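(* Let $\boldsymbol\Xi_T\in L^2(\Omega)^d$, $\beta\ge0$ and $$\mathcal J_\beta(\mathbf f)=\tfrac12\|\mathbf u(\cdot,T;\mathbf f)-\boldsymbol\Xi_T\|^2+\tfrac\beta2\|\mathbf f\|^2,\qquad\mathbf f\in L^2(\Omega)^d.$$ For $\mathbf f\in L^2(\Omega)^d$ let $\nabla\mathcal J_\beta[\mathbf f]\in L^2(\Omega)^d$ be the Riesz representer in $\mathcal H=L^2(\Omega)^d$ of the Gâteaux derivative of $\mathcal J_\beta$ at $\mathbf f$, i.e. the unique element with $\mathcal J_\beta'(\mathbf f;\delta_{\mathbf f})=(\nabla\mathcal J_\beta[\mathbf f],\delta_{\mathbf f})$ for all $\delta_{\mathbf f}\in L^2(\Omega)^d$. Then $$\nabla\mathcal J_\beta[\mathbf f]=-\frac1\rho\int_0^Tg(t)\,\mathbf u^\ast(\cdot,t;\mathbf f)\,dt+\beta\mathbf f\in L^2(\Omega)^d,$$ where $(\mathbf u^\ast,\theta^\ast)=(\mathbf u^\ast(\cdot;\mathbf f),\theta^\ast(\cdot;\mathbf f))$ is the solution of the adjoint problem $$\begin{cases}\rho\,\partial_{tt}\mathbf u^\ast-\nabla\cdot\sigma(\mathbf u^\ast)+\gamma T_0\nabla\partial_t\theta^\ast=\mathbf 0&\text{in }Q_T,\\-\rho C_s\partial_t\theta^\ast-\kappa\Delta\theta^\ast-K^\ast(\Delta\theta^\ast)-\gamma\nabla\cdot\mathbf u^\ast=0&\text{in }Q_T,\\\mathbf u^\ast=\mathbf 0,\ \theta^\ast=0&\text{on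 }\Sigma_T,\\\mathbf u^\ast(\cdot,T)=\mathbf 0,\ \partial_t\mathbf u^\ast(\cdot,T)=\mathbf u(\cdot,T;\mathbf f)-\boldsymbol\Xi_T,\ \theta^\ast(\cdot,T)=0&\text{in }\Omega.\end{cases}$$
   Context: Setting. $\Omega\subset\mathbb R^d$ ($d\in\mathbb N$) is open and bounded with Lipschitz boundary $\Gamma$; $T>0$; $Q_T=\Omega\times(0,T]$, $\Sigma_T=\Gamma\times(0,T]$. $\rho,C_s,\kappa,T_0,\lambda,\mu,\alpha_T$ are positive constants and $\gamma=\alpha_T(3\lambda+2\mu)>0$. $\epsilon(\mathbf u)=\frac12(\nabla\mathbf u+(\nabla\mathbf u)^\top)$, $\sigma(\mathbf u)=2\mu\,\epsilon(\mathbf u)+\lambda\,\mathrm{Tr}(\epsilon(\mathbf u))\,\mathrm{Id}$. The kernel $k\in C^2([0,T])$ is strongly positive definite (in the standard sense for convolution kernels) and satisfies $\lim_{t\to\infty}k(t)=0$, $(-1)^jk^{(j)}(t)\ge 0$ for $j=0,1,2$ and $t\in[0,T]$, $k'\not\equiv0$. $(k\ast z)(\mathbf x,t)=\int_0^tk(t-s)z(\mathbf x,s)\,ds$ and $K^\ast(z)(s)=\int_s^Tk(t-s)z(t)\,dt$, $s\in[0,T]$. $(\cdot,\cdot)$ and $\|\cdot\|$ denote the inner product and norm of $L^2(\Omega)$, $L^2(\Omega)^d$ and $L^2(\Omega)^{d\times d}$. Function $g$: $g\in C^1([0,T])$ with $\partial_t(g(t)^2)>0$ for all $t\in[0,T]$.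 Problem $(P_1)$ with source $\mathbf f\in L^2(\Omega)^d$: $\rho\,\partial_{tt}\mathbf u-\nabla\cdot\sigma(\mathbf u)+\gamma\nabla\theta=g(t)\mathbf f(\mathbf x)$ in $Q_T$; $\rho C_s\partial_t\theta-\kappa\Delta\theta-k\ast\Delta\theta+T_0\gamma\nabla\cdot\partial_t\mathbf u=0$ in $Q_T$; $\mathbf u=\mathbf 0$, $\theta=0$ on $\Sigma_T$; $\mathbf u(\cdot,0)=\mathbf 0$, $\partial_t\mathbf u(\cdot,0)=\mathbf 0$, $\theta(\cdot,0)=0$ in $\Omega$. Solutions are weak: $(\mathbf u(t),\theta(t))\in H_0^1(\Omega)^d\times H_0^1(\Omega)$, and for a.e. $t$ and all $\boldsymbol\varphi\in H^1_0(\Omega)^d$, $\psi\in H^1_0(\Omega)$: $\rho(\partial_{tt}\mathbf u,\boldsymbol\varphi)+\mu(\nabla\mathbf u,\nabla\boldsymbol\varphi)+(\lambda+\mu)(\nabla\cdot\mathbf u,\nabla\cdot\boldsymbol\varphi)+\gamma(\nabla\theta,\boldsymbol\varphi)=(g(t)\mathbf f,\boldsymbol\varphi)$ and $\rho C_s(\partial_t\theta,\psi)+\kappa(\nabla\theta,\nabla\psi)+(k\ast\nabla\theta,\nabla\psi)-T_0\gamma(\partial_t\mathbf u,\nabla\psi)=0$. There is a unique weak solution $(\mathbf u(\cdot,\cdot;\mathbf f),\theta(\cdot,\cdot;\mathbf f))$ (known), with $\mathbf u\in C([0,T],H_0^1(\Omega)^d)$, $\partial_t\mathbf u\in C([0,T],L^2(\Omega)^d)\cap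 L^2((0,T),H_0^1(\Omega)^d)$, $\partial_{tt}\mathbf u\in L^2((0,T),L^2(\Omega)^d)$, $\theta\in C([0,T],H_0^1(\Omega))$, $\partial_t\theta\in L^2((0,T),H^1_0(\Omega))$. The adjoint problem is a terminal-value problem, understood in the analogous weak sense and regarded as well posed. The Gâteaux derivative is $\mathcal J'_\beta(\mathbf f;\delta_{\mathbf f})=\lim_{\varepsilon\to0}\varepsilon^{-1}(\mathcal J_\beta(\mathbf f+\varepsilon\delta_{\mathbf f})-\mathcal J_\beta(\mathbf f))$, which is a bounded linear functional of $\delta_{\mathbf f}\in L^2(\Omega)^d$. *)

theory Defs
  imports "HOL-Analysis.Analysis"
begin

section \<open>The Hilbert space of square-integrable functions\<close>

definition sq_int :: "('a::euclidean_space \<Rightarrow> 'b::euclidean_space) \<Rightarrow> bool" where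
  "sq_int f \<longleftrightarrow> f \<in> borel_measurable lborel \<and> integrable lborel (\<lambda>x. (norm (f x))\<^sup>2)"

definition l2_rel :: "('a::euclidean_space \<Rightarrow> 'b::euclidean_space) \<Rightarrow> ('a \<Rightarrow> 'b) \<Rightarrow> bool" where
  "l2_rel f g \<longleftrightarrow> sq_int f \<and> sq_int g \<and> (AE x in lborel. f x = g x)"

lemma sq_int_zero: "sq_int (\<lambda>x. 0)"
  by (simp add: sq_int_def)

lemma sq_int_scale: "sq_int f \<Longrightarrow> sq_int (\<lambda>x. c *\<^sub>R f x)"
  by (auto simp: sq_int_def power_mult_distrib)

lemma norm_add_sq_le: "(norm (a + b))\<^sup>2 \<le> 2 * (norm a)\<^sup>2 + 2 * (norm b)\<^sup>2" for a b :: "'b::real_inner"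
proof -
  have "(norm (a + b))\<^sup>2 + (norm (a - b))\<^sup>2 = 2 * (norm a)\<^sup>2 + 2 * (norm b)\<^sup>2"
    by (simp add: power2_norm_eq_inner inner_diff inner_add inner_commute)
  then show ?thesis by (smt (verit) zero_le_power2)
qed

lemma sq_int_add:
  fixes f g :: "'a::euclidean_space \<Rightarrow> 'b::euclidean_space"
  assumes "sq_int f" "sq_int g" shows "sq_int (\<lambda>x. f x + g x)"
proof -
  have [measurable]: "f \<in> borel_measurable lborel" "g \<in> borel_measurable lborel"
    using assms by (auto simp: sq_int_def)
  have "integrable lborel (\<lambda>x. (norm (f x + g x))\<^sup>2)"
  proof (rule Bochner_Integration.integrable_bound)
    show "integrable lborel (\<lambda>x. 2 * (norm (f x))\<^sup>2 + 2 * (norm (g x))\<^sup>2)"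
      using assms by (auto simp: sq_int_def)
    show "AE x in lborel. norm ((norm (f x + g x))\<^sup>2) \<le> norm (2 * (norm (f x))\<^sup>2 + 2 * (norm (g x))\<^sup>2)"
      using norm_add_sq_le by (auto intro!: AE_I2)
  qed simp
  then show ?thesis by (simp add: sq_int_def)
qed

lemma sq_int_uminus: "sq_int f \<Longrightarrow> sq_int (\<lambda>x. - f x)"
  using sq_int_scale[of f "-1"] by simp

lemma sq_int_diff: "sq_int f \<Longrightarrow> sq_int g \<Longrightarrow> sq_int (\<lambda>x. f x - g x)"
  using sq_int_add[of f "\<lambda>x. - g x"] sq_int_uminus[of g] by simp

lemma sq_int_inner:
  assumes "sq_int f" "sq_int g" shows "integrable lborel (\<lambda>x. f x \<bullet> g x)"
proof (rule Bochner_Integration.integrable_bound)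
  have [measurable]: "f \<in> borel_measurable lborel" "g \<in> borel_measurable lborel"
    using assms by (auto simp: sq_int_def)
  show "integrable lborel (\<lambda>x. (norm (f x))\<^sup>2 + (norm (g x))\<^sup>2)"
    using assms by (auto simp: sq_int_def)
  show "AE x in lborel. norm (f x \<bullet> g x) \<le> norm ((norm (f x))\<^sup>2 + (norm (g x))\<^sup>2)"
  proof (rule AE_I2)
    fix x
    have "\<bar>f x \<bullet> g x\<bar> \<le> norm (f x) * norm (g x)" by (rule Cauchy_Schwarz_ineq2)
    also have "\<dots> \<le> 2 * norm (f x) * norm (g x)" by simp
    also have "\<dots> \<le> (norm (f x))\<^sup>2 + (norm (g x))\<^sup>2" by (rule sum_squares_bound)
    finally show "norm (f x \<bullet> g x) \<le> norm ((norm (f x))\<^sup>2 + (norm (g x))\<^sup>2)" by simp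
  qed
qed (use assms in \<open>auto simp: sq_int_def\<close>)

text \<open>Elements of \<open>('a, 'b) l2\<close> are the classes of Borel functions \<open>'a \<Rightarrow> 'b\<close>, square
  integrable over the whole space, modulo equality almost everywhere.\<close>

quotient_type (overloaded) ('a, 'b) l2 = "'a::euclidean_space \<Rightarrow> 'b::euclidean_space" / partial: l2_rel
proof (rule part_equivpI)
  show "\<exists>x. l2_rel x (x :: 'a \<Rightarrow> 'b)"
    by (rule exI[of _ "\<lambda>x. 0"]) (simp add: l2_rel_def sq_int_zero)
  show "symp (l2_rel :: ('a \<Rightarrow> 'b) \<Rightarrow> _)"
    by (auto simp: symp_def l2_rel_def elim: AE_mp)
  show "transp (l2_rel :: ('a \<Rightarrow> 'b) \<Rightarrow> _)"
    by (auto simp: transp_def l2_rel_def elim: AE_mp)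
qed

instantiation l2 :: (euclidean_space, euclidean_space) real_vector
begin

lift_definition zero_l2 :: "('a, 'b) l2" is "\<lambda>x. 0"
  by (simp add: l2_rel_def sq_int_zero)
lift_definition plus_l2 :: "('a, 'b) l2 \<Rightarrow> ('a, 'b) l2 \<Rightarrow> ('a, 'b) l2" is "\<lambda>f g x. f x + g x"
  by (auto simp: l2_rel_def sq_int_add)
lift_definition minus_l2 :: "('a, 'b) l2 \<Rightarrow> ('a, 'b) l2 \<Rightarrow> ('a, 'b) l2" is "\<lambda>f g x. f x - g x"
  by (auto simp: l2_rel_def sq_int_diff)
lift_definition uminus_l2 :: "('a, 'b) l2 \<Rightarrow> ('a, 'b) l2" is "\<lambda>f x. - f x"
  by (auto simp: l2_rel_def sq_int_uminus)
lift_definition scaleR_l2 :: "real \<Rightarrow> ('a, 'b) l2 \<Rightarrow> ('a, 'b) l2" is "\<lambda>c f x. c *\<^sub>R f x"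
  by (auto simp: l2_rel_def sq_int_scale)

instance
  by standard
    (transfer; auto simp: l2_rel_def sq_int_add sq_int_scale sq_int_diff sq_int_uminus sq_int_zero
      algebra_simps)+

end

instantiation l2 :: (euclidean_space, euclidean_space) real_inner
begin

lift_definition inner_l2 :: "('a, 'b) l2 \<Rightarrow> ('a, 'b) l2 \<Rightarrow> real" is
  "\<lambda>f g. LINT x|lborel. f x \<bullet> g x"
proof -
  fix f f' g g' :: "'a \<Rightarrow> 'b"
  assume *: "l2_rel f f'" "l2_rel g g'"
  then have [measurable]: "f \<in> borel_measurable lborel" "g \<in> borel_measurable lborel"
      "f' \<in> borel_measurable lborel" "g' \<in> borel_measurable lborel"
    by (auto simp: l2_rel_def sq_int_def)
  show "(LINT x|lborel. f x \<bullet> g x) = (LINT x|lborel. f' x \<bullet> g' x)"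
    using * by (intro integral_cong_AE) (auto simp: l2_rel_def)
qed

definition norm_l2 :: "('a, 'b) l2 \<Rightarrow> real" where "norm_l2 f = sqrt (f \<bullet> f)"
definition sgn_l2 :: "('a, 'b) l2 \<Rightarrow> ('a, 'b) l2" where "sgn_l2 f = f /\<^sub>R norm f"
definition dist_l2 :: "('a, 'b) l2 \<Rightarrow> ('a, 'b) l2 \<Rightarrow> real" where "dist_l2 f g = norm (f - g)"
definition uniformity_l2 :: "(('a, 'b) l2 \<times> ('a, 'b) l2) filter"
  where "uniformity_l2 = (INF e\<in>{0 <..}. principal {(x, y). dist x y < e})"
definition open_l2 :: "('a, 'b) l2 set \<Rightarrow> bool"
  where "open_l2 S = (\<forall>x\<in>S. \<forall>\<^sub>F (x', y) in uniformity. x' = x \<longrightarrow> y \<in> S)"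

instance
proof
  fix f g h :: "('a, 'b) l2" and r :: real
  show "f \<bullet> g = g \<bullet> f" by transfer (simp add: inner_commute)
  show "(f + g) \<bullet> h = f \<bullet> h + g \<bullet> h"
    by transfer (simp add: inner_add_left l2_rel_def sq_int_inner)
  show "(r *\<^sub>R f) \<bullet> g = r * (f \<bullet> g)" by transfer simp
  show "0 \<le> f \<bullet> f" by transfer simp
  show "(f \<bullet> f = 0) = (f = 0)"
  proof transfer
    fix f :: "'a \<Rightarrow> 'b" assume "l2_rel f f"
    then have f: "sq_int f" by (simp add: l2_rel_def)
    then show "((LINT x|lborel. f x \<bullet> f x) = 0) = l2_rel f (\<lambda>x. 0)"
      using sq_int_inner[OF f f]
      by (subst integral_nonneg_eq_0_iff_AE) (auto simp: l2_rel_def sq_int_zero)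
  qed
qed (rule norm_l2_def sgn_l2_def dist_l2_def uniformity_l2_def open_l2_def)+

end

lemma l2_rel_rep: "l2_rel (rep_l2 v) (rep_l2 v)"
  by (rule Quotient3_rep_reflp[OF Quotient3_l2])

lemma sq_int_rep: "sq_int (rep_l2 v)"
  using l2_rel_rep[of v] by (simp add: l2_rel_def)

lemma abs_rep_l2: "abs_l2 (rep_l2 v) = v"
  by (rule Quotient3_abs_rep[OF Quotient3_l2])

lemma rep_abs_l2: "sq_int f \<Longrightarrow> AE x in lborel. rep_l2 (abs_l2 f) x = f x"
  using Quotient3_rep_abs[OF Quotient3_l2, of f] by (auto simp: l2_rel_def)

lemma abs_l2_diff: "sq_int f \<Longrightarrow> sq_int g \<Longrightarrow> abs_l2 f - abs_l2 g = abs_l2 (\<lambda>x. f x - g x)"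
  by (simp add: minus_l2.abs_eq l2_rel_def)

lemma abs_l2_add: "sq_int f \<Longrightarrow> sq_int g \<Longrightarrow> abs_l2 f + abs_l2 g = abs_l2 (\<lambda>x. f x + g x)"
  by (simp add: plus_l2.abs_eq l2_rel_def)

lemma abs_l2_scale: "sq_int f \<Longrightarrow> c *\<^sub>R abs_l2 f = abs_l2 (\<lambda>x. c *\<^sub>R f x)"
  by (simp add: scaleR_l2.abs_eq l2_rel_def)

lemma norm_abs_l2: "sq_int f \<Longrightarrow> (norm (abs_l2 f))\<^sup>2 = (LINT x|lborel. (norm (f x))\<^sup>2)"
  by (simp add: power2_norm_eq_inner inner_l2.abs_eq l2_rel_def)

lemma l2_dominated_convergence:
  fixes s :: "nat \<Rightarrow> 'a::euclidean_space \<Rightarrow> 'b::euclidean_space"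
  assumes s: "\<And>i. s i \<in> borel_measurable lborel" and f: "f \<in> borel_measurable lborel"
    and w: "sq_int w"
    and lim: "\<And>x. (\<lambda>i. s i x) \<longlonglongrightarrow> f x" and bound: "\<And>i x. norm (s i x) \<le> norm (w x :: 'b)"
  shows "(\<lambda>i. abs_l2 (s i)) \<longlonglongrightarrow> abs_l2 f"
proof -
  have w2: "integrable lborel (\<lambda>x. (norm (w x))\<^sup>2)" and [measurable]: "w \<in> borel_measurable lborel"
    using w by (auto simp: sq_int_def)
  note [measurable] = s f
  have bf: "norm (f x) \<le> norm (w x)" for x
    by (rule LIMSEQ_le_const2[OF tendsto_norm[OF lim[of x]]]) (use bound in auto)
  have "sq_int h" if [measurable]: "h \<in> borel_measurable lborel" and "\<And>x. norm (h x) \<le> norm (w x)" for h :: "'a \<Rightarrow> 'b"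
    unfolding sq_int_def using that
    by (intro conjI Bochner_Integration.integrable_bound[OF w2]) (auto intro!: AE_I2 power_mono)
  then have sq: "sq_int (s i)" "sq_int f" for i using bound bf s f by auto
  have "(\<lambda>i. LINT x|lborel. (norm (s i x - f x))\<^sup>2) \<longlonglongrightarrow> (LINT x|(lborel :: 'a measure). (0::real))"
  proof (rule integral_dominated_convergence)
    show "integrable lborel (\<lambda>x. (norm (w x))\<^sup>2 * 4)" using w2 by simp
    show "AE x in lborel. (\<lambda>i. (norm (s i x - f x))\<^sup>2) \<longlonglongrightarrow> 0"
    proof (rule AE_I2)
      fix x
      have "(\<lambda>i. s i x - f x) \<longlonglongrightarrow> 0" using lim[of x] by (simp add: LIM_zero)
      from tendsto_power[OF tendsto_norm[OF this], of 2]
      show "(\<lambda>i. (norm (s i x - f x))\<^sup>2) \<longlonglongrightarrow> 0" by simp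
    qed
    show "AE x in lborel. norm ((norm (s i x - f x))\<^sup>2) \<le> (norm (w x))\<^sup>2 * 4" for i
    proof (rule AE_I2)
      fix x
      have "norm (s i x - f x) \<le> 2 * norm (w x)"
        using norm_triangle_ineq4[of "s i x" "f x"] bound[of i x] bf[of x] by linarith
      from power_mono[OF this, of 2] show "norm ((norm (s i x - f x))\<^sup>2) \<le> (norm (w x))\<^sup>2 * 4"
        by (simp add: power_mult_distrib)
    qed
  qed auto
  then have "(\<lambda>i. (norm (abs_l2 (s i) - abs_l2 f))\<^sup>2) \<longlonglongrightarrow> 0"
    by (simp add: abs_l2_diff norm_abs_l2 sq sq_int_diff)
  from tendsto_real_sqrt[OF this] have "(\<lambda>i. norm (abs_l2 (s i) - abs_l2 f)) \<longlonglongrightarrow> 0" by simp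
  then show ?thesis by (simp add: LIM_zero_iff tendsto_norm_zero_iff)
qed

lemma quarter_power: "(2 * (1/2)^i)\<^sup>2 = (4 * (1/4)^i :: real)"
proof -
  have "(2 * (1/2)^i)\<^sup>2 = (4 * ((1/2)\<^sup>2)^i :: real)"
    by (simp add: power_mult_distrib mult.commute flip: power_mult)
  then show ?thesis by (simp add: power_divide)
qed

lemma ennreal_half_power: "ennreal (2^i) * ennreal (4 * (1/4)^i) = ennreal (4 * (1/2)^i)"
proof -
  have "(2::real)^i * (4 * (1/4)^i) = 4 * (2 * (1/4))^i"
    by (simp only: power_mult_distrib mult.left_commute)
  then show ?thesis by (simp flip: ennreal_mult)
qed

instance l2 :: (euclidean_space, euclidean_space) complete_space
proof
  fix X :: "nat \<Rightarrow> ('a, 'b) l2" assume X: "Cauchy X"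
  have "\<exists>n. \<forall>m\<ge>n. norm (X m - X n) < (1/2)^i" for i
  proof -
    have "(0::real) < (1/2)^i" by simp
    from CauchyD[OF X this] show ?thesis by blast
  qed
  then obtain N0 where N0: "\<And>i m. m \<ge> N0 i \<Longrightarrow> norm (X m - X (N0 i)) < (1/2)^i" by metis
  define N where "N i = Max (N0 ` {..i}) + i" for i
  have N_ge: "N i \<ge> N0 i" for i by (auto simp: N_def intro!: trans_le_add1 Max_ge)
  have N_mono: "N i \<le> N j" if "i \<le> j" for i j
    unfolding N_def using that by (intro add_mono Max_mono image_mono) auto
  have N: "norm (X m - X (N i)) < 2 * (1/2)^i" if "m \<ge> N i" for i m
  proof -
    have "norm (X m - X (N i)) \<le> norm (X m - X (N0 i)) + norm (X (N i) - X (N0 i))"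
      using norm_triangle_ineq4[of "X m - X (N0 i)" "X (N i) - X (N0 i)"] by simp
    also have "\<dots> < 2 * (1/2)^i"
      using N0[of i m] N0[of i "N i"] N_ge[of i] that by linarith
    finally show ?thesis .
  qed
  define f where "f i = rep_l2 (X (N i))" for i
  have sq: "sq_int (f i)" for i by (simp add: f_def sq_int_rep)
  then have [measurable]: "f i \<in> borel_measurable borel" for i by (simp add: sq_int_def)
  have Xf: "X (N i) = abs_l2 (f i)" for i by (simp add: f_def abs_rep_l2)
  have nd: "(\<integral>\<^sup>+x. ennreal ((norm (f j x - f i x))\<^sup>2) \<partial>lborel) \<le> ennreal (4 * (1/4)^i)" if "i \<le> j" for i j
  proof -
    have int: "integrable lborel (\<lambda>x. (norm (f j x - f i x))\<^sup>2)"
      using sq_int_diff[OF sq[of j] sq[of i]] by (simp add: sq_int_def)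
    have "norm (X (N j) - X (N i)) \<le> 2 * (1/2)^i"
      using N[of i "N j"] N_mono[OF that] by simp
    then have "(norm (X (N j) - X (N i)))\<^sup>2 \<le> (2 * (1/2)^i)\<^sup>2"
      by (intro power_mono) auto
    also have "(2 * (1/2)^i)\<^sup>2 = (4 * (1/4)^i :: real)"
      by (rule quarter_power)
    finally have "(LINT x|lborel. (norm (f j x - f i x))\<^sup>2) \<le> 4 * (1/4)^i"
      by (simp add: Xf abs_l2_diff sq norm_abs_l2 sq_int_diff)
    then show ?thesis
      by (subst nn_integral_eq_integral[OF int]) (auto intro!: ennreal_leI)
  qed
  let ?d = "\<lambda>i x. ennreal (2^i * (norm (f (Suc i) x - f i x))\<^sup>2)"
  have "(\<integral>\<^sup>+x. (\<Sum>i. ?d i x) \<partial>lborel) = (\<Sum>i. \<integral>\<^sup>+x. ?d i x \<partial>lborel)"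
    by (rule nn_integral_suminf) simp
  also have "\<dots> \<le> (\<Sum>i. ennreal (4 * (1/2)^i))"
  proof (intro suminf_le summableI)
    fix i
    have "(\<integral>\<^sup>+x. ?d i x \<partial>lborel) = ennreal (2^i) * (\<integral>\<^sup>+x. ennreal ((norm (f (Suc i) x - f i x))\<^sup>2) \<partial>lborel)"
      by (subst nn_integral_cmult[symmetric]) (auto simp: ennreal_mult)
    also have "\<dots> \<le> ennreal (2^i) * ennreal (4 * (1/4)^i)"
      by (intro mult_left_mono nd) auto
    also have "\<dots> = ennreal (4 * (1/2)^i)"
      by (rule ennreal_half_power)
    finally show "(\<integral>\<^sup>+x. ?d i x \<partial>lborel) \<le> ennreal (4 * (1/2)^i)" .
  qed
  also have "\<dots> < \<infinity>"
    by (subst suminf_ennreal2) (auto intro!: summable_mult summable_geometric)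
  finally have "AE x in lborel. (\<Sum>i. ?d i x) \<noteq> \<infinity>"
    by (intro nn_integral_PInf_AE) auto
  then have conv: "AE x in lborel. convergent (\<lambda>i. f i x)"
  proof eventually_elim
    fix x assume fin: "(\<Sum>i. ?d i x) \<noteq> \<infinity>"
    have "\<exists>C\<ge>0. S = ennreal C" if "S \<noteq> \<infinity>" for S
      using that by (cases S) auto
    from this[OF fin] obtain C where C: "0 \<le> C" "(\<Sum>i. ?d i x) = ennreal C"
      by (elim exE conjE) (rule that)
    have le: "norm (f (Suc i) x - f i x) \<le> sqrt C * (sqrt (1/2))^i" for i
    proof -
      have "(\<Sum>i\<in>{i}. ?d i x) \<le> (\<Sum>i. ?d i x)"
        by (rule sum_le_suminf) auto
      then have "?d i x \<le> ennreal C"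
        unfolding C(2) by (simp only: sum.insert sum.empty finite.intros empty_iff add_0_right not_False_eq_True)
      then have "2^i * (norm (f (Suc i) x - f i x))\<^sup>2 \<le> C"
        by (rule ennreal_le_iff[OF C(1), THEN iffD1])
      then have "(norm (f (Suc i) x - f i x))\<^sup>2 \<le> C * (1/2)^i"
        by (simp only: power_one_over) (simp add: divide_simps mult.commute)
      then have "sqrt ((norm (f (Suc i) x - f i x))\<^sup>2) \<le> sqrt (C * (1/2)^i)"
        by (rule real_sqrt_le_mono)
      then show ?thesis
        by (simp only: real_sqrt_abs abs_norm_cancel real_sqrt_mult) (simp only: real_sqrt_power)
    qed
    have "summable (\<lambda>i. f (Suc i) x - f i x)"
    proof (rule summable_comparison_test')
      show "summable (\<lambda>i. sqrt C * (sqrt (1/2))^i)"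
        by (intro summable_mult summable_geometric) (simp add: real_sqrt_divide)
    qed (use le in auto)
    then have "convergent (\<lambda>n. (f n x - f 0 x) + f 0 x)"
      by (intro convergent_add convergent_const)
        (simp add: summable_iff_convergent sum_lessThan_telescope[of "\<lambda>i. f i x"])
    then show "convergent (\<lambda>i. f i x)" by simp
  qed
  define g where "g x = lim (\<lambda>i. f i x)" for x
  have [measurable]: "g \<in> borel_measurable borel"
    unfolding g_def by simp
  have gl: "AE x in lborel. (\<lambda>i. f i x) \<longlonglongrightarrow> g x"
    using conv by eventually_elim (simp add: g_def convergent_LIMSEQ_iff)
  have ng: "(\<integral>\<^sup>+x. ennreal ((norm (g x - f i x))\<^sup>2) \<partial>lborel) \<le> ennreal (4 * (1/4)^i)" for i
  proof -
    have "(\<integral>\<^sup>+x. ennreal ((norm (g x - f i x))\<^sup>2) \<partial>lborel)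
        = (\<integral>\<^sup>+x. liminf (\<lambda>j. ennreal ((norm (f j x - f i x))\<^sup>2)) \<partial>lborel)"
    proof (rule nn_integral_cong_AE)
      show "AE x in lborel. ennreal ((norm (g x - f i x))\<^sup>2) = liminf (\<lambda>j. ennreal ((norm (f j x - f i x))\<^sup>2))"
        using gl
      proof eventually_elim
        fix x assume "(\<lambda>i. f i x) \<longlonglongrightarrow> g x"
        then have "(\<lambda>j. ennreal ((norm (f j x - f i x))\<^sup>2)) \<longlonglongrightarrow> ennreal ((norm (g x - f i x))\<^sup>2)"
          by (intro tendsto_ennrealI tendsto_intros)
        then show "ennreal ((norm (g x - f i x))\<^sup>2) = liminf (\<lambda>j. ennreal ((norm (f j x - f i x))\<^sup>2))"
          by (intro lim_imp_Liminf[symmetric]) auto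
      qed
    qed
    also have "\<dots> \<le> liminf (\<lambda>j. \<integral>\<^sup>+x. ennreal ((norm (f j x - f i x))\<^sup>2) \<partial>lborel)"
      by (rule nn_integral_liminf) simp
    also have "\<dots> \<le> ennreal (4 * (1/4)^i)"
    proof (rule Liminf_le)
      show "\<forall>\<^sub>F j in sequentially. (\<integral>\<^sup>+x. ennreal ((norm (f j x - f i x))\<^sup>2) \<partial>lborel) \<le> ennreal (4 * (1/4)^i)"
        using eventually_ge_at_top[of i] by eventually_elim (rule nd)
    qed simp
    finally show ?thesis .
  qed
  have "sq_int (\<lambda>x. g x - f 0 x)"
    unfolding sq_int_def
  proof (intro conjI integrableI_bounded)
    show "(\<integral>\<^sup>+x. ennreal (norm ((norm (g x - f 0 x))\<^sup>2)) \<partial>lborel) < \<infinity>"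
      using ng[of 0] by (auto intro: le_less_trans)
  qed simp_all
  from sq_int_add[OF this sq[of 0]] have sg: "sq_int g" by simp
  have lim: "norm (abs_l2 g - X (N i)) \<le> 2 * (1/2)^i" for i
  proof -
    have int: "integrable lborel (\<lambda>x. (norm (g x - f i x))\<^sup>2)"
      using sq_int_diff[OF sg sq[of i]] by (simp add: sq_int_def)
    have "ennreal (LINT x|lborel. (norm (g x - f i x))\<^sup>2) \<le> ennreal (4 * (1/4)^i)"
      using ng[of i] by (subst (asm) nn_integral_eq_integral[OF int]) auto
    then have "(norm (abs_l2 g - X (N i)))\<^sup>2 \<le> 4 * (1/4)^i"
      by (simp add: Xf abs_l2_diff sq sg norm_abs_l2 sq_int_diff)
    also have "\<dots> = (2 * (1/2)^i)\<^sup>2"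
      by (rule quarter_power[symmetric])
    finally show ?thesis by (rule power2_le_imp_le) simp
  qed
  have "X \<longlonglongrightarrow> abs_l2 g"
  proof (rule LIMSEQ_I)
    fix r :: real assume "r > 0"
    then obtain i where i: "(1/2)^i < r / 4" using real_arch_pow_inv[of "r/4" "1/2"] by auto
    have "norm (X m - abs_l2 g) < r" if "m \<ge> N i" for m
    proof -
      have "norm (X m - abs_l2 g) \<le> norm (X m - X (N i)) + norm (abs_l2 g - X (N i))"
        using norm_triangle_ineq4[of "X m - X (N i)" "abs_l2 g - X (N i)"] by simp
      also have "\<dots> < 4 * (1/2)^i" using N[OF that] lim[of i] by linarith
      finally show ?thesis using i by linarith
    qed
    then show "\<exists>no. \<forall>n\<ge>no. norm (X n - abs_l2 g) < r" by blast
  qed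
  then show "convergent X" by (auto simp: convergent_def)
qed

instance l2 :: (euclidean_space, euclidean_space) banach ..

lemma countable_dense_subspace:
  fixes K :: "'v::real_normed_vector set"
  assumes "countable K"
  obtains D where "countable D" "K \<subseteq> closure D" "subspace (closure D)"
proof -
  define comb where "comb xs = sum_list (map (\<lambda>(q, k). of_rat q *\<^sub>R k) xs)" for xs :: "(rat \<times> 'v) list"
  define D where "D = comb ` lists (UNIV \<times> K)"
  have cD: "countable D"
    unfolding D_def using assms by (intro countable_image countable_lists countable_SIGMA) auto
  have KD: "K \<subseteq> D"
  proof
    fix k assume "k \<in> K"
    then have "comb [(1, k)] \<in> D" unfolding D_def by (intro imageI) auto
    then show "k \<in> D" by (simp add: comb_def)
  qed
  have zero: "0 \<in> D"
    unfolding D_def by (rule image_eqI[of _ _ "[]"]) (auto simp: comb_def)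
  have add: "x + y \<in> D" if xy: "x \<in> D" "y \<in> D" for x y
  proof -
    obtain xs ys where *: "x = comb xs" "y = comb ys" "xs \<in> lists (UNIV \<times> K)" "ys \<in> lists (UNIV \<times> K)"
      using xy by (auto simp: D_def)
    then have "x + y = comb (xs @ ys)" by (simp add: comb_def)
    then show ?thesis unfolding D_def using * by (intro image_eqI[of _ _ "xs @ ys"]) auto
  qed
  have scale: "of_rat q *\<^sub>R x \<in> D" if x: "x \<in> D" for q x
  proof -
    obtain xs where *: "x = comb xs" "xs \<in> lists (UNIV \<times> K)"
      using x by (auto simp: D_def)
    have "of_rat q *\<^sub>R comb xs = comb (map (\<lambda>(r, k). (q * r, k)) xs)"
      by (induction xs) (auto simp: comb_def of_rat_mult scaleR_add_right)
    moreover have "map (\<lambda>(r, k). (q * r, k)) xs \<in> lists (UNIV \<times> K)"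
      using *(2) by (induction xs) auto
    ultimately show ?thesis using * by (auto simp: D_def)
  qed
  have "subspace (closure D)"
  proof (rule subspaceI)
    show "0 \<in> closure D" using zero closure_subset by blast
    show "x + y \<in> closure D" if xy: "x \<in> closure D" "y \<in> closure D" for x y
    proof -
      obtain a where a: "\<forall>n. a n \<in> D" "a \<longlonglongrightarrow> x"
        using xy(1) unfolding closure_sequential by blast
      obtain b where b: "\<forall>n. b n \<in> D" "b \<longlonglongrightarrow> y"
        using xy(2) unfolding closure_sequential by blast
      from a b show ?thesis
        unfolding closure_sequential by (intro exI[of _ "\<lambda>n. a n + b n"]) (auto intro: add tendsto_add)
    qed
    show "c *\<^sub>R x \<in> closure D" if x: "x \<in> closure D" for c x
    proof -
      obtain a where a: "\<forall>n. a n \<in> D" "a \<longlonglongrightarrow> x"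
        using x unfolding closure_sequential by blast
      have "\<exists>q. \<bar>of_rat q - c\<bar> < 1 / real (Suc n)" for n
      proof -
        obtain q where "c < of_rat q" "of_rat q < c + 1 / real (Suc n)"
          using of_rat_dense[of c "c + 1 / real (Suc n)"] by auto
        then show ?thesis by (intro exI[of _ q]) auto
      qed
      then obtain q where q: "\<And>n. \<bar>of_rat (q n) - c\<bar> < 1 / real (Suc n)" by metis
      have "(\<lambda>n. of_rat (q n) - c) \<longlonglongrightarrow> 0"
      proof (rule Lim_null_comparison)
        show "\<forall>\<^sub>F n in sequentially. norm (of_rat (q n) - c) \<le> 1 / real (Suc n)"
          using q by (auto intro!: always_eventually less_imp_le)
        show "(\<lambda>n. 1 / real (Suc n)) \<longlonglongrightarrow> 0" using LIMSEQ_inverse_real_of_nat by (simp add: inverse_eq_divide)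
      qed
      then have "(\<lambda>n. of_rat (q n)) \<longlonglongrightarrow> c" by (simp add: LIM_zero_iff)
      then show ?thesis
        unfolding closure_sequential using a scale
        by (intro exI[of _ "\<lambda>n. of_rat (q n) *\<^sub>R a n"]) (auto intro: tendsto_scaleR)
    qed
  qed
  moreover have "K \<subseteq> closure D" using KD closure_subset by blast
  ultimately show ?thesis using that cD by blast
qed

lemma sq_int_indicator:
  fixes c :: "'b::euclidean_space"
  assumes [measurable]: "A \<in> sets borel" and "bounded A"
  shows "sq_int (\<lambda>x :: 'a::euclidean_space. indicator A x *\<^sub>R c)"
proof -
  have "emeasure lborel A < \<infinity>" using assms(2) by (rule emeasure_bounded_finite)
  then have "integrable lborel (\<lambda>x. indicator A x * (norm c)\<^sup>2)"
    by (intro integrable_mult_left) (auto intro: integrable_real_indicator)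
  moreover have "(norm (indicator A x *\<^sub>R c))\<^sup>2 = indicator A x * (norm c)\<^sup>2" for x
    by (auto simp: indicator_def)
  ultimately show ?thesis by (simp add: sq_int_def)
qed

lemma l2_separable: "\<exists>D :: ('a::euclidean_space, 'b::euclidean_space) l2 set. countable D \<and> closure D = UNIV"
proof -
  obtain B :: "'a set set" where B: "countable B" "topological_basis B"
    using ex_countable_basis by blast
  define E where "E = Inter ` {F. finite F \<and> F \<subseteq> B}"
  have cE: "countable E"
    unfolding E_def using B(1) by (intro countable_image countable_Collect_finite_subset)
  have openE: "open X" if "X \<in> E" for X
    using that topological_basis_open[OF B(2)] unfolding E_def by (auto intro!: open_Inter)
  have "B \<subseteq> E"
  proof
    fix X assume "X \<in> B"
    then show "X \<in> E" unfolding E_def by (intro image_eqI[of _ _ "{X}"]) auto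
  qed
  then have "topological_basis E"
    using B(2) openE unfolding topological_basis_def by (metis subset_iff)
  then have sets_E: "sets (borel :: 'a measure) = sigma_sets UNIV E"
    using borel_eq_countable_basis[OF cE] by (metis sets_measure_of subset_UNIV top_greatest subset_Pow_Union Pow_UNIV)
  have "Int_stable E"
  proof (rule Int_stableI)
    fix X Y assume "X \<in> E" "Y \<in> E"
    then obtain F G where "finite F" "F \<subseteq> B" "X = \<Inter> F" "finite G" "G \<subseteq> B" "Y = \<Inter> G"
      by (auto simp: E_def)
    then show "X \<inter> Y \<in> E"
      unfolding E_def by (intro image_eqI[of _ _ "F \<union> G"]) auto
  qed
  define Q where "Q n = cball (0 :: 'a) (real n)" for n
  have [measurable]: "Q n \<in> sets borel" for n by (simp add: Q_def)
  have bQ: "bounded (A \<inter> Q n)" for A n by (auto simp: Q_def intro: bounded_subset[OF bounded_cball])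
  define ind :: "'a set \<Rightarrow> nat \<Rightarrow> 'b \<Rightarrow> 'a \<Rightarrow> 'b" where "ind A n c = (\<lambda>x. indicator (A \<inter> Q n) x *\<^sub>R c)" for A n c
  define K where "K = (\<lambda>(A, n, c). abs_l2 (ind A n c)) ` (insert UNIV E \<times> UNIV \<times> Basis)"
  have "countable K"
    unfolding K_def using cE by (intro countable_image countable_SIGMA) (auto intro: countable_finite)
  then obtain D where D: "countable D" "K \<subseteq> closure D" "subspace (closure D)"
    by (rule countable_dense_subspace)
  have sqi: "sq_int (ind A n c)" if "A \<in> sets borel" for A n c
    unfolding ind_def using that bQ by (intro sq_int_indicator) auto
  have step1: "abs_l2 (ind A n c) \<in> closure D" if A: "A \<in> sets borel" and c: "c \<in> Basis" for A n c
  proof -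
    have "A \<in> sigma_sets UNIV E" using A by (simp add: sets_E)
    with \<open>Int_stable E\<close> have "Int_stable E" "E \<subseteq> Pow UNIV" "A \<in> sigma_sets UNIV E" by auto
    then show ?thesis
    proof (induction rule: sigma_sets_induct_disjoint)
      case (basic A)
      then have "abs_l2 (ind A n c) \<in> K" using c unfolding K_def by force
      then show ?case using D by auto
    next
      case empty
      have "ind {} n c = (\<lambda>x. 0)" by (simp add: ind_def)
      then have "abs_l2 (ind {} n c) = 0" by (simp add: zero_l2_def)
      then show ?case using subspace_0[OF D(3)] by simp
    next
      case (compl A)
      have "A \<in> sets borel" using compl by (simp add: sets_E)
      then have "abs_l2 (ind (UNIV - A) n c) = abs_l2 (ind UNIV n c) - abs_l2 (ind A n c)"
        using sqi[of UNIV n c] sqi[of A n c]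
        by (subst abs_l2_diff) (auto intro!: arg_cong[of _ _ abs_l2] simp: ind_def indicator_def fun_eq_iff)
      moreover have "abs_l2 (ind UNIV n c) \<in> K" using c unfolding K_def by force
      ultimately show ?case using compl D by (auto intro: subspace_diff)
    next
      case (union A)
      have Ab: "A i \<in> sets borel" for i using union by (auto simp: sets_E)
      define U where "U m = (\<Union>i<m. A i)" for m
      have Ub: "U m \<in> sets borel" for m unfolding U_def using Ab by auto
      have inU: "abs_l2 (ind (U m) n c) \<in> closure D" for m
      proof (induction m)
        case 0
        have "abs_l2 (ind (U 0) n c) = 0" by (simp add: zero_l2_def ind_def U_def)
        then show ?case using subspace_0[OF D(3)] by simp
      next
        case (Suc m)
        have dj: "U m \<inter> A m = {}"
        proof -
          have "A k \<inter> A m = {}" if "k < m" for k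
            using union(1) that by (auto simp: disjoint_family_on_def dest!: spec[of _ k] spec[of _ m])
          then show ?thesis by (auto simp: U_def)
        qed
        have "abs_l2 (ind (U (Suc m)) n c) = abs_l2 (ind (U m) n c) + abs_l2 (ind (A m) n c)"
        proof -
          have "ind (U (Suc m)) n c = (\<lambda>x. ind (U m) n c x + ind (A m) n c x)"
            using dj by (auto simp: ind_def indicator_def U_def lessThan_Suc fun_eq_iff)
          then show ?thesis by (simp add: abs_l2_add sqi Ub Ab)
        qed
        then show ?case using Suc union D by (auto intro: subspace_add)
      qed
      have "(\<lambda>m. abs_l2 (ind (U m) n c)) \<longlonglongrightarrow> abs_l2 (ind (\<Union>i. A i) n c)"
      proof (rule l2_dominated_convergence)
        show "sq_int (ind UNIV n c)" by (rule sqi) simp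
        show "norm (ind (U m) n c x) \<le> norm (ind UNIV n c x)" for m x
          by (auto simp: ind_def indicator_def)
        show "(\<lambda>m. ind (U m) n c x) \<longlonglongrightarrow> ind (\<Union>i. A i) n c x" for x
        proof (cases "x \<in> (\<Union>i. A i)")
          case True
          then obtain i where i: "x \<in> A i" by auto
          have "\<forall>\<^sub>F m in sequentially. ind (U m) n c x = ind (\<Union>i. A i) n c x"
            using eventually_gt_at_top[of i] by eventually_elim (use i in \<open>auto simp: ind_def indicator_def U_def\<close>)
          then show ?thesis by (rule tendsto_eventually)
        next
          case False
          then have "ind (U m) n c x = ind (\<Union>i. A i) n c x" for m
            by (auto simp: ind_def indicator_def U_def)
          then show ?thesis by simp
        qed
      qed (use sqi[OF Ub] sqi[of "\<Union>i. A i"] Ab in \<open>auto simp: sq_int_def\<close>)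
      then show ?case
        using inU by (rule closed_sequentially[OF closed_closure, rotated])
    qed
  qed
  have step2: "abs_l2 (ind A n c) \<in> closure D" if A: "A \<in> sets borel" for A n c
  proof -
    have "abs_l2 (\<lambda>x. \<Sum>b\<in>F. ind A n ((c \<bullet> b) *\<^sub>R b) x) \<in> closure D \<and> sq_int (\<lambda>x. \<Sum>b\<in>F. ind A n ((c \<bullet> b) *\<^sub>R b) x)"
      if "finite F" "F \<subseteq> Basis" for F
      using that
    proof induction
      case empty
      then show ?case using subspace_0[OF D(3)] by (simp add: zero_l2_def sq_int_zero)
    next
      case (insert b F)
      have "abs_l2 (\<lambda>x. ind A n ((c \<bullet> b) *\<^sub>R b) x) = (c \<bullet> b) *\<^sub>R abs_l2 (ind A n b)"
        using sqi[OF A, of n b]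
        by (subst abs_l2_scale) (auto intro!: arg_cong[of _ _ abs_l2] simp: ind_def)
      then have "abs_l2 (\<lambda>x. ind A n ((c \<bullet> b) *\<^sub>R b) x) \<in> closure D"
        using step1[OF A, of b n] insert.prems subspace_scale[OF D(3)] by simp
      moreover have "abs_l2 (\<lambda>x. \<Sum>b\<in>insert b F. ind A n ((c \<bullet> b) *\<^sub>R b) x)
          = abs_l2 (\<lambda>x. ind A n ((c \<bullet> b) *\<^sub>R b) x) + abs_l2 (\<lambda>x. \<Sum>b\<in>F. ind A n ((c \<bullet> b) *\<^sub>R b) x)"
        using insert sqi[OF A] by (subst abs_l2_add) auto
      ultimately show ?case
        using insert sqi[OF A] by (auto intro: subspace_add[OF D(3)] sq_int_add)
    qed
    from this[of Basis] have "abs_l2 (\<lambda>x. \<Sum>b\<in>Basis. ind A n ((c \<bullet> b) *\<^sub>R b) x) \<in> closure D" by simp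
    moreover have "(\<lambda>x. \<Sum>b\<in>Basis. ind A n ((c \<bullet> b) *\<^sub>R b) x) = ind A n c"
      by (simp only: ind_def euclidean_representation flip: scaleR_sum_right)
    ultimately show ?thesis by simp
  qed
  have step3: "abs_l2 f \<in> closure D" if f: "sq_int f" for f
  proof -
    have fm: "f \<in> borel_measurable lborel" using f by (simp add: sq_int_def)
    obtain s where s0: "\<forall>i. simple_function lborel (s i)"
        "\<forall>x\<in>space lborel. (\<lambda>i. s i x) \<longlonglongrightarrow> f x"
        "\<forall>i. \<forall>x\<in>space lborel. dist (s i x) 0 \<le> 2 * dist (f x) 0"
      using borel_measurable_implies_sequence_metric[OF fm, of 0] by blast
    have s: "simple_function lborel (s i)" "(\<lambda>i. s i x) \<longlonglongrightarrow> f x" "norm (s i x) \<le> 2 * norm (f x)" for i x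
      using s0 by simp_all
    define r where "r i x = indicator (Q i) x *\<^sub>R s i x" for i x
    have sm: "s i -` {y} \<in> sets borel" for i y
      using simple_functionD(2)[OF s(1), of i "{y}"] by simp
    have r: "abs_l2 (r i) \<in> closure D \<and> r i \<in> borel_measurable lborel" for i
    proof -
      have fin: "finite (range (s i))" using simple_functionD(1)[OF s(1), of i] by simp
      have "abs_l2 (\<lambda>x. \<Sum>y\<in>F. ind (s i -` {y}) i y x) \<in> closure D \<and> sq_int (\<lambda>x. \<Sum>y\<in>F. ind (s i -` {y}) i y x)"
        if "finite F" for F
        using that
      proof induction
        case empty
        then show ?case using subspace_0[OF D(3)] by (simp add: zero_l2_def sq_int_zero)
      next
        case (insert y F)
        have "abs_l2 (\<lambda>x. \<Sum>y\<in>insert y F. ind (s i -` {y}) i y x)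
            = abs_l2 (ind (s i -` {y}) i y) + abs_l2 (\<lambda>x. \<Sum>y\<in>F. ind (s i -` {y}) i y x)"
          using insert sqi[OF sm] by (subst abs_l2_add) auto
        then show ?case
          using insert sqi[OF sm] step2[OF sm] by (auto intro: subspace_add[OF D(3)] sq_int_add)
      qed
      from this[OF fin] have *: "abs_l2 (\<lambda>x. \<Sum>y\<in>range (s i). ind (s i -` {y}) i y x) \<in> closure D"
        "sq_int (\<lambda>x. \<Sum>y\<in>range (s i). ind (s i -` {y}) i y x)" by auto
      have "(\<Sum>y\<in>range (s i). ind (s i -` {y}) i y x) = r i x" for x
      proof -
        have "(\<Sum>y\<in>range (s i). ind (s i -` {y}) i y x) = (\<Sum>y\<in>{s i x}. ind (s i -` {y}) i y x)"
          using fin by (intro sum.mono_neutral_right) (auto simp: ind_def)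
        also have "\<dots> = r i x" by (simp add: ind_def r_def indicator_def)
        finally show ?thesis .
      qed
      then have "(\<lambda>x. \<Sum>y\<in>range (s i). ind (s i -` {y}) i y x) = r i" by (rule ext)
      with * show ?thesis by (simp only: sq_int_def)
    qed
    have "(\<lambda>i. abs_l2 (r i)) \<longlonglongrightarrow> abs_l2 f"
    proof (rule l2_dominated_convergence)
      show "sq_int (\<lambda>x. 2 *\<^sub>R f x)" by (rule sq_int_scale[OF f])
      show "norm (r i x) \<le> norm (2 *\<^sub>R f x)" for i x
        using s(3)[of i x] by (cases "x \<in> Q i") (simp_all add: r_def)
      show "(\<lambda>i. r i x) \<longlonglongrightarrow> f x" for x
      proof -
        obtain k :: nat where k: "norm x \<le> real k" using real_arch_simple by blast
        have "\<forall>\<^sub>F i in sequentially. s i x = r i x"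
          using eventually_ge_at_top[of k]
          by eventually_elim (use k in \<open>auto simp: r_def Q_def indicator_def\<close>)
        with s(2)[of x] show ?thesis by (rule Lim_transform_eventually)
      qed
      show "r i \<in> borel_measurable lborel" for i using r[of i] by (rule conjunct2)
    qed (rule fm)
    then show ?thesis
      by (rule closed_sequentially[OF closed_closure, rotated]) (rule conjunct1[OF r])
  qed
  have "v \<in> closure D" for v :: "('a, 'b) l2"
    using step3[OF sq_int_rep[of v]] by (simp add: abs_rep_l2)
  then show ?thesis using D(1) by auto
qed

instance l2 :: (euclidean_space, euclidean_space) second_countable_topology
proof
  obtain D :: "('a, 'b) l2 set" where D: "countable D" "closure D = UNIV"
    using l2_separable by blast
  define B where "B = (\<lambda>(d, n). ball d (1 / real (Suc n))) ` (D \<times> (UNIV :: nat set))"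
  have "countable B" unfolding B_def using D by (intro countable_image countable_SIGMA) auto
  moreover have "topological_basis B"
  proof (rule topological_basisI)
    show "open X" if "X \<in> B" for X using that by (auto simp: B_def)
    fix X and x :: "('a, 'b) l2" assume "open X" "x \<in> X"
    then obtain e where e: "e > 0" "ball x e \<subseteq> X" by (meson open_contains_ball)
    obtain n where n: "1 / real (Suc n) < e / 2"
      using e(1) nat_approx_posE[of "e / 2"] by auto
    obtain d where d: "d \<in> D" "dist d x < 1 / real (Suc n)"
      using D(2) closure_approachable[of x D] by (metis UNIV_I divide_pos_pos of_nat_0_less_iff zero_less_Suc zero_less_one)
    have "ball d (1 / real (Suc n)) \<subseteq> ball x e"
    proof
      fix y assume "y \<in> ball d (1 / real (Suc n))"
      then have "dist d y < 1 / real (Suc n)" by simp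
      then show "y \<in> ball x e"
        using dist_triangle3[of x y d] d(2) n by simp
    qed
    then show "\<exists>B'\<in>B. x \<in> B' \<and> B' \<subseteq> X"
      using d e by (intro bexI[of _ "ball d (1 / real (Suc n))"]) (auto simp: B_def)
  qed
  ultimately show "\<exists>B :: ('a, 'b) l2 set set. countable B \<and> open = generate_topology B"
    by (blast intro: topological_basis_imp_subbasis)
qed


section \<open>Sobolev spaces on a Lipschitz domain\<close>

text \<open>Near each boundary point the domain is the part above the graph of a Lipschitz function;
  the hyperplane carrying the graph is given by its unit normal \<open>e\<close>.\<close>

definition lipschitz_boundary :: "(real^'n) set \<Rightarrow> bool" where
  "lipschitz_boundary \<Omega> \<longleftrightarrow> (\<forall>x0\<in>frontier \<Omega>. \<exists>r>0. \<exists>e h L. norm e = 1 \<and>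
     L-lipschitz_on {y. y \<bullet> e = 0} (h :: real^'n \<Rightarrow> real) \<and>
     \<Omega> \<inter> ball x0 r = {x \<in> ball x0 r. x \<bullet> e > h (x - (x \<bullet> e) *\<^sub>R e)})"

definition pdiff :: "'n \<Rightarrow> (real^'n \<Rightarrow> real) \<Rightarrow> real^'n \<Rightarrow> real" where
  "pdiff i \<phi> x = frechet_derivative \<phi> (at x) (axis i 1)"

primrec C_k :: "nat \<Rightarrow> (real^'n \<Rightarrow> real) \<Rightarrow> bool" where
  "C_k 0 \<phi> \<longleftrightarrow> continuous_on UNIV \<phi>"
| "C_k (Suc m) \<phi> \<longleftrightarrow> (\<forall>x. \<phi> differentiable (at x)) \<and> (\<forall>i. C_k m (pdiff i \<phi>))"

definition test_fun :: "(real^'n) set \<Rightarrow> (real^'n \<Rightarrow> real) \<Rightarrow> bool" where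
  "test_fun \<Omega> \<phi> \<longleftrightarrow> (\<forall>m. C_k m \<phi>) \<and>
     compact (closure {x. \<phi> x \<noteq> 0}) \<and> closure {x. \<phi> x \<noteq> 0} \<subseteq> \<Omega>"

text \<open>\<open>L\<^sup>2(\<Omega>)\<close> is identified, by extension by zero, with the closed subspace of classes vanishing
  almost everywhere outside \<open>\<Omega>\<close>; the inner product and the norm are then those of \<open>l2\<close>. The value
  type \<open>'b\<close> is \<open>real\<close> for scalar, \<open>real^'n\<close> for vector and \<open>real^'n^'n\<close> for matrix fields.\<close>

definition L2 :: "'a::euclidean_space set \<Rightarrow> ('a, 'b::euclidean_space) l2 set" where
  "L2 \<Omega> = {v. AE x in lborel. x \<notin> \<Omega> \<longrightarrow> rep_l2 v x = 0}"

definition has_weak_grad ::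
    "(real^'n) set \<Rightarrow> (real^'n, real) l2 \<Rightarrow> (real^'n, real^'n) l2 \<Rightarrow> bool" where
  "has_weak_grad \<Omega> v G \<longleftrightarrow> v \<in> L2 \<Omega> \<and> G \<in> L2 \<Omega> \<and> (\<forall>\<phi>. test_fun \<Omega> \<phi> \<longrightarrow> (\<forall>i.
     (LINT x|lborel. rep_l2 v x * pdiff i \<phi> x) = - (LINT x|lborel. (rep_l2 G x $ i) * \<phi> x)))"

definition H1 :: "(real^'n) set \<Rightarrow> (real^'n, real) l2 set" where
  "H1 \<Omega> = {v. \<exists>G. has_weak_grad \<Omega> v G}"

definition grad :: "(real^'n) set \<Rightarrow> (real^'n, real) l2 \<Rightarrow> (real^'n, real^'n) l2" where
  "grad \<Omega> v = (THE G. has_weak_grad \<Omega> v G)"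

definition H1_norm :: "(real^'n) set \<Rightarrow> (real^'n, real) l2 \<Rightarrow> real" where
  "H1_norm \<Omega> v = sqrt ((norm v)\<^sup>2 + (norm (grad \<Omega> v))\<^sup>2)"

definition H10 :: "(real^'n) set \<Rightarrow> (real^'n, real) l2 set" where
  "H10 \<Omega> = {v \<in> H1 \<Omega>. \<exists>\<phi>. (\<forall>m::nat. test_fun \<Omega> (\<phi> m)) \<and>
     (\<lambda>m. H1_norm \<Omega> (v - abs_l2 (\<phi> m))) \<longlonglongrightarrow> 0}"

definition component :: "(real^'n, real^'n) l2 \<Rightarrow> 'n \<Rightarrow> (real^'n, real) l2" where
  "component V i = abs_l2 (\<lambda>x. rep_l2 V x $ i)"

definition H10_vec :: "(real^'n) set \<Rightarrow> (real^'n, real^'n) l2 set" where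
  "H10_vec \<Omega> = {V. \<forall>i. component V i \<in> H10 \<Omega>}"

text \<open>Row \<open>i\<close> of the Jacobian matrix is the gradient of the \<open>i\<close>-th component.\<close>

definition grad_vec :: "(real^'n) set \<Rightarrow> (real^'n, real^'n) l2 \<Rightarrow> (real^'n, real^'n^'n) l2" where
  "grad_vec \<Omega> V = abs_l2 (\<lambda>x. \<chi> i. rep_l2 (grad \<Omega> (component V i)) x)"

definition div_vec :: "(real^'n) set \<Rightarrow> (real^'n, real^'n) l2 \<Rightarrow> (real^'n, real) l2" where
  "div_vec \<Omega> V = (\<Sum>i\<in>UNIV. component (grad \<Omega> (component V i)) i)"

definition H1_norm_vec :: "(real^'n) set \<Rightarrow> (real^'n, real^'n) l2 \<Rightarrow> real" where
  "H1_norm_vec \<Omega> V = sqrt ((norm V)\<^sup>2 + (norm (grad_vec \<Omega> V))\<^sup>2)"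


section \<open>Functions of time\<close>

text \<open>\<open>dt_on T f\<close> is the derivative on \<open>[0,T]\<close>, one-sided at the end points.\<close>

definition dt_on :: "real \<Rightarrow> (real \<Rightarrow> real) \<Rightarrow> real \<Rightarrow> real" where
  "dt_on T f t = vector_derivative f (at t within {0..T})"

definition C_k_on :: "nat \<Rightarrow> real \<Rightarrow> (real \<Rightarrow> real) \<Rightarrow> bool" where
  "C_k_on m T f \<longleftrightarrow> (\<forall>j\<le>m. continuous_on {0..T} ((dt_on T ^^ j) f)) \<and>
     (\<forall>j<m. \<forall>t\<in>{0..T}. (dt_on T ^^ j) f differentiable (at t within {0..T}))"

text \<open>Strong positive definiteness in the sense of Nohel and Shea: \<open>a(t) - \<epsilon> exp(-t)\<close> is a positive
  definite kernel for some \<open>\<epsilon> > 0\<close>. Since kernels matter on \<open>[0,T]\<close> only, so do the test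
  functions \<open>y\<close>.\<close>

definition positive_definite_kernel :: "real \<Rightarrow> (real \<Rightarrow> real) \<Rightarrow> bool" where
  "positive_definite_kernel T a \<longleftrightarrow> (\<forall>y. continuous_on {0..T} y \<longrightarrow> (\<forall>t\<in>{0..T}.
     0 \<le> (LINT s:{0..t}|lborel. y s * (LINT r:{0..s}|lborel. a (s - r) * y r))))"

definition strongly_positive_definite_kernel :: "real \<Rightarrow> (real \<Rightarrow> real) \<Rightarrow> bool" where
  "strongly_positive_definite_kernel T a \<longleftrightarrow>
     (\<exists>\<epsilon>>0. positive_definite_kernel T (\<lambda>t. a t - \<epsilon> * exp (- t)))"

definition convolution :: "(real \<Rightarrow> real) \<Rightarrow> (real \<Rightarrow> 'h::{banach, second_countable_topology}) \<Rightarrow> real \<Rightarrow> 'h"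
  where "convolution k z t = (LINT s:{0..t}|lborel. k (t - s) *\<^sub>R z s)"

definition adjoint_convolution ::
    "real \<Rightarrow> (real \<Rightarrow> real) \<Rightarrow> (real \<Rightarrow> 'h::{banach, second_countable_topology}) \<Rightarrow> real \<Rightarrow> 'h"
  where "adjoint_convolution T k z s = (LINT t:{s..T}|lborel. k (t - s) *\<^sub>R z t)"

text \<open>\<open>w\<close> is the time derivative of the absolutely continuous function \<open>u\<close> on \<open>[0,T]\<close>: the
  Bochner-Sobolev derivative, with \<open>u\<close> taken to be the continuous representative.\<close>

definition has_time_deriv ::
    "real \<Rightarrow> (real \<Rightarrow> 'h::{banach, second_countable_topology}) \<Rightarrow> (real \<Rightarrow> 'h) \<Rightarrow> bool" where
  "has_time_deriv T u w \<longleftrightarrow> set_integrable lborel {0..T} w \<and>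
     (\<forall>t\<in>{0..T}. u t = u 0 + (LINT s:{0..t}|lborel. w s))"

definition L2_time :: "real \<Rightarrow> (real \<Rightarrow> 'h::{banach, second_countable_topology}) \<Rightarrow> bool" where
  "L2_time T v \<longleftrightarrow> set_borel_measurable lborel {0..T} v \<and>
     set_integrable lborel {0..T} (\<lambda>t. (norm (v t))\<^sup>2)"

definition C_L2 ::
    "'a::euclidean_space set \<Rightarrow> real \<Rightarrow> (real \<Rightarrow> ('a, 'b::euclidean_space) l2) \<Rightarrow> bool" where
  "C_L2 \<Omega> T v \<longleftrightarrow> continuous_on {0..T} v \<and> (\<forall>t\<in>{0..T}. v t \<in> L2 \<Omega>)"

definition C_H10 :: "(real^'n) set \<Rightarrow> real \<Rightarrow> (real \<Rightarrow> (real^'n, real) l2) \<Rightarrow> bool" where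
  "C_H10 \<Omega> T v \<longleftrightarrow> (\<forall>t\<in>{0..T}. v t \<in> H10 \<Omega>) \<and>
     continuous_on {0..T} v \<and> continuous_on {0..T} (\<lambda>t. grad \<Omega> (v t))"

definition C_H10_vec :: "(real^'n) set \<Rightarrow> real \<Rightarrow> (real \<Rightarrow> (real^'n, real^'n) l2) \<Rightarrow> bool" where
  "C_H10_vec \<Omega> T v \<longleftrightarrow> (\<forall>t\<in>{0..T}. v t \<in> H10_vec \<Omega>) \<and>
     continuous_on {0..T} v \<and> continuous_on {0..T} (\<lambda>t. grad_vec \<Omega> (v t))"

definition L2_L2 ::
    "'a::euclidean_space set \<Rightarrow> real \<Rightarrow> (real \<Rightarrow> ('a, 'b::euclidean_space) l2) \<Rightarrow> bool" where
  "L2_L2 \<Omega> T v \<longleftrightarrow> L2_time T v \<and> (AE t\<in>{0<..<T} in lborel. v t \<in> L2 \<Omega>)"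

text \<open>The gradient is matched with a Borel function of time \<open>G\<close> almost everywhere, as
  \<open>grad\<close> is unspecified at the exceptional times where \<open>v t\<close> is not in the Sobolev space.\<close>

definition L2_H10 :: "(real^'n) set \<Rightarrow> real \<Rightarrow> (real \<Rightarrow> (real^'n, real) l2) \<Rightarrow> bool" where
  "L2_H10 \<Omega> T v \<longleftrightarrow> L2_time T v \<and> (\<exists>G. L2_time T G \<and>
     (AE t\<in>{0<..<T} in lborel. v t \<in> H10 \<Omega> \<and> grad \<Omega> (v t) = G t))"

definition L2_H10_vec :: "(real^'n) set \<Rightarrow> real \<Rightarrow> (real \<Rightarrow> (real^'n, real^'n) l2) \<Rightarrow> bool" where
  "L2_H10_vec \<Omega> T v \<longleftrightarrow> L2_time T v \<and> (\<exists>G. L2_time T G \<and>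
     (AE t\<in>{0<..<T} in lborel. v t \<in> H10_vec \<Omega> \<and> grad_vec \<Omega> (v t) = G t))"

text \<open>Square-integrable functions of time with values in \<open>H\<^sup>-\<^sup>1(\<Omega>)\<^sup>d\<close>, the dual of \<open>H10_vec \<Omega>\<close>;
  \<open>W t \<phi>\<close> is the duality pairing and \<open>b t\<close> bounds the dual norm of \<open>W t\<close>. As the space is separable,
  weak measurability is measurability.\<close>

definition L2_Hm1_vec ::
    "(real^'n) set \<Rightarrow> real \<Rightarrow> (real \<Rightarrow> (real^'n, real^'n) l2 \<Rightarrow> real) \<Rightarrow> bool" where
  "L2_Hm1_vec \<Omega> T W \<longleftrightarrow>
     (\<forall>\<phi>\<in>H10_vec \<Omega>. set_borel_measurable lborel {0..T} (\<lambda>t. W t \<phi>)) \<and>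
     (\<exists>b :: real \<Rightarrow> real. L2_time T b \<and> (AE t\<in>{0<..<T} in lborel.
        \<forall>\<phi>\<in>H10_vec \<Omega>. \<bar>W t \<phi>\<bar> \<le> b t * H1_norm_vec \<Omega> \<phi> \<and>
          (\<forall>c. W t (c *\<^sub>R \<phi>) = c * W t \<phi>) \<and> (\<forall>\<psi>\<in>H10_vec \<Omega>. W t (\<phi> + \<psi>) = W t \<phi> + W t \<psi>)))"


section \<open>The direct and the adjoint problem\<close>

definition forward_solution ::
    "(real^'n) set \<Rightarrow> real \<Rightarrow> real \<Rightarrow> real \<Rightarrow> real \<Rightarrow> real \<Rightarrow> real \<Rightarrow> real \<Rightarrow> real \<Rightarrow>
     (real \<Rightarrow> real) \<Rightarrow> (real \<Rightarrow> real) \<Rightarrow> (real^'n, real^'n) l2 \<Rightarrow>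
     (real \<Rightarrow> (real^'n, real^'n) l2) \<Rightarrow> (real \<Rightarrow> (real^'n, real) l2) \<Rightarrow> bool" where
  "forward_solution \<Omega> T \<rho> C\<^sub>s \<kappa> T\<^sub>0 lam \<mu> \<gamma> k g f u \<theta> \<longleftrightarrow> (\<exists>u\<^sub>t u\<^sub>t\<^sub>t \<theta>\<^sub>t.
     C_H10_vec \<Omega> T u \<and> has_time_deriv T u u\<^sub>t \<and>
     C_L2 \<Omega> T u\<^sub>t \<and> L2_H10_vec \<Omega> T u\<^sub>t \<and> has_time_deriv T u\<^sub>t u\<^sub>t\<^sub>t \<and> L2_L2 \<Omega> T u\<^sub>t\<^sub>t \<and>
     C_H10 \<Omega> T \<theta> \<and> has_time_deriv T \<theta> \<theta>\<^sub>t \<and> L2_H10 \<Omega> T \<theta>\<^sub>t \<and>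
     u 0 = 0 \<and> u\<^sub>t 0 = 0 \<and> \<theta> 0 = 0 \<and>
     (AE t\<in>{0<..<T} in lborel. \<forall>\<phi>\<in>H10_vec \<Omega>.
        \<rho> * (u\<^sub>t\<^sub>t t \<bullet> \<phi>) + \<mu> * (grad_vec \<Omega> (u t) \<bullet> grad_vec \<Omega> \<phi>)
          + (lam + \<mu>) * (div_vec \<Omega> (u t) \<bullet> div_vec \<Omega> \<phi>) + \<gamma> * (grad \<Omega> (\<theta> t) \<bullet> \<phi>)
        = (g t *\<^sub>R f) \<bullet> \<phi>) \<and>
     (AE t\<in>{0<..<T} in lborel. \<forall>\<psi>\<in>H10 \<Omega>.
        \<rho> * C\<^sub>s * (\<theta>\<^sub>t t \<bullet> \<psi>) + \<kappa> * (grad \<Omega> (\<theta> t) \<bullet> grad \<Omega> \<psi>)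
          + convolution k (\<lambda>s. grad \<Omega> (\<theta> s)) t \<bullet> grad \<Omega> \<psi> - T\<^sub>0 * \<gamma> * (u\<^sub>t t \<bullet> grad \<Omega> \<psi>)
        = 0))"

text \<open>The terminal velocity \<open>w\<close> of the adjoint problem is merely square integrable, so its weak
  solutions have finite energy only: the acceleration is a function with values in
  \<open>H\<^sup>-\<^sup>1(\<Omega>)\<^sup>d\<close>. As in the direct problem, the divergence in the heat equation is moved to the
  test function.\<close>

definition adjoint_solution ::
    "(real^'n) set \<Rightarrow> real \<Rightarrow> real \<Rightarrow> real \<Rightarrow> real \<Rightarrow> real \<Rightarrow> real \<Rightarrow> real \<Rightarrow> real \<Rightarrow>
     (real \<Rightarrow> real) \<Rightarrow> (real^'n, real^'n) l2 \<Rightarrow>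
     (real \<Rightarrow> (real^'n, real^'n) l2) \<Rightarrow> (real \<Rightarrow> (real^'n, real) l2) \<Rightarrow> bool" where
  "adjoint_solution \<Omega> T \<rho> C\<^sub>s \<kappa> T\<^sub>0 lam \<mu> \<gamma> k w u \<theta> \<longleftrightarrow> (\<exists>u\<^sub>t u\<^sub>t\<^sub>t \<theta>\<^sub>t.
     C_H10_vec \<Omega> T u \<and> has_time_deriv T u u\<^sub>t \<and> C_L2 \<Omega> T u\<^sub>t \<and> L2_Hm1_vec \<Omega> T u\<^sub>t\<^sub>t \<and>
     (\<forall>\<phi>\<in>H10_vec \<Omega>. has_time_deriv T (\<lambda>t. u\<^sub>t t \<bullet> \<phi>) (\<lambda>t. u\<^sub>t\<^sub>t t \<phi>)) \<and>
     C_H10 \<Omega> T \<theta> \<and> has_time_deriv T \<theta> \<theta>\<^sub>t \<and> L2_H10 \<Omega> T \<theta>\<^sub>t \<and>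
     u T = 0 \<and> u\<^sub>t T = w \<and> \<theta> T = 0 \<and>
     (AE t\<in>{0<..<T} in lborel. \<forall>\<phi>\<in>H10_vec \<Omega>.
        \<rho> * u\<^sub>t\<^sub>t t \<phi> + \<mu> * (grad_vec \<Omega> (u t) \<bullet> grad_vec \<Omega> \<phi>)
          + (lam + \<mu>) * (div_vec \<Omega> (u t) \<bullet> div_vec \<Omega> \<phi>) + \<gamma> * T\<^sub>0 * (grad \<Omega> (\<theta>\<^sub>t t) \<bullet> \<phi>)
        = 0) \<and>
     (AE t\<in>{0<..<T} in lborel. \<forall>\<psi>\<in>H10 \<Omega>.
        - \<rho> * C\<^sub>s * (\<theta>\<^sub>t t \<bullet> \<psi>) + \<kappa> * (grad \<Omega> (\<theta> t) \<bullet> grad \<Omega> \<psi>)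
          + adjoint_convolution T k (\<lambda>s. grad \<Omega> (\<theta> s)) t \<bullet> grad \<Omega> \<psi> + \<gamma> * (u t \<bullet> grad \<Omega> \<psi>)
        = 0))"


section \<open>The cost functional and its gradient\<close>

text \<open>\<open>U f\<close> is the displacement field for the source \<open>f\<close>.\<close>

definition cost ::
    "('h::real_inner \<Rightarrow> real \<Rightarrow> 'h) \<Rightarrow> real \<Rightarrow> 'h \<Rightarrow> real \<Rightarrow> 'h \<Rightarrow> real" where
  "cost U T \<Xi> \<beta> f = 1 / 2 * (norm (U f T - \<Xi>))\<^sup>2 + \<beta> / 2 * (norm f)\<^sup>2"

definition has_gateaux_deriv :: "('h::real_inner \<Rightarrow> real) \<Rightarrow> 'h \<Rightarrow> 'h \<Rightarrow> real \<Rightarrow> bool" where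
  "has_gateaux_deriv J f \<delta> D \<longleftrightarrow> ((\<lambda>\<epsilon>. (J (f + \<epsilon> *\<^sub>R \<delta>) - J f) / \<epsilon>) \<longlongrightarrow> D) (at 0)"

definition is_riesz_gradient :: "'h::real_inner set \<Rightarrow> ('h \<Rightarrow> real) \<Rightarrow> 'h \<Rightarrow> 'h \<Rightarrow> bool" where
  "is_riesz_gradient H J f G \<longleftrightarrow> G \<in> H \<and> (\<forall>\<delta>\<in>H. has_gateaux_deriv J f \<delta> (G \<bullet> \<delta>))"

end

(*
  Testing the direct equations with the adjoint solution and the adjoint equations with the direct
  solution, subtracting and integrating over [0,T], all interior terms cancel: the two memory terms by
  Fubini, the coupling terms after one integration by parts in time. What remains are the boundary
  terms, rho (u(T), u(T;f) - Xi) = - int_0^T g(t) (delta, u'(t)) dt for the displacement u with source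
  delta. The displacement depends linearly on the source, because an energy estimate makes the direct
  problem uniquely solvable: the memory term is absorbed by the diffusion term and by Gronwall's lemma.
  Hence the cost is quadratic along every line, and its linear coefficient is given by the duality
  relation.
*)

theory Submission
  imports Defs
begin

text \<open>\<open>grad\<close> is a definite description, so nothing is known about it until weak
  gradients are shown to be unique; this is what the test functions built below are for. Being a
  weak gradient amounts to linear equations against fixed elements of L^2, hence it survives Bochner
  integration. That makes the Jacobian of \<open>u t\<close> a time primitive of the Jacobian of the
  velocity, and every integration by parts in time becomes Fubini's theorem on a triangle, without
  pointwise derivatives. Two obstacles shape the rest. Treating a combination of solutions as a weak
  solution would require closure of \<open>H10\<close> and \<open>H10_vec\<close> under addition;
  instead the pairs of a function and its gradient are spanned, and the equations, being linear in
  the test pair, extend to the span. The energy estimate then takes place in abstract Hilbert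
  spaces. Second, the adjoint acceleration is only a functional on \<open>H10_vec\<close>, so it
  cannot be paired with a moving test function through the product rule; the adjoint momentum
  equation is integrated from 0 to t first and only then tested with the velocity of the direct
  problem.\<close>

section \<open>Smooth bumps and the fundamental lemma of the calculus of variations\<close>

text \<open>The powers of \<open>s\<close> in the denominator are carried along because
  differentiating \<open>exp (- c / s)\<close> produces them: up to linear combinations the family
  is closed under differentiation. The parameter \<open>c\<close> is later sent to 0.\<close>

definition flat :: "nat \<Rightarrow> real \<Rightarrow> real \<Rightarrow> real" where
  "flat m c s = (if s > 0 then exp (- c / s) / s ^ m else 0)"

text \<open>On the right, the substitution x = c / s reduces the claim to x ^ m / exp x tending to 0
  at infinity; the constant factor \<open>c ^ m\<close> is then divided out. On the left the
  function is 0.\<close>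

lemma flat_tendsto_0: "c > 0 \<Longrightarrow> (flat m c \<longlongrightarrow> 0) (at 0)"
  unfolding filterlim_at_split
proof
  assume c: "c > 0"
  show "(flat m c \<longlongrightarrow> 0) (at_left 0)"
    by (rule tendsto_eventually) (auto simp: flat_def eventually_at_filter)
  have "filterlim (\<lambda>s. c * inverse s) at_top (at_right 0)"
    using c filterlim_tendsto_pos_mult_at_top[OF tendsto_const _ filterlim_inverse_at_top_right] by blast
  then have "((\<lambda>s. (c * inverse s) ^ m / exp (c * inverse s)) \<longlongrightarrow> 0) (at_right 0)"
    by (rule filterlim_compose[OF tendsto_power_div_exp_0])
  then have "((\<lambda>s. (c * inverse s) ^ m / exp (c * inverse s) / c ^ m) \<longlongrightarrow> 0) (at_right 0)"
    by (rule tendsto_divide_zero)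
  moreover have "\<forall>\<^sub>F s in at_right 0. (c * inverse s) ^ m / exp (c * inverse s) / c ^ m = flat m c s"
    using c by (auto simp: flat_def eventually_at_filter exp_minus field_simps)
  ultimately show "(flat m c \<longlongrightarrow> 0) (at_right 0)"
    by (rule Lim_transform_eventually)
qed

lemma flat_deriv:
  assumes "c > 0"
  shows "(flat m c has_real_derivative c * flat (Suc (Suc m)) c s - real m * flat (Suc m) c s) (at s)"
proof (cases "s = 0")
  case False
  then consider "s > 0" | "s < 0" by linarith
  then show ?thesis
  proof cases
    case 1
    have "((\<lambda>s. exp (- c / s) / s ^ m) has_real_derivative
        (exp (- c / s) * (c / s\<^sup>2) * s ^ m - exp (- c / s) * (real m * s ^ (m - 1))) / (s ^ m * s ^ m)) (at s)"
      using 1 by (auto intro!: derivative_eq_intros simp: power2_eq_square)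
    also have "(exp (- c / s) * (c / s\<^sup>2) * s ^ m - exp (- c / s) * (real m * s ^ (m - 1))) / (s ^ m * s ^ m)
        = c * flat (Suc (Suc m)) c s - real m * flat (Suc m) c s"
      using 1 by (cases m) (auto simp: flat_def power2_eq_square field_simps)
    finally have "((\<lambda>s. exp (- c / s) / s ^ m) has_real_derivative c * flat (Suc (Suc m)) c s - real m * flat (Suc m) c s) (at s)" .
    then show ?thesis
      by (rule has_field_derivative_transform_within_open[of _ _ _ "{0<..}"]) (use 1 in \<open>auto simp: flat_def\<close>)
  next
    case 2
    have "((\<lambda>s. 0) has_real_derivative 0) (at s)" by simp
    then have "(flat m c has_real_derivative 0) (at s)"
      by (rule has_field_derivative_transform_within_open[of _ _ _ "{..<0}"]) (use 2 in \<open>auto simp: flat_def\<close>)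
    then show ?thesis using 2 by (simp add: flat_def)
  qed
next
  case True
  \<comment> \<open>As \<open>flat m c\<close> vanishes at 0, this is its difference quotient there.
    It is the next member of the family, so its limit is known to be 0, which is also the value of
    the claimed derivative.\<close>
  have "(\<lambda>h. flat m c h / h) = flat (Suc m) c"
    by (auto simp: flat_def fun_eq_iff)
  then show ?thesis
    using flat_tendsto_0[OF assms, of "Suc m"] True
    by (simp add: DERIV_def) (simp add: flat_def)
qed

text \<open>The class is closed under partial derivatives, so all its members are smooth.\<close>

inductive_set smooth :: "(real^'n \<Rightarrow> real) set" where
  smooth_const: "(\<lambda>x. c) \<in> smooth"
| smooth_coord: "(\<lambda>x. x $ i) \<in> smooth"
| smooth_add: "p \<in> smooth \<Longrightarrow> q \<in> smooth \<Longrightarrow> (\<lambda>x. p x + q x) \<in> smooth"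
| smooth_mult: "p \<in> smooth \<Longrightarrow> q \<in> smooth \<Longrightarrow> (\<lambda>x. p x * q x) \<in> smooth"
| smooth_flat: "p \<in> smooth \<Longrightarrow> c > 0 \<Longrightarrow> (\<lambda>x. flat m c (p x)) \<in> smooth"

lemma pdiff_eq: "(p has_derivative D) (at x) \<Longrightarrow> pdiff i p x = D (axis i 1)"
  by (simp add: pdiff_def frechet_derivative_at[symmetric])

lemma smooth_pdiff:
  fixes p :: "real^'n \<Rightarrow> real"
  assumes "p \<in> smooth"
  shows "(\<forall>x. p differentiable (at x)) \<and> (\<forall>i. pdiff i p \<in> smooth)"
  using assms
proof induction
  case (smooth_const c)
  have "pdiff i (\<lambda>x. c) = (\<lambda>x. 0)" for i :: 'n
    by (auto intro!: pdiff_eq[THEN trans] ext has_derivative_const)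
  then show ?case by (auto intro: smooth.intros)
next
  case (smooth_coord j)
  have d: "((\<lambda>x. x $ j) has_derivative (\<lambda>x. x $ j)) (at x)" for x :: "real^'n"
    by (auto intro: bounded_linear_imp_has_derivative bounded_linear_vec_nth)
  then have "pdiff i (\<lambda>x. x $ j) = (\<lambda>x. axis i 1 $ j)" for i :: 'n
    by (auto intro!: pdiff_eq[THEN trans] ext)
  with d show ?case by (auto intro: smooth.intros simp: differentiable_def)
next
  case (smooth_add p q)
  have d: "(p has_derivative frechet_derivative p (at x)) (at x)"
    "(q has_derivative frechet_derivative q (at x)) (at x)" for x
    using smooth_add by (auto simp: frechet_derivative_works)
  have "pdiff i (\<lambda>x. p x + q x) = (\<lambda>x. pdiff i p x + pdiff i q x)" for i
    using has_derivative_add[OF d, THEN pdiff_eq] by (auto simp: fun_eq_iff pdiff_def)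
  with smooth_add show ?case by (auto intro: smooth.intros)
next
  case (smooth_mult p q)
  have d: "(p has_derivative frechet_derivative p (at x)) (at x)"
    "(q has_derivative frechet_derivative q (at x)) (at x)" for x
    using smooth_mult by (auto simp: frechet_derivative_works)
  have "pdiff i (\<lambda>x. p x * q x) = (\<lambda>x. p x * pdiff i q x + pdiff i p x * q x)" for i
    using has_derivative_mult[OF d, THEN pdiff_eq] by (auto simp: fun_eq_iff pdiff_def)
  with smooth_mult show ?case by (auto intro!: smooth.intros)
next
  case (smooth_flat p c m)
  have d: "((\<lambda>x. flat m c (p x)) has_derivative
      (\<lambda>h. frechet_derivative p (at x) h * (c * flat (Suc (Suc m)) c (p x) - real m * flat (Suc m) c (p x)))) (at x)" for x
    using flat_deriv[OF smooth_flat(2), of m "p x"] smooth_flat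
    by (auto simp: has_field_derivative_def frechet_derivative_works mult.commute intro!: has_derivative_compose[of p _ _ _ "flat m c", THEN has_derivative_eq_rhs])
  \<comment> \<open>The difference is written as a sum with the constant factor
    \<open>- real m\<close>, since the rules generating \<open>smooth\<close> have sums and products
    but no differences.\<close>
  have "pdiff i (\<lambda>x. flat m c (p x)) =
     (\<lambda>x. pdiff i p x * (c * flat (Suc (Suc m)) c (p x) + (- real m) * flat (Suc m) c (p x)))" for i
    using d[THEN pdiff_eq] by (auto simp: fun_eq_iff pdiff_def)
  then have "pdiff i (\<lambda>x. flat m c (p x)) \<in> smooth" for i
    using smooth_flat by (simp only:) (intro smooth.intros; auto)
  with d show ?case by (auto simp: differentiable_def)
qed

lemma smooth_C_k: "p \<in> smooth \<Longrightarrow> C_k m p"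
proof (induction m arbitrary: p)
  case 0
  then show ?case
    using smooth_pdiff[of p] by (auto intro!: continuous_at_imp_continuous_on differentiable_imp_continuous_within)
next
  case (Suc m)
  then show ?case using smooth_pdiff[of p] by auto
qed

lemma smooth_prod: "finite I \<Longrightarrow> (\<And>i. i \<in> I \<Longrightarrow> p i \<in> smooth) \<Longrightarrow> (\<lambda>x. \<Prod>i\<in>I. p i x) \<in> smooth"
  by (induction I rule: finite_induct) (auto intro: smooth.intros)

text \<open>As \<open>n\<close> grows the factors \<open>exp(- 1 / ((n + 1) s))\<close> increase to 1 for \<open>s > 0\<close>, so the bumps converge
  boundedly to the indicator of the box.\<close>

definition bump :: "real^'n \<Rightarrow> real^'n \<Rightarrow> nat \<Rightarrow> real^'n \<Rightarrow> real" where
  "bump a b n x = (\<Prod>i\<in>UNIV. flat 0 (1 / real (Suc n)) ((x $ i - a $ i) * (b $ i - x $ i)))"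

lemma flat_0_range: "c > 0 \<Longrightarrow> 0 \<le> flat 0 c s \<and> flat 0 c s \<le> 1"
  by (auto simp: flat_def)

lemma bump_range: "0 \<le> bump a b n x \<and> bump a b n x \<le> 1"
  unfolding bump_def by (intro conjI prod_nonneg prod_le_1) (auto simp: flat_0_range)

text \<open>One product per coordinate encodes both inequalities. A product of two negative factors
  would put \<open>x $ i\<close> above \<open>b $ i\<close> and below \<open>a $ i\<close>, which
  nonemptiness of the box excludes.\<close>

lemma mem_box_iff_pos:
  fixes a b x :: "real^'n"
  assumes "box a b \<noteq> {}"
  shows "x \<in> box a b \<longleftrightarrow> (\<forall>i. (x $ i - a $ i) * (b $ i - x $ i) > 0)"
proof -
  have "a $ i < b $ i" for i
    using assms by (fastforce simp: mem_box_cart dest: less_trans)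
  then show ?thesis by (smt (verit, ccfv_threshold) mem_box_cart(1) zero_less_mult_iff)
qed

lemma bump_outside: "box a b \<noteq> {} \<Longrightarrow> x \<notin> box a b \<Longrightarrow> bump a b n x = 0"
  by (auto simp: mem_box_iff_pos bump_def flat_def)

lemma bump_test_fun:
  assumes "box a b \<noteq> {}" "cbox a b \<subseteq> \<Omega>"
  shows "test_fun \<Omega> (bump a b n)"
  unfolding test_fun_def
proof (intro conjI allI)
  have "bump a b n = (\<lambda>x. \<Prod>i\<in>UNIV. flat 0 (1 / real (Suc n)) ((x $ i + (- a $ i)) * (b $ i + (-1) * x $ i)))"
    by (simp add: bump_def fun_eq_iff)
  moreover have "\<dots> \<in> smooth"
    by (intro smooth_prod smooth.intros) auto
  ultimately show "C_k m (bump a b n)" for m by (simp add: smooth_C_k)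
  \<comment> \<open>The bumps are positive up to the faces of the open box, so their support is the
    closed box; hence the assumption on \<open>cbox a b\<close>.\<close>
  have "{x. bump a b n x \<noteq> 0} \<subseteq> cbox a b"
    using bump_outside[OF assms(1)] box_subset_cbox by blast
  then have *: "closure {x. bump a b n x \<noteq> 0} \<subseteq> cbox a b"
    by (rule closure_minimal) (rule closed_cbox)
  then show "closure {x. bump a b n x \<noteq> 0} \<subseteq> \<Omega>" using assms by blast
  show "compact (closure {x. bump a b n x \<noteq> 0})"
    using * compact_cbox[of a b] by (metis closed_closure compact_Int_closed inf.absorb2)
qed

lemma bump_tendsto: 
  assumes "box a b \<noteq> {}"
  shows "(\<lambda>n. bump a b n x) \<longlonglongrightarrow> indicator (box a b) x"
proof (cases "x \<in> box a b")
  case True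
  have "(\<lambda>n. 1 / real (Suc n)) \<longlonglongrightarrow> 0"
    using LIMSEQ_inverse_real_of_nat by (simp add: inverse_eq_divide)
  then have "(\<lambda>n. exp (- (1 / real (Suc n)) / s)) \<longlonglongrightarrow> exp (- 0 / s)" if "s > 0" for s :: real
    using that by (intro tendsto_intros) auto
  then have "(\<lambda>n. flat 0 (1 / real (Suc n)) s) \<longlonglongrightarrow> 1" if "s > 0" for s
    using that by (simp add: flat_def)
  then have "(\<lambda>n. bump a b n x) \<longlonglongrightarrow> (\<Prod>i\<in>(UNIV :: 'a set). 1)"
    unfolding bump_def using True mem_box_iff_pos[OF assms] by (intro tendsto_prod) auto
  with True show ?thesis by simp
qed (simp add: bump_outside[OF assms])

text \<open>The Borel sets over which \<open>f\<close> integrates to 0 form a Dynkin system, and the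
  boxes are an intersection-stable generator of the Borel sets. An integrable function whose
  integral vanishes over every Borel set is 0 almost everywhere.\<close>

lemma AE_eq_0_of_box_integrals:
  fixes f :: "'a::euclidean_space \<Rightarrow> real"
  assumes int: "integrable lborel f" and box: "\<And>a b. (LINT x:box a b|lborel. f x) = 0"
  shows "AE x in lborel. f x = 0"
proof (rule density_unique_real)
  have si: "set_integrable lborel A f" if "A \<in> sets borel" for A
    unfolding set_integrable_def using that int by (intro integrable_mult_indicator) auto
  let ?B = "\<lambda>n::nat. box (- (real n *\<^sub>R One)) (real n *\<^sub>R One) :: 'a set"
  \<comment> \<open>The whole space is not a box. Its integral is needed for complements and comes
    from exhaustion by growing cubes.\<close>
  have "(\<lambda>n. LINT x:?B n|lborel. f x) \<longlonglongrightarrow> (LINT x:(\<Union>n. ?B n)|lborel. f x)"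
    by (rule set_integral_cont_up[OF _ _ si]) (auto simp: incseq_def box_def intro!: sets.countable_UN elim: less_le_trans le_less_trans)
  then have UNIV0: "(LINT x:UNIV|lborel. f x) = 0"
    unfolding UN_box_eq_UNIV by (simp add: box LIMSEQ_const_iff)
  fix A :: "'a set" assume "A \<in> sets lborel"
  then have "A \<in> sigma_sets UNIV (range (\<lambda>(a, b). box a b))"
    by (simp add: borel_eq_box)
  moreover have "range (\<lambda>(a, b). box a b) \<subseteq> Pow (UNIV :: 'a set)" by simp
  moreover have "Int_stable (range (\<lambda>(a, b). box a b :: 'a set))"
    by (auto simp: Int_stable_def box_Int_box)
  ultimately have "Int_stable (range (\<lambda>(a, b). box a b :: 'a set))"
    "range (\<lambda>(a, b). box a b) \<subseteq> Pow (UNIV :: 'a set)" "A \<in> sigma_sets UNIV (range (\<lambda>(a, b). box a b))"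
    by auto
  then have "A \<in> sets borel \<and> (LINT x:A|lborel. f x) = 0"
  proof (induction rule: sigma_sets_induct_disjoint)
    case (basic A) then show ?case by (auto simp: box)
  next
    case empty show ?case by (simp add: set_lebesgue_integral_def)
  next
    case (compl A)
    have "(LINT x:A \<union> (UNIV - A)|lborel. f x) = (LINT x:A|lborel. f x) + (LINT x:UNIV - A|lborel. f x)"
      using compl by (intro set_integral_Un si) auto
    with compl UNIV0 show ?case by (auto simp flip: Compl_eq_Diff_UNIV)
  next
    case (union A)
    then have "(\<Union>i. A i) \<in> sets borel" by auto
    with union have "(LINT x:(\<Union>i. A i)|lborel. f x) = (\<Sum>i. (LINT x:A i|lborel. f x))"
      by (intro lebesgue_integral_countable_add si) (auto simp: disjoint_family_on_def)
    with union show ?case by auto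
  qed
  then show "(LINT x:A|lborel. f x) = (LINT x:A|lborel. 0)" by simp
qed (use int in auto)

lemma sq_int_real_mult: 
  fixes f g :: "'a::euclidean_space \<Rightarrow> real"
  shows "sq_int f \<Longrightarrow> sq_int g \<Longrightarrow> integrable lborel (\<lambda>x. f x * g x)"
  using sq_int_inner[of f g] by simp

lemma test_fun_continuous: "test_fun \<Omega> \<phi> \<Longrightarrow> continuous_on UNIV \<phi>"
  by (metis C_k.simps(1) test_fun_def)

lemma test_fun_measurable: "test_fun \<Omega> \<phi> \<Longrightarrow> \<phi> \<in> borel_measurable borel"
  by (intro borel_measurable_continuous_onI test_fun_continuous)

text \<open>Testing with bumps and passing to the limit gives zero integrals over boxes whose
  closure lies in \<Omega>. Localising to one such box makes \<open>v\<close> integrable, so the box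
  criterion applies there; countably many of these boxes cover \<Omega>.\<close>

lemma fundamental_lemma_variations:
  fixes v :: "real^'n \<Rightarrow> real"
  assumes "open \<Omega>" and v: "sq_int v"
    and test: "\<And>\<phi>. test_fun \<Omega> \<phi> \<Longrightarrow> (LINT x|lborel. v x * \<phi> x) = 0"
  shows "AE x in lborel. x \<in> \<Omega> \<longrightarrow> v x = 0"
proof -
  have vm [measurable]: "v \<in> borel_measurable borel" using v by (simp add: sq_int_def)
  have ind: "sq_int (indicator (box a b) :: real^'n \<Rightarrow> real)" for a b
    using sq_int_indicator[of "box a b" "1::real"] by simp
  have vi: "integrable lborel (\<lambda>x. v x * indicator (box a b) x)" for a b
    by (rule sq_int_real_mult[OF v ind])
  have box0: "(LINT x|lborel. v x * indicator (box a b) x) = 0" if "cbox a b \<subseteq> \<Omega>" for a b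
  proof (cases "box a b = {}")
    case False
    have tf: "test_fun \<Omega> (bump a b n)" for n using bump_test_fun[OF False that] .
    have [measurable]: "bump a b n \<in> borel_measurable borel" for n
      by (rule test_fun_measurable[OF tf])
    \<comment> \<open>The bumps lie between 0 and the indicator of the box, so |v| restricted to the
      box is an integrable majorant.\<close>
    have "(\<lambda>n. LINT x|lborel. v x * bump a b n x) \<longlonglongrightarrow> (LINT x|lborel. v x * indicator (box a b) x)"
    proof (rule integral_dominated_convergence)
      show "integrable lborel (\<lambda>x. \<bar>v x * indicator (box a b) x\<bar>)" using vi by simp
      show "AE x in lborel. (\<lambda>n. v x * bump a b n x) \<longlonglongrightarrow> v x * indicator (box a b) x"
        using bump_tendsto[OF False] by (intro AE_I2 tendsto_intros)
      show "AE x in lborel. norm (v x * bump a b n x) \<le> \<bar>v x * indicator (box a b) x\<bar>" for n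
        using bump_range[of a b n] bump_outside[OF False, of _ n]
        by (auto simp: abs_mult indicator_def intro!: AE_I2 mult_left_le)
    qed auto
    then show ?thesis by (simp add: test[OF tf] LIMSEQ_const_iff)
  qed simp
  have AE_box: "AE x in lborel. x \<in> box a b \<longrightarrow> v x = 0" if "cbox a b \<subseteq> \<Omega>" for a b
  proof -
    \<comment> \<open>Boxes are stable under intersection, and the closure of the smaller box stays
      inside \<open>cbox a b\<close>, hence inside \<Omega>.\<close>
    have "(LINT x:box c d|lborel. v x * indicator (box a b) x) = 0" for c d
    proof (cases "box c d \<inter> box a b = {}")
      case True
      then have *: "indicator (box c d) x *\<^sub>R (v x * indicator (box a b) x) = 0" for x
        by (auto simp: indicator_def)
      show ?thesis unfolding set_lebesgue_integral_def * by simp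
    next
      case False
      obtain e h where eh: "box c d \<inter> box a b = box e h"
        using box_Int_box[of c d a b] by blast
      then have "cbox e h \<subseteq> cbox a b"
        using False closure_mono[of "box e h" "box a b"] by (metis closure_box inf_bot_right inf_sup_ord(2))
      then have "(LINT x|lborel. v x * indicator (box e h) x) = 0"
        using that by (intro box0) auto
      also have "(\<lambda>x. v x * indicator (box e h) x) = (\<lambda>x. indicator (box c d) x *\<^sub>R (v x * indicator (box a b) x))"
        unfolding eh[symmetric] by (auto simp: indicator_def)
      finally show ?thesis by (simp add: set_lebesgue_integral_def)
    qed
    from AE_eq_0_of_box_integrals[OF vi this] show ?thesis
      by eventually_elim auto
  qed
  define F where "F = {box a b | a b. cbox a b \<subseteq> \<Omega>}"
  have UF: "\<Union>F = \<Omega>"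
  proof
    show "\<Union>F \<subseteq> \<Omega>" unfolding F_def using box_subset_cbox by blast
    show "\<Omega> \<subseteq> \<Union>F"
    proof
      fix x assume "x \<in> \<Omega>"
      then obtain a b where "cbox a b \<subseteq> \<Omega>" "x \<in> box a b"
        using \<open>open \<Omega>\<close> by (meson open_contains_cbox)
      then show "x \<in> \<Union>F" unfolding F_def by blast
    qed
  qed
  have "open X" if "X \<in> F" for X using that by (auto simp: F_def)
  \<comment> \<open>Almost-everywhere statements combine only over countable families, so a Lindelof
    subcover replaces the family of all boxes.\<close>
  then obtain F' where F': "F' \<subseteq> F" "countable F'" "\<Union>F' = \<Union>F"
    by (rule Lindelof)
  have "AE x in lborel. \<forall>X\<in>F'. x \<in> X \<longrightarrow> v x = 0"
    unfolding AE_ball_countable[OF F'(2)] using F'(1) AE_box by (auto simp: F_def)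
  then show ?thesis using F'(3) UF by (auto elim!: eventually_mono)
qed

section \<open>Weak gradients\<close>

lemma l2_eqI: "AE x in lborel. rep_l2 v x = rep_l2 w x \<Longrightarrow> v = w"
  using Quotient3_rel_abs[OF Quotient3_l2, of "rep_l2 v" "rep_l2 w"]
  by (simp add: l2_rel_def sq_int_rep abs_rep_l2)

lemma rep_l2_measurable [measurable]: "rep_l2 v \<in> borel_measurable borel"
  using sq_int_rep[of v] by (simp add: sq_int_def)

lemma inner_abs_l2: "sq_int f \<Longrightarrow> v \<bullet> abs_l2 f = (LINT x|lborel. rep_l2 v x \<bullet> f x)"
  using inner_l2.abs_eq[OF l2_rel_rep[of v], of f]
  by (simp add: l2_rel_def abs_rep_l2)

lemma inner_l2_rep: "v \<bullet> w = (LINT x|lborel. rep_l2 v x \<bullet> rep_l2 w x)"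
  using inner_abs_l2[OF sq_int_rep[of w], of v] by (simp add: abs_rep_l2)

lemma rep_l2_add: "AE x in lborel. rep_l2 (v + w) x = rep_l2 v x + rep_l2 w x"
  using rep_abs_l2[OF sq_int_add[OF sq_int_rep[of v] sq_int_rep[of w]]]
    abs_l2_add[OF sq_int_rep[of v] sq_int_rep[of w]] by (simp add: abs_rep_l2)

lemma rep_l2_scale: "AE x in lborel. rep_l2 (c *\<^sub>R v) x = c *\<^sub>R rep_l2 v x"
  using rep_abs_l2[OF sq_int_scale[OF sq_int_rep[of v]]]
    abs_l2_scale[OF sq_int_rep[of v]] by (simp add: abs_rep_l2)

lemma rep_l2_zero: "AE x in lborel. rep_l2 0 x = 0"
  using rep_l2_scale[of 0 0] by simp

text \<open>Components of vector fields, rows of Jacobians and the trace are all of this form, so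
  additivity, boundedness and commutation with integrals are proved once.\<close>

definition l2_map :: "('b \<Rightarrow> 'c) \<Rightarrow> ('a::euclidean_space, 'b::euclidean_space) l2 \<Rightarrow> ('a, 'c::euclidean_space) l2" where
  "l2_map L v = abs_l2 (\<lambda>x. L (rep_l2 v x))"

lemma sq_int_linear:
  fixes L :: "'b::euclidean_space \<Rightarrow> 'c::euclidean_space"
  assumes L: "linear L" and f: "sq_int f"
  shows "sq_int (\<lambda>x. L (f x))"
proof -
  have bl: "bounded_linear L" using L by (rule linear_conv_bounded_linear[THEN iffD1])
  have [measurable]: "f \<in> borel_measurable borel" "L \<in> borel_measurable borel"
    using f borel_measurable_continuous_onI[OF linear_continuous_on[OF bl]] by (auto simp: sq_int_def)
  obtain K where K: "\<And>y. norm (L y) \<le> norm y * K"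
    using bounded_linear.bounded[OF bl] by blast
  have "integrable lborel (\<lambda>x. (norm (L (f x)))\<^sup>2)"
  proof (rule Bochner_Integration.integrable_bound)
    show "integrable lborel (\<lambda>x. (norm (f x))\<^sup>2 * K\<^sup>2)" using f by (auto simp: sq_int_def)
    show "AE x in lborel. norm ((norm (L (f x)))\<^sup>2) \<le> norm ((norm (f x))\<^sup>2 * K\<^sup>2)"
      using power_mono[OF K norm_ge_zero, of _ 2] by (auto simp: power_mult_distrib)
  qed simp
  then show ?thesis by (simp add: sq_int_def)
qed

lemma rep_l2_map: "linear L \<Longrightarrow> AE x in lborel. rep_l2 (l2_map L v) x = L (rep_l2 v x)"
  unfolding l2_map_def by (rule rep_abs_l2[OF sq_int_linear[OF _ sq_int_rep]])

text \<open>Linearity holds almost everywhere on representatives, and the operator bound of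
  \<open>L\<close> is inherited by integrating its square. Boundedness is what carries
  \<open>l2_map L\<close> through Bochner integrals.\<close>

lemma bounded_linear_l2_map:
  assumes L: "linear L"
  shows "bounded_linear (l2_map L)"
proof -
  have bl: "bounded_linear L" using L by (rule linear_conv_bounded_linear[THEN iffD1])
  obtain K where K: "\<And>y. norm (L y) \<le> norm y * K" "K \<ge> 0"
    using bounded_linear.nonneg_bounded[OF bl] by blast
  show ?thesis
  proof (rule bounded_linear_intro)
    show "l2_map L (v + w) = l2_map L v + l2_map L w" for v w
    proof (rule l2_eqI)
      show "AE x in lborel. rep_l2 (l2_map L (v + w)) x = rep_l2 (l2_map L v + l2_map L w) x"
        using rep_l2_map[OF L, of "v + w"] rep_l2_map[OF L, of v] rep_l2_map[OF L, of w]
          rep_l2_add[of v w] rep_l2_add[of "l2_map L v" "l2_map L w"]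
        by eventually_elim (simp add: linear_add[OF L])
    qed
    show "l2_map L (c *\<^sub>R v) = c *\<^sub>R l2_map L v" for c v
    proof (rule l2_eqI)
      show "AE x in lborel. rep_l2 (l2_map L (c *\<^sub>R v)) x = rep_l2 (c *\<^sub>R l2_map L v) x"
        using rep_l2_map[OF L, of "c *\<^sub>R v"] rep_l2_map[OF L, of v]
          rep_l2_scale[of c v] rep_l2_scale[of c "l2_map L v"]
        by eventually_elim (simp add: linear_scale[OF L])
    qed
    show "norm (l2_map L v) \<le> norm v * K" for v
    proof (rule power2_le_imp_le)
      have "(norm (l2_map L v))\<^sup>2 = (LINT x|lborel. (norm (L (rep_l2 v x)))\<^sup>2)"
        unfolding l2_map_def by (rule norm_abs_l2[OF sq_int_linear[OF L sq_int_rep]])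
      also have "\<dots> \<le> (LINT x|lborel. (norm (rep_l2 v x))\<^sup>2 * K\<^sup>2)"
        using sq_int_linear[OF L sq_int_rep[of v]] sq_int_rep[of v] power_mono[OF K(1) norm_ge_zero, of _ 2]
        by (intro integral_mono) (auto simp: sq_int_def power_mult_distrib)
      also have "\<dots> = (norm v * K)\<^sup>2"
        using norm_abs_l2[OF sq_int_rep[of v]] by (simp add: abs_rep_l2 power_mult_distrib)
      finally show "(norm (l2_map L v))\<^sup>2 \<le> (norm v * K)\<^sup>2" .
      show "0 \<le> norm v * K" using K by simp
    qed
  qed
qed

text \<open>Writing \<open>L2 \<Omega>\<close> as an orthogonal complement shows that it is stable under Bochner integrals.\<close>

lemma L2_iff_orthogonal:
  fixes v :: "('a::euclidean_space, 'b::euclidean_space) l2"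
  assumes [measurable]: "\<Omega> \<in> sets borel"
  shows "v \<in> L2 \<Omega> \<longleftrightarrow> (\<forall>w\<in>L2 (- \<Omega>). v \<bullet> w = 0)"
proof
  assume v: "v \<in> L2 \<Omega>"
  show "\<forall>w\<in>L2 (- \<Omega>). v \<bullet> w = 0"
  proof
    fix w :: "('a, 'b) l2" assume w: "w \<in> L2 (- \<Omega>)"
    have "AE x in lborel. rep_l2 v x \<bullet> rep_l2 w x = 0"
      using v w unfolding L2_def mem_Collect_eq by eventually_elim auto
    then show "v \<bullet> w = 0"
      unfolding inner_l2_rep by (simp add: integral_eq_zero_AE)
  qed
next
  assume *: "\<forall>w\<in>L2 (- \<Omega>). v \<bullet> w = 0"
  \<comment> \<open>The witness is \<open>v\<close> cut off to the complement of \<Omega>: its inner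
    product with \<open>v\<close> is the integral of the squared norm of \<open>v\<close> over that
    complement.\<close>
  define f where "f x = indicator (- \<Omega>) x *\<^sub>R rep_l2 v x" for x
  have "sq_int f"
    unfolding sq_int_def f_def
  proof (intro conjI)
    show "integrable lborel (\<lambda>x. (norm (indicator (- \<Omega>) x *\<^sub>R rep_l2 v x))\<^sup>2)"
      by (rule Bochner_Integration.integrable_bound[of _ "\<lambda>x. (norm (rep_l2 v x))\<^sup>2"])
        (use sq_int_rep[of v] in \<open>auto simp: sq_int_def indicator_def intro!: AE_I2\<close>)
  qed measurable
  then have "AE x in lborel. rep_l2 (abs_l2 f) x = f x" "v \<bullet> abs_l2 f = (LINT x|lborel. rep_l2 v x \<bullet> f x)"
    and fi: "integrable lborel (\<lambda>x. rep_l2 v x \<bullet> f x)"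
    by (auto intro: rep_abs_l2 inner_abs_l2 sq_int_inner sq_int_rep)
  then have "abs_l2 f \<in> L2 (- \<Omega>)"
    unfolding L2_def mem_Collect_eq by (auto elim!: eventually_mono simp: f_def)
  with * have "(LINT x|lborel. rep_l2 v x \<bullet> f x) = 0"
    using \<open>v \<bullet> abs_l2 f = _\<close> by simp
  then have "AE x in lborel. rep_l2 v x \<bullet> f x = 0"
    using fi by (subst (asm) integral_nonneg_eq_0_iff_AE) (auto simp: f_def)
  then show "v \<in> L2 \<Omega>"
    unfolding L2_def mem_Collect_eq by eventually_elim (auto simp: f_def)
qed

lemma subspace_L2: "subspace (L2 \<Omega>)"
  unfolding subspace_def
proof (intro conjI ballI allI)
  show "0 \<in> L2 \<Omega>" using rep_l2_zero by (auto simp: L2_def elim!: eventually_mono)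
  show "x + y \<in> L2 \<Omega>" if "x \<in> L2 \<Omega>" "y \<in> L2 \<Omega>" for x y
    using that rep_l2_add[of x y] unfolding L2_def mem_Collect_eq by eventually_elim auto
  show "c *\<^sub>R x \<in> L2 \<Omega>" if "x \<in> L2 \<Omega>" for c x
    using that rep_l2_scale[of c x] unfolding L2_def mem_Collect_eq by eventually_elim auto
qed

lemma set_integral_bounded_linear:
  assumes "bounded_linear L" "set_integrable M A w"
  shows "set_integrable M A (\<lambda>s. L (w s))" "L (LINT s:A|M. w s) = (LINT s:A|M. L (w s))"
proof -
  have eq: "(\<lambda>s. indicator A s *\<^sub>R L (w s)) = (\<lambda>s. L (indicator A s *\<^sub>R w s))"
    by (simp add: linear_scale[OF bounded_linear.linear[OF assms(1)]])
  have w: "integrable M (\<lambda>s. indicator A s *\<^sub>R w s)"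
    using assms(2) by (simp only: set_integrable_def)
  show "set_integrable M A (\<lambda>s. L (w s))"
    unfolding set_integrable_def eq by (rule integrable_bounded_linear[OF assms(1) w])
  show "L (LINT s:A|M. w s) = (LINT s:A|M. L (w s))"
    unfolding set_lebesgue_integral_def eq by (rule integral_bounded_linear[OF assms(1) w, symmetric])
qed

lemma L2_integral:
  fixes v :: "'m \<Rightarrow> ('a::euclidean_space, 'b::euclidean_space) l2"
  assumes "\<Omega> \<in> sets borel" "set_integrable M A v" "AE s\<in>A in M. v s \<in> L2 \<Omega>"
  shows "(LINT s:A|M. v s) \<in> L2 \<Omega>"
  unfolding L2_iff_orthogonal[OF assms(1)]
proof
  fix w :: "('a, 'b) l2" assume w: "w \<in> L2 (- \<Omega>)"
  have "(LINT s:A|M. v s) \<bullet> w = (LINT s:A|M. v s \<bullet> w)"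
    by (rule set_integral_bounded_linear[OF bounded_linear_inner_left assms(2)])
  also have "\<dots> = 0"
    unfolding set_lebesgue_integral_def using assms(3) w
    by (intro integral_eq_zero_AE) (auto elim!: eventually_mono simp: L2_iff_orthogonal[OF assms(1)] indicator_def)
  finally show "(LINT s:A|M. v s) \<bullet> w = 0" .
qed

section \<open>Uniqueness of weak gradients and their stability under integrals\<close>

lemma sq_int_compact_support:
  fixes \<phi> :: "'a::euclidean_space \<Rightarrow> 'b::euclidean_space"
  assumes "continuous_on UNIV \<phi>" "compact K" "\<And>x. x \<notin> K \<Longrightarrow> \<phi> x = 0"
  shows "sq_int \<phi>"
  unfolding sq_int_def
proof
  show "\<phi> \<in> borel_measurable lborel"
    using borel_measurable_continuous_onI[OF assms(1)] by simp
  have "integrable lborel (\<lambda>x. indicator K x *\<^sub>R (norm (\<phi> x))\<^sup>2)"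
    by (intro borel_integrable_compact assms continuous_intros continuous_on_subset[OF assms(1)]) auto
  also have "(\<lambda>x. indicator K x *\<^sub>R (norm (\<phi> x))\<^sup>2) = (\<lambda>x. (norm (\<phi> x))\<^sup>2)"
    using assms(3) by (intro ext) (auto simp: indicator_def)
  finally show "integrable lborel (\<lambda>x. (norm (\<phi> x))\<^sup>2)" .
qed

lemma sq_int_test_fun:
  assumes "test_fun \<Omega> \<phi>"
  shows "sq_int \<phi>" "sq_int (pdiff i \<phi>)"
proof -
  let ?K = "closure {x. \<phi> x \<noteq> 0}"
  have K: "compact ?K" using assms by (simp add: test_fun_def)
  show "sq_int \<phi>"
    using closure_subset[of "{x. \<phi> x \<noteq> 0}"]
    by (intro sq_int_compact_support[OF test_fun_continuous[OF assms] K]) auto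
  have "C_k (Suc 0) \<phi>" using assms by (simp only: test_fun_def)
  then have "continuous_on UNIV (pdiff i \<phi>)" by simp
  moreover have "pdiff i \<phi> x = 0" if "x \<notin> ?K" for x
  proof -
    have "(\<phi> has_derivative (\<lambda>h. 0)) (at x)"
    proof (rule has_derivative_transform_within_open[where s = "- ?K"])
      show "((\<lambda>x. 0) has_derivative (\<lambda>h. 0)) (at x)" by simp
      show "0 = \<phi> y" if "y \<in> - ?K" for y
        using that closure_subset[of "{x. \<phi> x \<noteq> 0}"] by auto
    qed (use that in auto)
    then show ?thesis by (rule pdiff_eq)
  qed
  ultimately show "sq_int (pdiff i \<phi>)"
    by (intro sq_int_compact_support[OF _ K])
qed

lemma linear_axis: "linear (axis i :: 'b::real_vector \<Rightarrow> 'b^'n)"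
  by (rule linearI) (auto simp: vec_eq_iff axis_def)

text \<open>The field \<open>axis i (\<phi> x)\<close> picks out the \<open>i\<close>-th component
  of \<open>G\<close>. Rewriting the integrals as inner products with fixed elements exhibits the
  condition as continuous and linear in the pair of \<open>v\<close> and \<open>G\<close>.\<close>

lemma has_weak_grad_iff:
  "has_weak_grad \<Omega> v G \<longleftrightarrow> v \<in> L2 \<Omega> \<and> G \<in> L2 \<Omega> \<and>
     (\<forall>\<phi>. test_fun \<Omega> \<phi> \<longrightarrow> (\<forall>i. v \<bullet> abs_l2 (pdiff i \<phi>) + G \<bullet> abs_l2 (\<lambda>x. axis i (\<phi> x)) = 0))"
proof -
  have "v \<bullet> abs_l2 (pdiff i \<phi>) = (LINT x|lborel. rep_l2 v x * pdiff i \<phi> x)"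
       "G \<bullet> abs_l2 (\<lambda>x. axis i (\<phi> x)) = (LINT x|lborel. rep_l2 G x $ i * \<phi> x)"
    if "test_fun \<Omega> \<phi>" for \<phi> i
    using that by (simp_all add: inner_abs_l2 sq_int_test_fun sq_int_linear[OF linear_axis] inner_axis)
  then show ?thesis
    unfolding has_weak_grad_def by (auto simp: eq_neg_iff_add_eq_0)
qed

text \<open>Inside \<Omega> the fundamental lemma annihilates every component of the difference;
  outside, both candidates vanish by membership in \<open>L2 \<Omega>\<close>.\<close>

lemma has_weak_grad_unique:
  assumes "open \<Omega>" "has_weak_grad \<Omega> v G" "has_weak_grad \<Omega> v G'"
  shows "G = G'"
proof -
  define D where "D = G - G'"
  have D: "D \<in> L2 \<Omega>"
    using assms subspace_diff[OF subspace_L2] by (auto simp: D_def has_weak_grad_def)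
  have "AE x in lborel. x \<in> \<Omega> \<longrightarrow> rep_l2 D x $ i = 0" for i
  proof (rule fundamental_lemma_variations[OF \<open>open \<Omega>\<close>])
    show "sq_int (\<lambda>x. rep_l2 D x $ i)"
      by (rule sq_int_linear[OF bounded_linear.linear[OF bounded_linear_vec_nth] sq_int_rep])
    fix \<phi> assume "test_fun \<Omega> \<phi>"
    moreover from this have "D \<bullet> abs_l2 (\<lambda>x. axis i (\<phi> x)) = 0"
      using assms unfolding D_def has_weak_grad_iff inner_diff_left by (metis add_left_cancel diff_self)
    ultimately show "(LINT x|lborel. rep_l2 D x $ i * \<phi> x) = 0"
      by (simp add: inner_abs_l2 sq_int_test_fun sq_int_linear[OF linear_axis] inner_axis)
  qed
  then have "AE x in lborel. \<forall>i\<in>UNIV. x \<in> \<Omega> \<longrightarrow> rep_l2 D x $ i = 0"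
    by (intro AE_finite_allI) auto
  with D have "AE x in lborel. rep_l2 D x = rep_l2 0 x"
    using rep_l2_zero[where ?'a = "real^'a" and ?'b = "real^'a"] unfolding L2_def mem_Collect_eq by eventually_elim (auto simp: vec_eq_iff)
  then have "D = 0" by (rule l2_eqI)
  then show ?thesis by (simp add: D_def)
qed

lemma grad_eq: "open \<Omega> \<Longrightarrow> has_weak_grad \<Omega> v G \<Longrightarrow> grad \<Omega> v = G"
  unfolding grad_def by (rule the_equality) (auto intro: has_weak_grad_unique)

lemma has_weak_grad_grad: "open \<Omega> \<Longrightarrow> v \<in> H10 \<Omega> \<Longrightarrow> has_weak_grad \<Omega> v (grad \<Omega> v)"
  using grad_eq[of \<Omega> v] by (auto simp: H10_def H1_def)

text \<open>The defining equations pair \<open>v s\<close> and \<open>G s\<close> with fixed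
  elements, and such pairings commute with the Bochner integral. Membership in
  \<open>L2 \<Omega>\<close> is preserved as well, being an orthogonality condition.\<close>

lemma has_weak_grad_integral:
  assumes "open \<Omega>" "set_integrable M A v" "set_integrable M A G"
    and wg: "AE s\<in>A in M. has_weak_grad \<Omega> (v s) (G s)"
  shows "has_weak_grad \<Omega> (LINT s:A|M. v s) (LINT s:A|M. G s)"
  unfolding has_weak_grad_iff
proof (intro conjI allI impI)
  have \<Omega>: "\<Omega> \<in> sets borel" using assms by auto
  show "(LINT s:A|M. v s) \<in> L2 \<Omega>" "(LINT s:A|M. G s) \<in> L2 \<Omega>"
    using wg by (auto intro!: L2_integral[OF \<Omega>] assms elim!: eventually_mono simp: has_weak_grad_def)
  fix \<phi> i assume \<phi>: "test_fun \<Omega> \<phi>"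
  let ?p = "abs_l2 (pdiff i \<phi>)" and ?a = "abs_l2 (\<lambda>x. axis i (\<phi> x))"
  note v = set_integral_bounded_linear[OF bounded_linear_inner_left[of ?p] assms(2)]
    and G = set_integral_bounded_linear[OF bounded_linear_inner_left[of ?a] assms(3)]
  have "(LINT s:A|M. v s) \<bullet> ?p + (LINT s:A|M. G s) \<bullet> ?a = (LINT s:A|M. v s \<bullet> ?p + G s \<bullet> ?a)"
    using v G by (simp add: set_integral_add)
  also have "\<dots> = 0"
    unfolding set_lebesgue_integral_def using wg \<phi>
    by (intro integral_eq_zero_AE) (auto elim!: eventually_mono simp: has_weak_grad_iff indicator_def)
  finally show "(LINT s:A|M. v s) \<bullet> ?p + (LINT s:A|M. G s) \<bullet> ?a = 0" .
qed

section \<open>Jacobian and divergence of vector fields\<close>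

definition has_weak_grad_vec ::
    "(real^'n) set \<Rightarrow> (real^'n, real^'n) l2 \<Rightarrow> (real^'n, real^'n^'n) l2 \<Rightarrow> bool" where
  "has_weak_grad_vec \<Omega> V M \<longleftrightarrow> (\<forall>i. has_weak_grad \<Omega> (component V i) (l2_map (\<lambda>A. A $ i) M))"

lemma linear_nth: "linear (\<lambda>A :: 'b::real_normed_vector^'n. A $ i)"
  by (rule bounded_linear.linear[OF bounded_linear_vec_nth])

lemma component_l2_map: "component V i = l2_map (\<lambda>y. y $ i) V"
  by (simp add: component_def l2_map_def)

text \<open>Assembling the vector as a sum of \<open>axis i (f i x)\<close> leaves only sums and
  linear images of square-integrable functions.\<close>

lemma sq_int_vec:
  fixes f :: "'n::finite \<Rightarrow> 'a::euclidean_space \<Rightarrow> 'b::euclidean_space"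
  assumes f: "\<And>i. sq_int (f i)"
  shows "sq_int (\<lambda>x. \<chi> i. f i x)"
proof -
  have "sq_int (\<lambda>x. \<Sum>i\<in>I. axis i (f i x))" if "finite I" for I
    using that by induction (auto intro: sq_int_zero sq_int_add sq_int_linear[OF linear_axis f])
  moreover have "(\<Sum>i\<in>UNIV. axis i (f i x)) = (\<chi> i. f i x)" for x
    by (simp add: vec_eq_iff axis_def if_distrib cong: if_cong)
  ultimately show ?thesis by (metis (no_types, lifting) ext finite)
qed

lemma rep_grad_vec: "AE x in lborel. rep_l2 (grad_vec \<Omega> V) x = (\<chi> i. rep_l2 (grad \<Omega> (component V i)) x)"
  unfolding grad_vec_def by (intro rep_abs_l2 sq_int_vec sq_int_rep)

lemma row_grad_vec: "l2_map (\<lambda>A. A $ i) (grad_vec \<Omega> V) = grad \<Omega> (component V i)"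
proof (rule l2_eqI)
  show "AE x in lborel. rep_l2 (l2_map (\<lambda>A. A $ i) (grad_vec \<Omega> V)) x = rep_l2 (grad \<Omega> (component V i)) x"
    using rep_l2_map[OF linear_nth[of i], of "grad_vec \<Omega> V"] rep_grad_vec[of \<Omega> V]
    by eventually_elim simp
qed

lemma rows_eq_imp_eq:
  assumes "\<And>i. l2_map (\<lambda>A. A $ i) M = l2_map (\<lambda>A. A $ i) M'"
  shows "M = M'"
proof (rule l2_eqI)
  have "AE x in lborel. rep_l2 M x $ i = rep_l2 M' x $ i" for i
    using rep_l2_map[OF linear_nth[of i], of M] rep_l2_map[OF linear_nth[of i], of M']
    unfolding assms by eventually_elim simp
  then have "AE x in lborel. \<forall>i\<in>UNIV. rep_l2 M x $ i = rep_l2 M' x $ i"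
    by (intro AE_finite_allI) auto
  then show "AE x in lborel. rep_l2 M x = rep_l2 M' x"
    by eventually_elim (simp add: vec_eq_iff)
qed

lemma grad_vec_eq: "open \<Omega> \<Longrightarrow> has_weak_grad_vec \<Omega> V M \<Longrightarrow> grad_vec \<Omega> V = M"
  by (rule rows_eq_imp_eq) (simp add: row_grad_vec has_weak_grad_vec_def grad_eq)

lemma has_weak_grad_vec_grad_vec: "open \<Omega> \<Longrightarrow> V \<in> H10_vec \<Omega> \<Longrightarrow> has_weak_grad_vec \<Omega> V (grad_vec \<Omega> V)"
  by (simp add: has_weak_grad_vec_def row_grad_vec H10_vec_def has_weak_grad_grad)

lemma H10_vec_subset_L2:
  assumes "open \<Omega>"
  shows "H10_vec \<Omega> \<subseteq> L2 \<Omega>"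
proof
  fix V assume V: "V \<in> H10_vec \<Omega>"
  have "component V i \<in> L2 \<Omega>" for i
    using V has_weak_grad_grad[OF assms] by (auto simp: H10_vec_def has_weak_grad_def)
  then have "AE x in lborel. \<forall>i\<in>UNIV. x \<notin> \<Omega> \<longrightarrow> rep_l2 (component V i) x = 0"
    by (intro AE_finite_allI) (auto simp: L2_def)
  moreover have "AE x in lborel. \<forall>i\<in>UNIV. rep_l2 (component V i) x = rep_l2 V x $ i"
    unfolding component_l2_map by (intro AE_finite_allI rep_l2_map linear_nth) auto
  ultimately show "V \<in> L2 \<Omega>"
    unfolding L2_def mem_Collect_eq by eventually_elim (auto simp: vec_eq_iff)
qed

lemma has_weak_grad_vec_integral:
  assumes "open \<Omega>" "set_integrable M A V" "set_integrable M A G"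
    and wg: "AE s\<in>A in M. has_weak_grad_vec \<Omega> (V s) (G s)"
  shows "has_weak_grad_vec \<Omega> (LINT s:A|M. V s) (LINT s:A|M. G s)"
  unfolding has_weak_grad_vec_def component_l2_map
proof
  fix i
  note * = set_integral_bounded_linear[OF bounded_linear_l2_map[OF linear_nth[of i]]]
  show "has_weak_grad \<Omega> (l2_map (\<lambda>y. y $ i) (LINT s:A|M. V s)) (l2_map (\<lambda>A. A $ i) (LINT s:A|M. G s))"
    unfolding *(2)[OF assms(2)] *(2)[OF assms(3)]
    using wg by (intro has_weak_grad_integral * assms)
      (auto elim!: eventually_mono simp: has_weak_grad_vec_def component_l2_map)
qed

lemma linear_trace: "linear (trace :: real^'n^'n \<Rightarrow> real)"
  by (rule linearI) (auto simp: trace_def sum.distrib sum_distrib_left)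

text \<open>In this form the divergence is a fixed bounded linear map of the Jacobian, so its time
  derivatives and integrals come for free, and the energy argument may treat it as an abstract
  operator.\<close>

lemma div_vec_eq_trace: "div_vec \<Omega> V = l2_map trace (grad_vec \<Omega> V)"
proof (rule l2_eqI)
  let ?g = "\<lambda>i. grad \<Omega> (component V i)"
  have "AE x in lborel. rep_l2 (\<Sum>i\<in>I. component (?g i) i) x = (\<Sum>i\<in>I. rep_l2 (?g i) x $ i)" if "finite I" for I
    using that
  proof induction
    case empty
    then show ?case using rep_l2_zero by simp
  next
    case (insert i I)
    show ?case
      using insert(3) rep_l2_add[of "component (?g i) i" "\<Sum>i\<in>I. component (?g i) i"]
        rep_l2_map[OF linear_nth[of i], of "?g i"]
      by eventually_elim (use insert(1,2) in \<open>simp add: component_l2_map\<close>)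
  qed
  from this[OF finite[of UNIV]] show "AE x in lborel. rep_l2 (div_vec \<Omega> V) x = rep_l2 (l2_map trace (grad_vec \<Omega> V)) x"
    using rep_l2_map[OF linear_trace, of "grad_vec \<Omega> V"] rep_grad_vec[of \<Omega> V]
    by eventually_elim (simp add: div_vec_def trace_def)
qed

section \<open>Absolutely continuous functions of time\<close>

text \<open>Common source of integration by parts and of the duality of convolutions: the weight is
  the indicator of a triangle in one case and the kernel in the other. Since \<open>m\<close> is
  bounded, \<open>K\<close> times the product of the norms of \<open>f s\<close> and
  \<open>h t\<close> is an integrable majorant, which justifies Fubini.\<close>

lemma weighted_fubini:
  fixes f h :: "real \<Rightarrow> 'h::{real_inner, banach, second_countable_topology}" and m :: "real \<times> real \<Rightarrow> real"
  assumes f: "integrable lborel f" and h: "integrable lborel h"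
    and m: "m \<in> borel_measurable borel" and bound: "\<And>p. \<bar>m p\<bar> \<le> K"
  shows "integrable lborel (\<lambda>s. f s \<bullet> (LINT t|lborel. m (s, t) *\<^sub>R h t))" (is ?th1)
    and "integrable lborel (\<lambda>t. (LINT s|lborel. m (s, t) *\<^sub>R f s) \<bullet> h t)" (is ?th2)
    and "(LINT s|lborel. f s \<bullet> (LINT t|lborel. m (s, t) *\<^sub>R h t)) =
         (LINT t|lborel. (LINT s|lborel. m (s, t) *\<^sub>R f s) \<bullet> h t)" (is ?th3)
proof -
  have [measurable]: "f \<in> borel_measurable borel" "h \<in> borel_measurable borel"
    using f h by auto
  have mm [measurable]: "m \<in> borel_measurable (borel \<Otimes>\<^sub>M borel)"
    using m by (simp add: borel_prod)
  have "K \<ge> 0" using bound[of undefined] by linarith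
  have mi: "integrable lborel (\<lambda>t. m (s, t) *\<^sub>R h t)" "integrable lborel (\<lambda>s. m (s, t) *\<^sub>R f s)" for s t
  proof -
    show "integrable lborel (\<lambda>t. m (s, t) *\<^sub>R h t)"
      by (rule Bochner_Integration.integrable_bound[of _ "\<lambda>t. K * norm (h t)"])
        (use h bound \<open>K \<ge> 0\<close> in \<open>auto intro!: AE_I2 mult_right_mono simp: abs_mult\<close>)
    show "integrable lborel (\<lambda>s. m (s, t) *\<^sub>R f s)"
      by (rule Bochner_Integration.integrable_bound[of _ "\<lambda>t. K * norm (f t)"])
        (use f bound \<open>K \<ge> 0\<close> in \<open>auto intro!: AE_I2 mult_right_mono simp: abs_mult\<close>)
  qed
  have "integrable (lborel \<Otimes>\<^sub>M lborel) (\<lambda>(s, t). norm (f s) * norm (h t))"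
    by (rule lborel_pair.Fubini_integrable) (use f h in \<open>auto simp: abs_mult\<close>)
  then have "integrable (lborel \<Otimes>\<^sub>M lborel) (\<lambda>p. K * (case p of (s, t) \<Rightarrow> norm (f s) * norm (h t)))"
    by (rule integrable_mult_right)
  then have int: "integrable (lborel \<Otimes>\<^sub>M lborel) (\<lambda>(s, t). m (s, t) * (f s \<bullet> h t))"
  proof (rule Bochner_Integration.integrable_bound)
    have "\<bar>m (s, t) * (f s \<bullet> h t)\<bar> \<le> K * (norm (f s) * norm (h t))" for s t
      unfolding abs_mult using bound \<open>K \<ge> 0\<close> by (intro mult_mono Cauchy_Schwarz_ineq2) auto
    then show "AE p in lborel \<Otimes>\<^sub>M lborel. norm (case p of (s, t) \<Rightarrow> m (s, t) * (f s \<bullet> h t))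
        \<le> norm (K * (case p of (s, t) \<Rightarrow> norm (f s) * norm (h t)))"
      using \<open>K \<ge> 0\<close> by (intro AE_I2) (auto simp: abs_mult)
  qed measurable
  have eq: "(LINT t|lborel. m (s, t) * (f s \<bullet> h t)) = f s \<bullet> (LINT t|lborel. m (s, t) *\<^sub>R h t)"
    "(LINT s|lborel. m (s, t) * (f s \<bullet> h t)) = (LINT s|lborel. m (s, t) *\<^sub>R f s) \<bullet> h t" for s t
    using integral_bounded_linear[OF bounded_linear_inner_right[of "f s"] mi(1)[of s]]
      integral_bounded_linear[OF bounded_linear_inner_left[of "h t"] mi(2)[of t]] by simp_all
  show ?th1 ?th2 ?th3
    using lborel_pair.integrable_fst'[OF int] lborel_pair.integrable_snd[of "\<lambda>s t. m (s, t) * (f s \<bullet> h t)"]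
      lborel_pair.Fubini_integral[of "\<lambda>s t. m (s, t) * (f s \<bullet> h t)"] int
    by (simp_all add: eq)
qed

lemma continuous_indefinite_integral:
  fixes f :: "real \<Rightarrow> 'h::{banach, second_countable_topology}"
  assumes f: "integrable lborel f"
  shows "continuous_on UNIV (\<lambda>t. LINT s|lborel. indicator {..t} s *\<^sub>R f s)"
  unfolding continuous_on_sequentially comp_def
proof (intro allI ballI impI, elim conjE)
  fix x and t assume x: "x \<longlonglongrightarrow> (t::real)"
  have [measurable]: "f \<in> borel_measurable borel" using f by auto
  show "(\<lambda>n. LINT s|lborel. indicator {..x n} s *\<^sub>R f s) \<longlonglongrightarrow> (LINT s|lborel. indicator {..t} s *\<^sub>R f s)"
  proof (rule integral_dominated_convergence)
    show "integrable lborel (\<lambda>s. norm (f s))" using f by simp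
    \<comment> \<open>The indicators converge except possibly at s = t, a null set.\<close>
    show "AE s in lborel. (\<lambda>n. indicator {..x n} s *\<^sub>R f s) \<longlonglongrightarrow> indicator {..t} s *\<^sub>R f s"
      using AE_lborel_singleton[of t]
    proof eventually_elim
      fix s assume "s \<noteq> t"
      then consider "s < t" | "s > t" by linarith
      then have "\<forall>\<^sub>F n in sequentially. indicator {..x n} s = (indicator {..t} s :: real)"
      proof cases
        case 1
        then show ?thesis using order_tendstoD(1)[OF x 1] by (auto elim!: eventually_mono)
      next
        case 2
        then show ?thesis using order_tendstoD(2)[OF x 2] by (auto elim!: eventually_mono)
      qed
      then show "(\<lambda>n. indicator {..x n} s *\<^sub>R f s) \<longlonglongrightarrow> indicator {..t} s *\<^sub>R f s"
        by (intro tendsto_scaleR tendsto_const tendsto_eventually)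
    qed
  qed (auto simp: indicator_def)
qed

text \<open>The product of the two total integrals is an integral over the plane. The half plane
  where t is at most s contributes the first term and its complement the second; the diagonal meets
  every section in a null set.\<close>

lemma integral_by_parts:
  fixes f h :: "real \<Rightarrow> 'h::{real_inner, banach, second_countable_topology}"
  assumes f: "integrable lborel f" and h: "integrable lborel h"
  shows "integrable lborel (\<lambda>s. f s \<bullet> (LINT t|lborel. indicator {..s} t *\<^sub>R h t))" (is ?th1)
    and "integrable lborel (\<lambda>t. (LINT s|lborel. indicator {..t} s *\<^sub>R f s) \<bullet> h t)" (is ?th2)
    and "(LINT s|lborel. f s \<bullet> (LINT t|lborel. indicator {..s} t *\<^sub>R h t)) +
         (LINT t|lborel. (LINT s|lborel. indicator {..t} s *\<^sub>R f s) \<bullet> h t) =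
         (LINT s|lborel. f s) \<bullet> (LINT t|lborel. h t)" (is ?th3)
proof -
  have [measurable]: "f \<in> borel_measurable borel" "h \<in> borel_measurable borel"
    using f h by auto
  define m :: "real \<times> real \<Rightarrow> real" where "m p = indicator {p. snd p \<le> fst p} p" for p
  have mm: "m \<in> borel_measurable borel"
    unfolding m_def borel_prod[symmetric] by measurable
  have [measurable]: "m \<in> borel_measurable (borel \<Otimes>\<^sub>M borel)" using mm by (simp add: borel_prod)
  have mb: "\<bar>m p\<bar> \<le> 1" for p by (simp add: m_def indicator_def)
  note F = weighted_fubini[OF f h mm mb]
  have m1: "m (s, t) = indicator {..s} t" for s t by (simp add: m_def indicator_def)
  show ?th1 using F(1) by (simp add: m1)
  have tail: "(LINT s|lborel. m (s, t) *\<^sub>R f s) = (LINT s|lborel. f s) - (LINT s|lborel. indicator {..t} s *\<^sub>R f s)" for t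
  proof -
    have i: "integrable lborel (\<lambda>s. indicator {..t} s *\<^sub>R f s)"
      using f by (intro integrable_mult_indicator) auto
    have "(LINT s|lborel. m (s, t) *\<^sub>R f s) = (LINT s|lborel. f s - indicator {..t} s *\<^sub>R f s)"
    proof (rule integral_cong_AE)
      show "AE s in lborel. m (s, t) *\<^sub>R f s = f s - indicator {..t} s *\<^sub>R f s"
        using AE_lborel_singleton[of t] by eventually_elim (auto simp: m_def indicator_def)
    qed simp_all
    then show ?thesis using f i by simp
  qed
  have eq: "(LINT s|lborel. indicator {..t} s *\<^sub>R f s) \<bullet> h t =
      (LINT s|lborel. f s) \<bullet> h t - (LINT s|lborel. m (s, t) *\<^sub>R f s) \<bullet> h t" for t
    by (simp add: tail inner_diff_left)
  have ih: "integrable lborel (\<lambda>t. (LINT s|lborel. f s) \<bullet> h t)" using h by simp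
  show ?th2 unfolding eq by (intro Bochner_Integration.integrable_diff ih F(2))
  have "(LINT s|lborel. f s) \<bullet> (LINT t|lborel. h t) = (LINT t|lborel. (LINT s|lborel. f s) \<bullet> h t)"
    using integral_bounded_linear[OF bounded_linear_inner_right h] by simp
  then show ?th3
    unfolding eq Bochner_Integration.integral_diff[OF ih F(2)] using F(3) by (simp add: m1)
qed

text \<open>Extending \<open>w\<close> by 0 turns the integral over [0,t] into one over a half line,
  the form in which the indefinite integral and integration by parts are stated.\<close>

lemma set_integral_Icc_restrict:
  fixes w :: "real \<Rightarrow> 'h::{banach, second_countable_topology}"
  assumes "t \<le> \<tau>"
  shows "(LINT s:{0..t}|lborel. w s) = (LINT s|lborel. indicator {..t} s *\<^sub>R (indicator {0..\<tau>} s *\<^sub>R w s))"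
  unfolding set_lebesgue_integral_def using assms
  by (intro Bochner_Integration.integral_cong) (auto simp: indicator_def)

lemma set_integral_singleton: "(LINT s:{0..0::real}|lborel. w s) = (0 :: 'h::{banach, second_countable_topology})"
  unfolding set_lebesgue_integral_def
  by (rule integral_eq_zero_AE) (use AE_lborel_singleton[of "0::real"] in \<open>auto elim!: eventually_mono\<close>)

section \<open>Calculus of absolutely continuous functions with values in Banach and Hilbert
  spaces\<close>

lemma has_time_derivD:
  assumes "has_time_deriv T u w"
  shows "set_integrable lborel {0..T} w"
    and "t \<in> {0..T} \<Longrightarrow> u t = u 0 + (LINT s:{0..t}|lborel. w s)"
  using assms unfolding has_time_deriv_def by blast+

lemma has_time_deriv_integral:
  assumes "set_integrable lborel {0..T} w"
  shows "has_time_deriv T (\<lambda>t. LINT s:{0..t}|lborel. w s) w"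
  using assms set_integral_singleton[of w] by (simp add: has_time_deriv_def)

lemma set_integrable_Icc_subset:
  fixes w :: "real \<Rightarrow> 'h::{banach, second_countable_topology}"
  shows "set_integrable lborel {0..T} w \<Longrightarrow> t \<le> T \<Longrightarrow> set_integrable lborel {0..t} w"
  by (rule set_integrable_subset) auto

lemma has_time_deriv_continuous:
  assumes "has_time_deriv T u w"
  shows "continuous_on {0..T} u"
proof -
  let ?w = "\<lambda>s. indicator {0..T} s *\<^sub>R w s"
  have w: "integrable lborel ?w"
    using has_time_derivD(1)[OF assms] by (simp add: set_integrable_def)
  have "continuous_on {0..T} (\<lambda>t. u 0 + (LINT s|lborel. indicator {..t} s *\<^sub>R ?w s))"
    by (intro continuous_intros continuous_on_subset[OF continuous_indefinite_integral[OF w]]) auto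
  then show ?thesis
  proof (rule continuous_on_eq)
    fix t assume t: "t \<in> {0..T}"
    show "u 0 + (LINT s|lborel. indicator {..t} s *\<^sub>R ?w s) = u t"
      using has_time_derivD(2)[OF assms t] set_integral_Icc_restrict[of t T w] t by simp
  qed
qed

lemma has_time_deriv_bounded_linear:
  assumes L: "bounded_linear L" and u: "has_time_deriv T u w"
  shows "has_time_deriv T (\<lambda>t. L (u t)) (\<lambda>t. L (w t))"
  unfolding has_time_deriv_def
proof (intro conjI ballI)
  note w = has_time_derivD(1)[OF u]
  show "set_integrable lborel {0..T} (\<lambda>t. L (w t))"
    using w
    by (rule set_integral_bounded_linear(1)[OF L])
  fix t assume t: "t \<in> {0..T}"
  show "L (u t) = L (u 0) + (LINT s:{0..t}|lborel. L (w s))"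
    using set_integral_bounded_linear(2)[OF L set_integrable_Icc_subset[OF w, of t]] t
    unfolding has_time_derivD(2)[OF u t] by (simp add: linear_add[OF bounded_linear.linear[OF L]])
qed

lemma has_time_deriv_add:
  assumes u: "has_time_deriv T u w" and v: "has_time_deriv T v z"
  shows "has_time_deriv T (\<lambda>t. u t + v t) (\<lambda>t. w t + z t)"
  unfolding has_time_deriv_def
proof (intro conjI ballI)
  have wz: "set_integrable lborel {0..T} w" "set_integrable lborel {0..T} z"
    using u v by (simp_all add: has_time_derivD)
  then show "set_integrable lborel {0..T} (\<lambda>t. w t + z t)" by (rule set_integral_add)
  fix t assume t: "t \<in> {0..T}"
  show "u t + v t = u 0 + v 0 + (LINT s:{0..t}|lborel. w s + z s)"
    unfolding has_time_derivD(2)[OF u t] has_time_derivD(2)[OF v t]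
    using t set_integral_add(2)[OF wz[THEN set_integrable_Icc_subset[where t = t]]] by simp
qed

lemma set_integrable_inner_continuous:
  fixes f g :: "real \<Rightarrow> 'h::{real_inner, banach, second_countable_topology}"
  assumes f: "set_integrable lborel {0..T} f" and g: "continuous_on {0..T} g"
  shows "set_integrable lborel {0..T} (\<lambda>s. f s \<bullet> g s)" "set_integrable lborel {0..T} (\<lambda>s. g s \<bullet> f s)"
proof -
  let ?f = "\<lambda>s. indicator {0..T} s *\<^sub>R f s" and ?g = "\<lambda>s. indicator {0..T} s *\<^sub>R g s"
  have fi: "integrable lborel ?f" using f by (simp add: set_integrable_def)
  then have [measurable]: "?f \<in> borel_measurable borel" by auto
  have [measurable]: "?g \<in> borel_measurable borel"
    using borel_integrable_atLeastAtMost'[OF g] by (auto simp: set_integrable_def)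
  obtain K where K: "K > 0" "\<And>s. s \<in> {0..T} \<Longrightarrow> norm (g s) \<le> K"
    using compact_imp_bounded[OF compact_continuous_image[OF g compact_Icc]]
    by (auto simp: bounded_pos)
  have "integrable lborel (\<lambda>s. ?f s \<bullet> ?g s)"
  proof (rule Bochner_Integration.integrable_bound)
    show "integrable lborel (\<lambda>s. K * norm (?f s))"
      by (rule integrable_mult_right[OF integrable_norm[OF fi]])
    have "\<bar>f s \<bullet> g s\<bar> \<le> K * norm (f s)" if "s \<in> {0..T}" for s
      using Cauchy_Schwarz_ineq2[of "f s" "g s"] mult_right_mono[OF K(2)[OF that], of "norm (f s)"]
      by (simp add: mult.commute)
    then show "AE s in lborel. norm (?f s \<bullet> ?g s) \<le> norm (K * norm (?f s))"
      using K(1) by (intro AE_I2) (auto simp: indicator_def)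
  qed measurable
  also have "(\<lambda>s. ?f s \<bullet> ?g s) = (\<lambda>s. indicator {0..T} s *\<^sub>R (f s \<bullet> g s))"
    by (auto simp: indicator_def)
  finally show "set_integrable lborel {0..T} (\<lambda>s. f s \<bullet> g s)" by (simp add: set_integrable_def)
  then show "set_integrable lborel {0..T} (\<lambda>s. g s \<bullet> f s)" by (simp add: inner_commute)
qed

text \<open>Each function is its initial value plus the primitive of its derivative; the constants
  contribute linear terms, and the two primitives are covered by \<open>integral_by_parts\<close>.
  This is the product rule in integrated form; nothing is differentiated pointwise.\<close>

lemma has_time_deriv_inner:
  fixes u v :: "real \<Rightarrow> 'h::{real_inner, banach, second_countable_topology}"
  assumes u: "has_time_deriv T u u'" and v: "has_time_deriv T v v'" and \<tau>: "0 \<le> \<tau>" "\<tau> \<le> T"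
  shows "set_integrable lborel {0..\<tau>} (\<lambda>s. u' s \<bullet> v s)" (is ?th1)
    and "set_integrable lborel {0..\<tau>} (\<lambda>s. u s \<bullet> v' s)" (is ?th2)
    and "(LINT s:{0..\<tau>}|lborel. u' s \<bullet> v s) + (LINT s:{0..\<tau>}|lborel. u s \<bullet> v' s) = u \<tau> \<bullet> v \<tau> - u 0 \<bullet> v 0" (is ?th3)
proof -
  let ?f = "\<lambda>s. indicator {0..\<tau>} s *\<^sub>R u' s" and ?h = "\<lambda>s. indicator {0..\<tau>} s *\<^sub>R v' s"
  have si: "set_integrable lborel {0..\<tau>} u'" "set_integrable lborel {0..\<tau>} v'"
    using has_time_derivD(1)[OF u] has_time_derivD(1)[OF v] \<tau> by (auto intro: set_integrable_Icc_subset)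
  have f: "integrable lborel ?f" and h: "integrable lborel ?h"
    using si by (auto simp: set_integrable_def)
  define A where "A t = (LINT s|lborel. indicator {..t} s *\<^sub>R ?f s)" for t
  define B where "B t = (LINT s|lborel. indicator {..t} s *\<^sub>R ?h s)" for t
  have uv: "u t = u 0 + A t" "v t = v 0 + B t" if "t \<in> {0..\<tau>}" for t
    using that \<tau> has_time_derivD(2)[OF u, of t] has_time_derivD(2)[OF v, of t]
    by (auto simp: A_def B_def set_integral_Icc_restrict[of t \<tau>])
  have full: "(LINT s|lborel. ?f s) = A \<tau>" "(LINT s|lborel. ?h s) = B \<tau>"
    unfolding A_def B_def by (auto intro!: Bochner_Integration.integral_cong simp: indicator_def)
  have i1: "indicator {0..\<tau>} s *\<^sub>R (u' s \<bullet> v s) = ?f s \<bullet> v 0 + ?f s \<bullet> B s" for s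
    using uv(2)[of s] by (auto simp: indicator_def inner_add_right)
  have i2: "indicator {0..\<tau>} s *\<^sub>R (u s \<bullet> v' s) = u 0 \<bullet> ?h s + A s \<bullet> ?h s" for s
    using uv(1)[of s] by (auto simp: indicator_def inner_add_left)
  note P = integral_by_parts[OF f h, folded A_def B_def]
  have c: "integrable lborel (\<lambda>s. ?f s \<bullet> v 0)" "integrable lborel (\<lambda>s. u 0 \<bullet> ?h s)"
    using f h by (intro integrable_inner_left integrable_inner_right; simp)+
  show ?th1 unfolding set_integrable_def i1 by (intro Bochner_Integration.integrable_add c P)
  show ?th2 unfolding set_integrable_def i2 by (intro Bochner_Integration.integrable_add c P)
  have "(LINT s:{0..\<tau>}|lborel. u' s \<bullet> v s) + (LINT s:{0..\<tau>}|lborel. u s \<bullet> v' s)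
    = (A \<tau> \<bullet> v 0 + (LINT s|lborel. ?f s \<bullet> B s)) + (u 0 \<bullet> B \<tau> + (LINT s|lborel. A s \<bullet> ?h s))"
    unfolding set_lebesgue_integral_def i1 i2
    using Bochner_Integration.integral_add[OF c(1) P(1)] Bochner_Integration.integral_add[OF c(2) P(2)]
      integral_bounded_linear[OF bounded_linear_inner_left f, of "v 0"]
      integral_bounded_linear[OF bounded_linear_inner_right h, of "u 0"]
    by (simp only: full)
  also have "\<dots> = u \<tau> \<bullet> v \<tau> - u 0 \<bullet> v 0"
    using P(3) uv[of \<tau>] \<tau> unfolding full by (simp add: inner_add_left inner_add_right)
  finally show ?th3 .
qed

lemma convolution_adjoint:
  fixes N Z :: "real \<Rightarrow> 'h::{real_inner, banach, second_countable_topology}"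
  assumes k: "continuous_on {0..T} k" and N: "continuous_on {0..T} N" and Z: "continuous_on {0..T} Z"
  shows "set_integrable lborel {0..T} (\<lambda>t. convolution k N t \<bullet> Z t)" (is ?th1)
    and "set_integrable lborel {0..T} (\<lambda>s. N s \<bullet> adjoint_convolution T k Z s)" (is ?th2)
    and "(LINT t:{0..T}|lborel. convolution k N t \<bullet> Z t) = (LINT s:{0..T}|lborel. N s \<bullet> adjoint_convolution T k Z s)" (is ?th3)
proof -
  let ?f = "\<lambda>s. indicator {0..T} s *\<^sub>R N s" and ?h = "\<lambda>s. indicator {0..T} s *\<^sub>R Z s"
  have f: "integrable lborel ?f" and h: "integrable lborel ?h"
    using borel_integrable_atLeastAtMost'[OF N] borel_integrable_atLeastAtMost'[OF Z] by (auto simp: set_integrable_def)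
  \<comment> \<open>Extending the kernel by 0 builds causality into the weight
    \<open>k' (t - s)\<close>: it vanishes for s > t, so one weight yields the convolution when
    integrated in s and its adjoint when integrated in t.\<close>
  define k' where "k' r = indicator {0..T} r *\<^sub>R k r" for r
  have [measurable]: "k' \<in> borel_measurable borel"
    using borel_integrable_atLeastAtMost'[OF k] unfolding k'_def by (auto simp: set_integrable_def)
  obtain K where K: "K > 0" "\<And>s. s \<in> {0..T} \<Longrightarrow> norm (k s) \<le> K"
    using compact_imp_bounded[OF compact_continuous_image[OF k compact_Icc]]
    by (auto simp: bounded_pos)
  define m where "m p = k' (snd p - fst p)" for p
  have mm: "m \<in> borel_measurable borel"
    unfolding m_def borel_prod[symmetric] by measurable
  have mb: "\<bar>m p\<bar> \<le> K" for p using K by (auto simp: m_def k'_def indicator_def)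
  note F = weighted_fubini[OF f h mm mb]
  have c: "indicator {0..T} t *\<^sub>R (convolution k N t \<bullet> Z t) = (LINT s|lborel. m (s, t) *\<^sub>R ?f s) \<bullet> ?h t" for t
  proof (cases "t \<in> {0..T}")
    case True
    then have "convolution k N t = (LINT s|lborel. m (s, t) *\<^sub>R ?f s)"
      unfolding convolution_def set_lebesgue_integral_def
      by (intro Bochner_Integration.integral_cong) (auto simp: indicator_def m_def k'_def)
    with True show ?thesis by simp
  qed simp
  have a: "indicator {0..T} s *\<^sub>R (N s \<bullet> adjoint_convolution T k Z s) = ?f s \<bullet> (LINT t|lborel. m (s, t) *\<^sub>R ?h t)" for s
  proof (cases "s \<in> {0..T}")
    case True
    then have "adjoint_convolution T k Z s = (LINT t|lborel. m (s, t) *\<^sub>R ?h t)"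
      unfolding adjoint_convolution_def set_lebesgue_integral_def
      by (intro Bochner_Integration.integral_cong) (auto simp: indicator_def m_def k'_def)
    with True show ?thesis by simp
  qed simp
  show ?th1 ?th2 ?th3
    unfolding set_integrable_def set_lebesgue_integral_def c a using F by auto
qed

section \<open>Linearity of the direct problem\<close>

lemma AE_Ioo_imp_Icc:
  fixes P :: "real \<Rightarrow> bool"
  assumes "AE t\<in>{0<..<T} in lborel. P t"
  shows "AE t\<in>{0..T} in lborel. P t"
  using assms AE_lborel_singleton[of 0] AE_lborel_singleton[of T] by eventually_elim auto

lemma set_integral_eq_zero_AE:
  fixes f :: "'a \<Rightarrow> 'h::{banach, second_countable_topology}"
  shows "(AE t\<in>A in M. f t = 0) \<Longrightarrow> (LINT t:A|M. f t) = 0"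
  unfolding set_lebesgue_integral_def
  by (rule integral_eq_zero_AE) (auto elim!: eventually_mono simp: indicator_def)

text \<open>A maximum of \<open>Y t / exp (2 * C * t)\<close> cannot be positive: if it is Z at t0,
  the hypothesis bounds 2 * Y t0 by Z * (exp (2 * C * t0) - 1), which is less than Y t0. The factor
  2 in the exponent is what gains this one half.\<close>

lemma gronwall_zero:
  fixes Y :: "real \<Rightarrow> real"
  assumes Y: "continuous_on {0..T} Y" and C: "C > 0"
    and le: "\<And>\<tau>. \<tau> \<in> {0..T} \<Longrightarrow> Y \<tau> \<le> C * (LINT t:{0..\<tau>}|lborel. Y t)"
    and \<tau>: "\<tau> \<in> {0..T}"
  shows "Y \<tau> \<le> 0"
proof -
  define e where "e t = exp (2 * C * t)" for t
  have "continuous_on {0..T} (\<lambda>t. Y t / e t)"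
    unfolding e_def using Y by (intro continuous_intros) auto
  then obtain t0 where t0: "t0 \<in> {0..T}" "\<And>t. t \<in> {0..T} \<Longrightarrow> Y t / e t \<le> Y t0 / e t0"
    using continuous_attains_sup[OF compact_Icc, of 0 T "\<lambda>t. Y t / e t"] \<tau> by fastforce
  define Z where "Z = Y t0 / e t0"
  have e0: "e t > 0" for t by (simp add: e_def)
  have YZ: "Y t \<le> Z * e t" if "t \<in> {0..T}" for t
    using t0(2)[OF that] e0[of t] by (simp add: Z_def pos_divide_le_eq)
  have "Z \<le> 0"
  proof (rule ccontr)
    assume "\<not> Z \<le> 0"
    then have Z: "Z > 0" by simp
    have ce: "continuous_on {0..t0} (\<lambda>t. 2 * C * e t)"
      unfolding e_def by (intro continuous_intros)
    have "integral\<^sup>L lborel (\<lambda>t. indicator {0..t0} t *\<^sub>R (2 * C * e t)) = e t0 - e 0"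
      using t0(1) unfolding e_def
      by (intro integral_FTC_atLeastAtMost continuous_intros)
        (auto intro!: derivative_eq_intros simp: has_real_derivative_iff_has_vector_derivative[symmetric])
    moreover have "e 0 = 1" by (simp add: e_def)
    ultimately have ie: "(LINT t:{0..t0}|lborel. 2 * C * e t) = e t0 - 1"
      by (simp only: set_lebesgue_integral_def)
    have "2 * Y t0 \<le> (LINT t:{0..t0}|lborel. 2 * C * Y t)"
      using le[OF t0(1)] by simp
    also have "\<dots> \<le> (LINT t:{0..t0}|lborel. Z * (2 * C * e t))"
    proof (rule set_integral_mono)
      show "set_integrable lborel {0..t0} (\<lambda>t. 2 * C * Y t)"
        using t0(1) by (intro borel_integrable_atLeastAtMost' continuous_intros continuous_on_subset[OF Y]) auto
      show "set_integrable lborel {0..t0} (\<lambda>t. Z * (2 * C * e t))"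
        by (intro borel_integrable_atLeastAtMost' continuous_intros ce)
      show "2 * C * Y t \<le> Z * (2 * C * e t)" if "t \<in> {0..t0}" for t
        using YZ[of t] that t0(1) C by (auto simp: mult_ac intro!: mult_left_mono)
    qed
    also have "\<dots> = Z * (e t0 - 1)" using ie by simp
    also have "\<dots> < Z * e t0" using Z by simp
    also have "\<dots> = Y t0" using e0[of t0] by (simp add: Z_def)
    finally have "Y t0 < 0" by simp
    then show False using Z e0[of t0] by (simp add: Z_def divide_neg_pos less_asym' not_less_iff_gr_or_eq zero_less_divide_iff)
  qed
  then show ?thesis using YZ[OF \<tau>] e0[of \<tau>] by (smt (verit) mult_nonpos_nonneg)
qed

lemma has_time_deriv_square:
  fixes u :: "real \<Rightarrow> 'h::{real_inner, banach, second_countable_topology}"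
  assumes "has_time_deriv T u w" "u 0 = 0" "\<tau> \<in> {0..T}"
  shows "(LINT s:{0..\<tau>}|lborel. w s \<bullet> u s) = (u \<tau> \<bullet> u \<tau>) / 2"
  using has_time_deriv_inner(3)[OF assms(1,1), of \<tau>] assms(2,3) by (simp add: inner_commute)

text \<open>Young's inequality under the convolution integral. Half of the diffusion energy \<kappa>
  |N t|^2 may be spent; spread over an interval of length at most \<open>T\<close> this allows
  \<kappa> / (2 T) |N t|^2 for each s, which dictates the factor
  \<open>K\<^sup>2 * T / (2 * \<kappa>)\<close> of |N s|^2.\<close>

lemma convolution_lower_bound:
  fixes N :: "real \<Rightarrow> 'h::{real_inner, banach, second_countable_topology}"
  assumes k: "continuous_on {0..T} k" and K: "\<And>s. s \<in> {0..T} \<Longrightarrow> \<bar>k s\<bar> \<le> K"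
    and N: "continuous_on {0..T} N" and "\<kappa> > 0" "T > 0" and t: "t \<in> {0..T}"
  shows "- (\<kappa> / 2) * (N t \<bullet> N t) - K\<^sup>2 * T / (2 * \<kappa>) * (LINT s:{0..t}|lborel. N s \<bullet> N s) \<le> convolution k N t \<bullet> N t"
proof -
  have N': "continuous_on {0..t} N" using N t by (auto intro: continuous_on_subset)
  have k': "continuous_on {0..t} (\<lambda>s. k (t - s))"
    using t by (intro continuous_on_compose2[OF k] continuous_intros) auto
  have kN: "set_integrable lborel {0..t} (\<lambda>s. k (t - s) *\<^sub>R N s)"
    by (intro borel_integrable_atLeastAtMost' continuous_intros k' N')
  have iN: "set_integrable lborel {0..t} (\<lambda>s. N s \<bullet> N s)"
    by (intro borel_integrable_atLeastAtMost' continuous_intros N')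
  let ?a = "\<kappa> / (2 * T) * (N t \<bullet> N t)" and ?C = "K\<^sup>2 * T / (2 * \<kappa>)"
  have ia: "set_integrable lborel {0..t} (\<lambda>s. - ?a)"
    by (intro borel_integrable_atLeastAtMost' continuous_intros)
  have "(LINT s:{0..t}|lborel. - ?a) = - ?a * t"
    using t by (simp add: set_integral_const)
  moreover have "- (\<kappa> / 2) * (N t \<bullet> N t) \<le> - ?a * t"
  proof -
    have "\<kappa> * (N t \<bullet> N t) * t \<le> \<kappa> * (N t \<bullet> N t) * T"
      using t \<open>\<kappa> > 0\<close> by (intro mult_left_mono) auto
    then show ?thesis using \<open>T > 0\<close> by (simp add: field_simps)
  qed
  ultimately have "- (\<kappa> / 2) * (N t \<bullet> N t) - ?C * (LINT s:{0..t}|lborel. N s \<bullet> N s)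
      \<le> (LINT s:{0..t}|lborel. - ?a - ?C * (N s \<bullet> N s))"
    using set_integral_diff(2)[OF ia set_integrable_mult_right[OF iN, of ?C]] by simp
  also have "\<dots> \<le> (LINT s:{0..t}|lborel. (k (t - s) *\<^sub>R N s) \<bullet> N t)"
  proof (rule set_integral_mono)
    show "set_integrable lborel {0..t} (\<lambda>s. - ?a - ?C * (N s \<bullet> N s))"
      by (intro borel_integrable_atLeastAtMost' continuous_intros N')
    show "set_integrable lborel {0..t} (\<lambda>s. (k (t - s) *\<^sub>R N s) \<bullet> N t)"
      by (intro borel_integrable_atLeastAtMost' continuous_intros k' N')
    fix s assume s: "s \<in> {0..t}"
    let ?x = "norm (N s)" and ?y = "norm (N t)"
    have "\<bar>(k (t - s) *\<^sub>R N s) \<bullet> N t\<bar> \<le> \<bar>k (t - s)\<bar> * (?x * ?y)"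
      using mult_left_mono[OF Cauchy_Schwarz_ineq2[of "N s" "N t"], of "\<bar>k (t - s)\<bar>"] by (simp add: abs_mult)
    also have "\<dots> \<le> K * (?x * ?y)"
      using s t by (intro mult_right_mono K) auto
    also have "\<dots> \<le> \<kappa> / (2 * T) * ?y\<^sup>2 + ?C * ?x\<^sup>2"
    proof -
      \<comment> \<open>The two weights are those for which the bound is a completed square.\<close>
      have "0 \<le> (\<kappa> * ?y - K * T * ?x)\<^sup>2 / (2 * \<kappa> * T)" using \<open>\<kappa> > 0\<close> \<open>T > 0\<close> by simp
      also have "\<dots> = \<kappa> / (2 * T) * ?y\<^sup>2 + ?C * ?x\<^sup>2 - K * (?x * ?y)"
        using \<open>\<kappa> > 0\<close> \<open>T > 0\<close> by (simp add: field_simps power2_eq_square)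
      finally show ?thesis by simp
    qed
    finally show "- ?a - ?C * (N s \<bullet> N s) \<le> (k (t - s) *\<^sub>R N s) \<bullet> N t"
      by (simp add: dot_square_norm)
  qed
  also have "\<dots> = convolution k N t \<bullet> N t"
    unfolding convolution_def by (rule set_integral_bounded_linear(2)[OF bounded_linear_inner_left kN, symmetric])
  finally show ?thesis .
qed

text \<open>\<open>M\<close> and \<open>N\<close> stand for the gradients of \<open>u\<close> and \<open>\<theta>\<close>. Testing with pairs from subspaces \<open>V\<close>, \<open>W\<close>
  of graphs makes linearity immediate.\<close>

definition energy_solution where
  "energy_solution V W tr T \<rho> C \<kappa> T\<^sub>0 lam \<mu> \<gamma> k g f u \<theta> \<longleftrightarrow> (\<exists>u\<^sub>t u\<^sub>t\<^sub>t M M' \<theta>\<^sub>t N.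
     has_time_deriv T u u\<^sub>t \<and> has_time_deriv T u\<^sub>t u\<^sub>t\<^sub>t \<and> has_time_deriv T M M' \<and> has_time_deriv T \<theta> \<theta>\<^sub>t \<and>
     continuous_on {0..T} N \<and> u 0 = 0 \<and> u\<^sub>t 0 = 0 \<and> M 0 = 0 \<and> \<theta> 0 = 0 \<and>
     (AE t\<in>{0..T} in lborel. (u\<^sub>t t, M' t) \<in> V \<and> (\<theta> t, N t) \<in> W \<and>
        (\<forall>\<phi> P. (\<phi>, P) \<in> V \<longrightarrow> \<rho> * (u\<^sub>t\<^sub>t t \<bullet> \<phi>) + \<mu> * (M t \<bullet> P) + (lam + \<mu>) * (tr (M t) \<bullet> tr P) + \<gamma> * (N t \<bullet> \<phi>)
           = g t * (f \<bullet> \<phi>)) \<and>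
        (\<forall>\<psi> Q. (\<psi>, Q) \<in> W \<longrightarrow> \<rho> * C * (\<theta>\<^sub>t t \<bullet> \<psi>) + \<kappa> * (N t \<bullet> Q) + convolution k N t \<bullet> Q - T\<^sub>0 * \<gamma> * (u\<^sub>t t \<bullet> Q) = 0)))"
  for V :: "('h::{real_inner, banach, second_countable_topology} \<times> 'm::{real_inner, banach, second_countable_topology}) set"
    and W :: "('x::{real_inner, banach, second_countable_topology} \<times> 'h) set"
    and tr :: "'m \<Rightarrow> 'y::{real_inner, banach, second_countable_topology}"

lemma energy_solution_combine:
  assumes V: "subspace V" and W: "subspace W" and tr: "linear tr" and k: "continuous_on {0..T} k"
    and 1: "energy_solution V W tr T \<rho> C \<kappa> T\<^sub>0 lam \<mu> \<gamma> k g f1 u1 \<theta>1"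
    and 2: "energy_solution V W tr T \<rho> C \<kappa> T\<^sub>0 lam \<mu> \<gamma> k g f2 u2 \<theta>2"
  shows "energy_solution V W tr T \<rho> C \<kappa> T\<^sub>0 lam \<mu> \<gamma> k g
    (f1 + c *\<^sub>R f2) (\<lambda>t. u1 t + c *\<^sub>R u2 t) (\<lambda>t. \<theta>1 t + c *\<^sub>R \<theta>2 t)"
proof -
  from 1 obtain u1t u1tt M1 M1' \<theta>1t N1 where 1:
     "has_time_deriv T u1 u1t" "has_time_deriv T u1t u1tt" "has_time_deriv T M1 M1'" "has_time_deriv T \<theta>1 \<theta>1t"
     "continuous_on {0..T} N1" "u1 0 = 0" "u1t 0 = 0" "M1 0 = 0" "\<theta>1 0 = 0"
     "AE t\<in>{0..T} in lborel. (u1t t, M1' t) \<in> V \<and> (\<theta>1 t, N1 t) \<in> W \<and>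
        (\<forall>\<phi> P. (\<phi>, P) \<in> V \<longrightarrow> \<rho> * (u1tt t \<bullet> \<phi>) + \<mu> * (M1 t \<bullet> P) + (lam + \<mu>) * (tr (M1 t) \<bullet> tr P) + \<gamma> * (N1 t \<bullet> \<phi>)
           = g t * (f1 \<bullet> \<phi>)) \<and>
        (\<forall>\<psi> Q. (\<psi>, Q) \<in> W \<longrightarrow> \<rho> * C * (\<theta>1t t \<bullet> \<psi>) + \<kappa> * (N1 t \<bullet> Q) + convolution k N1 t \<bullet> Q - T\<^sub>0 * \<gamma> * (u1t t \<bullet> Q) = 0)"
    unfolding energy_solution_def by blast
  from 2 obtain u2t u2tt M2 M2' \<theta>2t N2 where 2:
     "has_time_deriv T u2 u2t" "has_time_deriv T u2t u2tt" "has_time_deriv T M2 M2'" "has_time_deriv T \<theta>2 \<theta>2t"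
     "continuous_on {0..T} N2" "u2 0 = 0" "u2t 0 = 0" "M2 0 = 0" "\<theta>2 0 = 0"
     "AE t\<in>{0..T} in lborel. (u2t t, M2' t) \<in> V \<and> (\<theta>2 t, N2 t) \<in> W \<and>
        (\<forall>\<phi> P. (\<phi>, P) \<in> V \<longrightarrow> \<rho> * (u2tt t \<bullet> \<phi>) + \<mu> * (M2 t \<bullet> P) + (lam + \<mu>) * (tr (M2 t) \<bullet> tr P) + \<gamma> * (N2 t \<bullet> \<phi>)
           = g t * (f2 \<bullet> \<phi>)) \<and>
        (\<forall>\<psi> Q. (\<psi>, Q) \<in> W \<longrightarrow> \<rho> * C * (\<theta>2t t \<bullet> \<psi>) + \<kappa> * (N2 t \<bullet> Q) + convolution k N2 t \<bullet> Q - T\<^sub>0 * \<gamma> * (u2t t \<bullet> Q) = 0)"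
    unfolding energy_solution_def by blast
  have comb: "has_time_deriv T (\<lambda>t. v t + c *\<^sub>R w t) (\<lambda>t. v' t + c *\<^sub>R w' t)"
    if "has_time_deriv T v v'" "has_time_deriv T w w'"
    for v v' w w' :: "real \<Rightarrow> 'z::{banach, second_countable_topology}"
    by (intro has_time_deriv_add that has_time_deriv_bounded_linear[OF bounded_linear_scaleR_right])
  \<comment> \<open>Splitting the integral requires integrable integrands; they are supplied by the
    continuity of \<open>k\<close>, \<open>N1\<close> and \<open>N2\<close>.\<close>
  have conv: "convolution k (\<lambda>t. N1 t + c *\<^sub>R N2 t) t = convolution k N1 t + c *\<^sub>R convolution k N2 t" if t: "t \<in> {0..T}" for t
  proof -
    have "continuous_on {0..t} N1" "continuous_on {0..t} N2"
      using 1(5) 2(5) t by (auto intro: continuous_on_subset)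
    moreover have "continuous_on {0..t} (\<lambda>s. k (t - s))"
      using t by (intro continuous_on_compose2[OF k] continuous_intros) auto
    ultimately have *: "set_integrable lborel {0..t} (\<lambda>s. k (t - s) *\<^sub>R N1 s)" "set_integrable lborel {0..t} (\<lambda>s. c *\<^sub>R (k (t - s) *\<^sub>R N2 s))"
      by (intro borel_integrable_atLeastAtMost' continuous_intros; simp)+
    have "convolution k (\<lambda>t. N1 t + c *\<^sub>R N2 t) t = (LINT s:{0..t}|lborel. k (t - s) *\<^sub>R N1 s + c *\<^sub>R (k (t - s) *\<^sub>R N2 s))"
      by (simp add: convolution_def algebra_simps)
    also have "\<dots> = convolution k N1 t + c *\<^sub>R convolution k N2 t"
      unfolding set_integral_add(2)[OF *] by (simp add: convolution_def del: scaleR_scaleR)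
    finally show ?thesis .
  qed
  have mem: "(a + c *\<^sub>R a', b + c *\<^sub>R b') \<in> S" if "subspace S" "(a, b) \<in> S" "(a', b') \<in> S"
    for a a' :: "'z::real_vector" and b b' :: "'w::real_vector" and S
    using subspace_add[OF that(1,2) subspace_scale[OF that(1,3), of c]] by simp
  have tr': "tr (a + c *\<^sub>R b) = tr a + c *\<^sub>R tr b" for a b
    by (simp add: linear_add[OF tr] linear_scale[OF tr])
  show ?thesis
    unfolding energy_solution_def
  proof (intro exI conjI)
    show "has_time_deriv T (\<lambda>t. u1 t + c *\<^sub>R u2 t) (\<lambda>t. u1t t + c *\<^sub>R u2t t)"
      "has_time_deriv T (\<lambda>t. u1t t + c *\<^sub>R u2t t) (\<lambda>t. u1tt t + c *\<^sub>R u2tt t)"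
      "has_time_deriv T (\<lambda>t. M1 t + c *\<^sub>R M2 t) (\<lambda>t. M1' t + c *\<^sub>R M2' t)"
      "has_time_deriv T (\<lambda>t. \<theta>1 t + c *\<^sub>R \<theta>2 t) (\<lambda>t. \<theta>1t t + c *\<^sub>R \<theta>2t t)"
      using 1 2 by (auto intro: comb)
    show "continuous_on {0..T} (\<lambda>t. N1 t + c *\<^sub>R N2 t)"
      using 1 2 by (intro continuous_intros)
    show "AE t\<in>{0..T} in lborel. (u1t t + c *\<^sub>R u2t t, M1' t + c *\<^sub>R M2' t) \<in> V \<and>
        (\<theta>1 t + c *\<^sub>R \<theta>2 t, N1 t + c *\<^sub>R N2 t) \<in> W \<and>
        (\<forall>\<phi> P. (\<phi>, P) \<in> V \<longrightarrow> \<rho> * ((u1tt t + c *\<^sub>R u2tt t) \<bullet> \<phi>) + \<mu> * ((M1 t + c *\<^sub>R M2 t) \<bullet> P)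
          + (lam + \<mu>) * (tr (M1 t + c *\<^sub>R M2 t) \<bullet> tr P) + \<gamma> * ((N1 t + c *\<^sub>R N2 t) \<bullet> \<phi>) = g t * ((f1 + c *\<^sub>R f2) \<bullet> \<phi>)) \<and>
        (\<forall>\<psi> Q. (\<psi>, Q) \<in> W \<longrightarrow> \<rho> * C * ((\<theta>1t t + c *\<^sub>R \<theta>2t t) \<bullet> \<psi>) + \<kappa> * ((N1 t + c *\<^sub>R N2 t) \<bullet> Q)
          + convolution k (\<lambda>t. N1 t + c *\<^sub>R N2 t) t \<bullet> Q - T\<^sub>0 * \<gamma> * ((u1t t + c *\<^sub>R u2t t) \<bullet> Q) = 0)"
      using 1(10) 2(10)
    proof eventually_elim
      case (elim t)
      show ?case
      proof (intro impI conjI allI)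
        assume t: "t \<in> {0..T}"
        note e1 = elim(1)[THEN mp, OF t] and e2 = elim(2)[THEN mp, OF t]
        show "(u1t t + c *\<^sub>R u2t t, M1' t + c *\<^sub>R M2' t) \<in> V" "(\<theta>1 t + c *\<^sub>R \<theta>2 t, N1 t + c *\<^sub>R N2 t) \<in> W"
          using e1 e2 by (auto intro: mem V W)
        show "\<rho> * ((u1tt t + c *\<^sub>R u2tt t) \<bullet> \<phi>) + \<mu> * ((M1 t + c *\<^sub>R M2 t) \<bullet> P)
          + (lam + \<mu>) * (tr (M1 t + c *\<^sub>R M2 t) \<bullet> tr P) + \<gamma> * ((N1 t + c *\<^sub>R N2 t) \<bullet> \<phi>) = g t * ((f1 + c *\<^sub>R f2) \<bullet> \<phi>)"
          if "(\<phi>, P) \<in> V" for \<phi> P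
        proof -
          have "\<rho> * (u1tt t \<bullet> \<phi>) + \<mu> * (M1 t \<bullet> P) + (lam + \<mu>) * (tr (M1 t) \<bullet> tr P) + \<gamma> * (N1 t \<bullet> \<phi>) = g t * (f1 \<bullet> \<phi>)"
            "\<rho> * (u2tt t \<bullet> \<phi>) + \<mu> * (M2 t \<bullet> P) + (lam + \<mu>) * (tr (M2 t) \<bullet> tr P) + \<gamma> * (N2 t \<bullet> \<phi>) = g t * (f2 \<bullet> \<phi>)"
            using e1 e2 that by auto
          then show ?thesis unfolding tr' inner_add_left inner_scaleR_left by algebra
        qed
        show "\<rho> * C * ((\<theta>1t t + c *\<^sub>R \<theta>2t t) \<bullet> \<psi>) + \<kappa> * ((N1 t + c *\<^sub>R N2 t) \<bullet> Q)
          + convolution k (\<lambda>t. N1 t + c *\<^sub>R N2 t) t \<bullet> Q - T\<^sub>0 * \<gamma> * ((u1t t + c *\<^sub>R u2t t) \<bullet> Q) = 0"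
          if "(\<psi>, Q) \<in> W" for \<psi> Q
        proof -
          have "\<rho> * C * (\<theta>1t t \<bullet> \<psi>) + \<kappa> * (N1 t \<bullet> Q) + convolution k N1 t \<bullet> Q - T\<^sub>0 * \<gamma> * (u1t t \<bullet> Q) = 0"
            "\<rho> * C * (\<theta>2t t \<bullet> \<psi>) + \<kappa> * (N2 t \<bullet> Q) + convolution k N2 t \<bullet> Q - T\<^sub>0 * \<gamma> * (u2t t \<bullet> Q) = 0"
            using e1 e2 that by auto
          then show ?thesis unfolding conv[OF t] inner_add_left inner_scaleR_left by algebra
        qed
      qed
    qed
  qed (use 1 2 in auto)
qed

text \<open>The first equation is tested with the velocity and its gradient \<open>M'\<close>, the
  second with \<theta> and \<open>N\<close>. Multiplying the first by \<open>T\<^sub>0\<close> makes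
  the coupling terms cancel: both become \<open>T\<^sub>0 * \<gamma>\<close> times the same inner
  product, with opposite signs. After integration half squares, the diffusion and the memory term
  are left.\<close>

lemma energy_solution_zero:
  assumes tr: "bounded_linear tr" and k: "continuous_on {0..T} k"
    and pos: "T > 0" "\<rho> > 0" "C > 0" "\<kappa> > 0" "T\<^sub>0 > 0" "lam > 0" "\<mu> > 0"
    and sol: "energy_solution V W tr T \<rho> C \<kappa> T\<^sub>0 lam \<mu> \<gamma> k g 0 u \<theta>"
    and t: "t \<in> {0..T}"
  shows "u t = 0"
proof -
  from sol obtain ut utt M M' \<theta>t N where
     u: "has_time_deriv T u ut" and ut: "has_time_deriv T ut utt" and M: "has_time_deriv T M M'"
     and \<theta>: "has_time_deriv T \<theta> \<theta>t" and N: "continuous_on {0..T} N"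
     and init: "u 0 = 0" "ut 0 = 0" "M 0 = 0" "\<theta> 0 = 0"
     and ae: "AE t\<in>{0..T} in lborel. (ut t, M' t) \<in> V \<and> (\<theta> t, N t) \<in> W \<and>
        (\<forall>\<phi> P. (\<phi>, P) \<in> V \<longrightarrow> \<rho> * (utt t \<bullet> \<phi>) + \<mu> * (M t \<bullet> P) + (lam + \<mu>) * (tr (M t) \<bullet> tr P) + \<gamma> * (N t \<bullet> \<phi>)
           = g t * (0 \<bullet> \<phi>)) \<and>
        (\<forall>\<psi> Q. (\<psi>, Q) \<in> W \<longrightarrow> \<rho> * C * (\<theta>t t \<bullet> \<psi>) + \<kappa> * (N t \<bullet> Q) + convolution k N t \<bullet> Q - T\<^sub>0 * \<gamma> * (ut t \<bullet> Q) = 0)"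
    unfolding energy_solution_def by blast
  note trM = has_time_deriv_bounded_linear[OF tr M]
  have trM0: "tr (M 0) = 0" using init by (simp add: linear_0[OF bounded_linear.linear[OF tr]])
  have "\<exists>K. \<forall>s\<in>{0..T}. \<bar>k s\<bar> \<le> K"
    using compact_imp_bounded[OF compact_continuous_image[OF k compact_Icc]]
    by (auto simp: bounded_iff)
  then obtain K where K: "\<And>s. s \<in> {0..T} \<Longrightarrow> \<bar>k s\<bar> \<le> K" by blast
  \<comment> \<open>The first summand is the constant of \<open>convolution_lower_bound\<close>;
    adding 1 keeps \<open>c\<close> positive even for \<open>K = 0\<close>, as
    \<open>gronwall_zero\<close> asks for a positive constant.\<close>
  define c where "c = K\<^sup>2 * T / (2 * \<kappa>) + 1"
  have c: "c > 0" using pos by (auto simp: c_def intro!: add_nonneg_pos)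
  define Y where "Y t = (LINT s:{0..t}|lborel. N s \<bullet> N s)" for t
  have cNN: "continuous_on {0..T} (\<lambda>s. N s \<bullet> N s)" by (intro continuous_intros N)
  have Y: "continuous_on {0..T} Y"
    unfolding Y_def by (rule has_time_deriv_continuous[OF has_time_deriv_integral[OF borel_integrable_atLeastAtMost'[OF cNN]]])
  have Y0: "Y t \<ge> 0" for t
    unfolding Y_def set_lebesgue_integral_def by (rule Bochner_Integration.integral_nonneg) auto
  \<comment> \<open>\<open>Y\<close> is the accumulated squared temperature gradient. Half of the
    diffusion is spent on the memory term; the kinetic energy is kept on the left so that it can be
    read off once \<open>Y\<close> is known to vanish.\<close>
  have main: "T\<^sub>0 * \<rho> / 2 * (ut \<tau> \<bullet> ut \<tau>) + \<kappa> / 2 * Y \<tau> \<le> c * (LINT t:{0..\<tau>}|lborel. Y t)" if \<tau>: "\<tau> \<in> {0..T}" for \<tau>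
  proof -
    have \<tau>': "0 \<le> \<tau>" "\<tau> \<le> T" using \<tau> by auto
    note i1 = has_time_deriv_inner(1)[OF ut ut \<tau>'] and i2 = has_time_deriv_inner(1)[OF M M \<tau>']
      and i3 = has_time_deriv_inner(1)[OF trM trM \<tau>'] and i4 = has_time_deriv_inner(1)[OF \<theta> \<theta> \<tau>']
    have i5: "set_integrable lborel {0..\<tau>} (\<lambda>t. N t \<bullet> N t)"
      by (rule set_integrable_Icc_subset[OF borel_integrable_atLeastAtMost'[OF cNN] \<tau>'(2)])
    have i6: "set_integrable lborel {0..\<tau>} (\<lambda>t. convolution k N t \<bullet> N t)"
      by (rule set_integrable_Icc_subset[OF convolution_adjoint(1)[OF k N N] \<tau>'(2)])
    have i7: "set_integrable lborel {0..\<tau>} Y"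
      by (rule set_integrable_Icc_subset[OF borel_integrable_atLeastAtMost'[OF Y] \<tau>'(2)])
    note s1 = has_time_deriv_square[OF ut init(2) \<tau>] and s2 = has_time_deriv_square[OF M init(3) \<tau>]
      and s3 = has_time_deriv_square[OF trM trM0 \<tau>] and s4 = has_time_deriv_square[OF \<theta> init(4) \<tau>]
    have "(LINT t:{0..\<tau>}|lborel. T\<^sub>0 * \<rho> * (utt t \<bullet> ut t) + T\<^sub>0 * \<mu> * (M' t \<bullet> M t) + T\<^sub>0 * (lam + \<mu>) * (tr (M' t) \<bullet> tr (M t))
        + \<rho> * C * (\<theta>t t \<bullet> \<theta> t) + \<kappa> * (N t \<bullet> N t) + convolution k N t \<bullet> N t) = 0"
    proof (rule set_integral_eq_zero_AE)
      show "AE t\<in>{0..\<tau>} in lborel. T\<^sub>0 * \<rho> * (utt t \<bullet> ut t) + T\<^sub>0 * \<mu> * (M' t \<bullet> M t) + T\<^sub>0 * (lam + \<mu>) * (tr (M' t) \<bullet> tr (M t))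
        + \<rho> * C * (\<theta>t t \<bullet> \<theta> t) + \<kappa> * (N t \<bullet> N t) + convolution k N t \<bullet> N t = 0"
        using ae
      proof (eventually_elim, intro impI)
        fix t
        assume *: "t \<in> {0..T} \<longrightarrow> (ut t, M' t) \<in> V \<and> (\<theta> t, N t) \<in> W \<and>
        (\<forall>\<phi> P. (\<phi>, P) \<in> V \<longrightarrow> \<rho> * (utt t \<bullet> \<phi>) + \<mu> * (M t \<bullet> P) + (lam + \<mu>) * (tr (M t) \<bullet> tr P) + \<gamma> * (N t \<bullet> \<phi>)
           = g t * (0 \<bullet> \<phi>)) \<and>
        (\<forall>\<psi> Q. (\<psi>, Q) \<in> W \<longrightarrow> \<rho> * C * (\<theta>t t \<bullet> \<psi>) + \<kappa> * (N t \<bullet> Q) + convolution k N t \<bullet> Q - T\<^sub>0 * \<gamma> * (ut t \<bullet> Q) = 0)"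
          and "t \<in> {0..\<tau>}"
        then have "\<rho> * (utt t \<bullet> ut t) + \<mu> * (M t \<bullet> M' t) + (lam + \<mu>) * (tr (M t) \<bullet> tr (M' t)) + \<gamma> * (N t \<bullet> ut t) = g t * (0 \<bullet> ut t)"
          "\<rho> * C * (\<theta>t t \<bullet> \<theta> t) + \<kappa> * (N t \<bullet> N t) + convolution k N t \<bullet> N t - T\<^sub>0 * \<gamma> * (ut t \<bullet> N t) = 0"
          using \<tau> by auto
        then show "T\<^sub>0 * \<rho> * (utt t \<bullet> ut t) + T\<^sub>0 * \<mu> * (M' t \<bullet> M t) + T\<^sub>0 * (lam + \<mu>) * (tr (M' t) \<bullet> tr (M t))
        + \<rho> * C * (\<theta>t t \<bullet> \<theta> t) + \<kappa> * (N t \<bullet> N t) + convolution k N t \<bullet> N t = 0"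
          unfolding inner_commute[of "M' t"] inner_commute[of "tr (M' t)"] inner_commute[of "N t" "ut t"] inner_zero_left
          by algebra
      qed
    qed
    then have E: "T\<^sub>0 * \<rho> / 2 * (ut \<tau> \<bullet> ut \<tau>) + T\<^sub>0 * \<mu> / 2 * (M \<tau> \<bullet> M \<tau>) + T\<^sub>0 * (lam + \<mu>) / 2 * (tr (M \<tau>) \<bullet> tr (M \<tau>))
       + \<rho> * C / 2 * (\<theta> \<tau> \<bullet> \<theta> \<tau>) + \<kappa> * Y \<tau> + (LINT t:{0..\<tau>}|lborel. convolution k N t \<bullet> N t) = 0"
      using i1 i2 i3 i4 i5 i6 s1 s2 s3 s4 by (simp add: set_integral_add Y_def)
    have "- (\<kappa> / 2) * Y \<tau> - c * (LINT t:{0..\<tau>}|lborel. Y t) = (LINT t:{0..\<tau>}|lborel. - (\<kappa> / 2) * (N t \<bullet> N t) - c * Y t)"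
      using set_integral_diff(2)[OF set_integrable_mult_right[OF i5, of "- (\<kappa> / 2)"] set_integrable_mult_right[OF i7, of c]]
      unfolding set_integral_mult_right Y_def[symmetric] by simp
    also have "\<dots> \<le> (LINT t:{0..\<tau>}|lborel. convolution k N t \<bullet> N t)"
    proof (rule set_integral_mono[OF _ i6])
      show "set_integrable lborel {0..\<tau>} (\<lambda>t. - (\<kappa> / 2) * (N t \<bullet> N t) - c * Y t)"
        by (intro set_integral_diff set_integrable_mult_right i5 i7)
      fix t assume "t \<in> {0..\<tau>}"
      then have "t \<in> {0..T}" using \<tau> by auto
      from convolution_lower_bound[OF k K N pos(4,1) this]
      show "- (\<kappa> / 2) * (N t \<bullet> N t) - c * Y t \<le> convolution k N t \<bullet> N t"
        using Y0[of t] unfolding Y_def c_def by (simp add: algebra_simps)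
    qed
    finally have "(LINT t:{0..\<tau>}|lborel. convolution k N t \<bullet> N t) \<ge> - (\<kappa> / 2) * Y \<tau> - c * (LINT t:{0..\<tau>}|lborel. Y t)" .
    moreover have "T\<^sub>0 * \<mu> / 2 * (M \<tau> \<bullet> M \<tau>) \<ge> 0" "T\<^sub>0 * (lam + \<mu>) / 2 * (tr (M \<tau>) \<bullet> tr (M \<tau>)) \<ge> 0"
      "\<rho> * C / 2 * (\<theta> \<tau> \<bullet> \<theta> \<tau>) \<ge> 0"
      using pos by auto
    ultimately show ?thesis using E by linarith
  qed
  have "Y \<tau> \<le> 2 * c / \<kappa> * (LINT t:{0..\<tau>}|lborel. Y t)" if "\<tau> \<in> {0..T}" for \<tau>
  proof -
    have "T\<^sub>0 * \<rho> / 2 * (ut \<tau> \<bullet> ut \<tau>) \<ge> 0" using pos by simp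
    with main[OF that] have "\<kappa> / 2 * Y \<tau> \<le> c * (LINT t:{0..\<tau>}|lborel. Y t)" by linarith
    then show ?thesis using \<open>\<kappa> > 0\<close> by (simp add: field_simps)
  qed
  then have Yz: "Y \<tau> = 0" if "\<tau> \<in> {0..T}" for \<tau>
    using gronwall_zero[OF Y, of "2 * c / \<kappa>" \<tau>] that Y0[of \<tau>] c pos by (auto intro: order_antisym)
  have "ut \<tau> = 0" if \<tau>: "\<tau> \<in> {0..T}" for \<tau>
  proof -
    have "(LINT t:{0..\<tau>}|lborel. Y t) = 0"
      using Yz \<tau> by (intro set_integral_eq_zero_AE AE_I2) auto
    with main[OF \<tau>] Yz[OF \<tau>] have "T\<^sub>0 * \<rho> / 2 * (ut \<tau> \<bullet> ut \<tau>) \<le> 0" by simp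
    then have "ut \<tau> \<bullet> ut \<tau> \<le> 0" using pos by (simp add: mult_le_0_iff)
    then show ?thesis by (metis inner_eq_zero_iff inner_ge_zero order_antisym)
  qed
  then have "(LINT s:{0..t}|lborel. ut s) = 0"
    using t by (intro set_integral_eq_zero_AE AE_I2) auto
  then show ?thesis using has_time_derivD(2)[OF u t] init by simp
qed

section \<open>Gradients of time primitives and reduction to the abstract energy setting\<close>

lemma has_weak_grad_zero: "has_weak_grad \<Omega> 0 0"
  by (simp add: has_weak_grad_iff subspace_0[OF subspace_L2])

lemma has_weak_grad_add:
  "has_weak_grad \<Omega> v G \<Longrightarrow> has_weak_grad \<Omega> w H \<Longrightarrow> has_weak_grad \<Omega> (v + w) (G + H)"
  unfolding has_weak_grad_iff by (auto intro: subspace_add[OF subspace_L2] simp: inner_add_left) (smt (verit))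

lemma grad_zero: "open \<Omega> \<Longrightarrow> grad \<Omega> 0 = 0"
  by (rule grad_eq[OF _ has_weak_grad_zero])

lemma l2_map_zero: "linear L \<Longrightarrow> l2_map L 0 = 0"
  by (rule linear_0[OF bounded_linear.linear[OF bounded_linear_l2_map]])

lemma l2_map_add: "linear L \<Longrightarrow> l2_map L (v + w) = l2_map L v + l2_map L w"
  by (rule linear_add[OF bounded_linear.linear[OF bounded_linear_l2_map]])

lemma grad_vec_zero: "open \<Omega> \<Longrightarrow> grad_vec \<Omega> 0 = 0"
  by (rule grad_vec_eq)
    (auto simp: has_weak_grad_vec_def component_l2_map l2_map_zero linear_nth has_weak_grad_zero)

lemma has_weak_grad_vec_add:
  "has_weak_grad_vec \<Omega> v G \<Longrightarrow> has_weak_grad_vec \<Omega> w H \<Longrightarrow> has_weak_grad_vec \<Omega> (v + w) (G + H)"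
  by (auto simp: has_weak_grad_vec_def component_l2_map l2_map_add linear_nth has_weak_grad_add)

text \<open>On a bounded interval the norm is dominated by the integrable function 1 + |v
  t|^2.\<close>

lemma L2_time_integrable:
  assumes "L2_time T v"
  shows "set_integrable lborel {0..T} v"
  unfolding set_integrable_def
proof (rule Bochner_Integration.integrable_bound)
  show "integrable lborel (\<lambda>t. indicator {0..T} t *\<^sub>R 1 + indicator {0..T} t *\<^sub>R (norm (v t))\<^sup>2 :: real)"
    using assms borel_integrable_atLeastAtMost'[of 0 T "\<lambda>t. 1 :: real"]
    unfolding L2_time_def set_integrable_def by (intro Bochner_Integration.integrable_add) auto
  show "(\<lambda>t. indicator {0..T} t *\<^sub>R v t) \<in> borel_measurable lborel"
    using assms by (simp add: L2_time_def set_borel_measurable_def)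
  have "x \<le> 1 + x\<^sup>2" for x :: real
    using zero_le_power2[of "x - 1 / 2"] by (simp add: power2_eq_square algebra_simps)
  then show "AE t in lborel. norm (indicator {0..T} t *\<^sub>R v t)
      \<le> norm (indicator {0..T} t *\<^sub>R 1 + indicator {0..T} t *\<^sub>R (norm (v t))\<^sup>2 :: real)"
    by (intro AE_I2) (auto simp: indicator_def)
qed

text \<open>The increment of \<open>u\<close> is a Bochner integral of \<open>w\<close>, so its weak
  gradient is the integral of \<open>G\<close>. The measurable function \<open>G\<close> stands in
  for \<open>grad \<Omega> (w t)\<close>, which is unspecified at exceptional times.\<close>

lemma has_time_deriv_grad:
  assumes \<Omega>: "open \<Omega>" and u: "has_time_deriv T u w" and u0: "u 0 \<in> H10 \<Omega>" and G: "L2_time T G"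
    and w: "AE t\<in>{0<..<T} in lborel. w t \<in> H10 \<Omega> \<and> grad \<Omega> (w t) = G t"
  shows "has_time_deriv T (\<lambda>t. grad \<Omega> (u t)) G"
  unfolding has_time_deriv_def
proof (intro conjI ballI)
  show Gi: "set_integrable lborel {0..T} G" by (rule L2_time_integrable[OF G])
  have wg: "AE t\<in>{0..T} in lborel. has_weak_grad \<Omega> (w t) (G t)"
    using AE_Ioo_imp_Icc[OF w] by eventually_elim (metis has_weak_grad_grad[OF \<Omega>])
  fix t assume t: "t \<in> {0..T}"
  have "has_weak_grad \<Omega> (LINT s:{0..t}|lborel. w s) (LINT s:{0..t}|lborel. G s)"
    using wg t
    by (intro has_weak_grad_integral[OF \<Omega>] set_integrable_Icc_subset[OF Gi] set_integrable_Icc_subset[OF has_time_derivD(1)[OF u]])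
      (auto elim!: eventually_mono)
  then have "has_weak_grad \<Omega> (u t) (grad \<Omega> (u 0) + (LINT s:{0..t}|lborel. G s))"
    unfolding has_time_derivD(2)[OF u t] by (intro has_weak_grad_add has_weak_grad_grad[OF \<Omega> u0])
  then show "grad \<Omega> (u t) = grad \<Omega> (u 0) + (LINT s:{0..t}|lborel. G s)"
    by (rule grad_eq[OF \<Omega>])
qed

lemma has_time_deriv_grad_vec:
  assumes \<Omega>: "open \<Omega>" and u: "has_time_deriv T u w" and u0: "u 0 \<in> H10_vec \<Omega>" and G: "L2_time T G"
    and w: "AE t\<in>{0<..<T} in lborel. w t \<in> H10_vec \<Omega> \<and> grad_vec \<Omega> (w t) = G t"
  shows "has_time_deriv T (\<lambda>t. grad_vec \<Omega> (u t)) G"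
  unfolding has_time_deriv_def
proof (intro conjI ballI)
  show Gi: "set_integrable lborel {0..T} G" by (rule L2_time_integrable[OF G])
  have wg: "AE t\<in>{0..T} in lborel. has_weak_grad_vec \<Omega> (w t) (G t)"
    using AE_Ioo_imp_Icc[OF w] by eventually_elim (metis has_weak_grad_vec_grad_vec[OF \<Omega>])
  fix t assume t: "t \<in> {0..T}"
  have "has_weak_grad_vec \<Omega> (LINT s:{0..t}|lborel. w s) (LINT s:{0..t}|lborel. G s)"
    using wg t
    by (intro has_weak_grad_vec_integral[OF \<Omega>] set_integrable_Icc_subset[OF Gi] set_integrable_Icc_subset[OF has_time_derivD(1)[OF u]])
      (auto elim!: eventually_mono)
  then have "has_weak_grad_vec \<Omega> (u t) (grad_vec \<Omega> (u 0) + (LINT s:{0..t}|lborel. G s))"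
    unfolding has_time_derivD(2)[OF u t] by (intro has_weak_grad_vec_add has_weak_grad_vec_grad_vec[OF \<Omega> u0])
  then show "grad_vec \<Omega> (u t) = grad_vec \<Omega> (u 0) + (LINT s:{0..t}|lborel. G s)"
    by (rule grad_vec_eq[OF \<Omega>])
qed

abbreviation "div_l2 \<equiv> l2_map (trace :: real^'n^'n \<Rightarrow> real)"

text \<open>To see that the graph itself is a subspace one would have to show that
  \<open>H10_vec \<Omega>\<close> is closed under addition. The span is a subspace by construction,
  and the weak equations extend to it because they are linear in the test pair.\<close>

definition grad_vec_graph :: "(real^'n) set \<Rightarrow> ((real^'n, real^'n) l2 \<times> (real^'n, real^'n^'n) l2) set" where
  "grad_vec_graph \<Omega> = span ((\<lambda>\<phi>. (\<phi>, grad_vec \<Omega> \<phi>)) ` H10_vec \<Omega>)"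

definition grad_graph :: "(real^'n) set \<Rightarrow> ((real^'n, real) l2 \<times> (real^'n, real^'n) l2) set" where
  "grad_graph \<Omega> = span ((\<lambda>\<psi>. (\<psi>, grad \<Omega> \<psi>)) ` H10 \<Omega>)"

lemma forward_solution_energy:
  fixes \<Omega> :: "(real^'n) set"
  assumes \<Omega>: "open \<Omega>" and T: "T > 0"
    and sol: "forward_solution \<Omega> T \<rho> C \<kappa> T\<^sub>0 lam \<mu> \<gamma> k g f u \<theta>"
  shows "energy_solution (grad_vec_graph \<Omega>) (grad_graph \<Omega>) div_l2 T \<rho> C \<kappa> T\<^sub>0 lam \<mu> \<gamma> k g f u \<theta>"
proof -
  from sol obtain ut utt \<theta>t where
     u: "C_H10_vec \<Omega> T u" "has_time_deriv T u ut" "L2_H10_vec \<Omega> T ut" "has_time_deriv T ut utt"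
     and \<theta>: "C_H10 \<Omega> T \<theta>" "has_time_deriv T \<theta> \<theta>t" and init: "u 0 = 0" "ut 0 = 0" "\<theta> 0 = 0"
     and e1: "AE t\<in>{0<..<T} in lborel. \<forall>\<phi>\<in>H10_vec \<Omega>.
        \<rho> * (utt t \<bullet> \<phi>) + \<mu> * (grad_vec \<Omega> (u t) \<bullet> grad_vec \<Omega> \<phi>)
          + (lam + \<mu>) * (div_vec \<Omega> (u t) \<bullet> div_vec \<Omega> \<phi>) + \<gamma> * (grad \<Omega> (\<theta> t) \<bullet> \<phi>) = (g t *\<^sub>R f) \<bullet> \<phi>"
     and e2: "AE t\<in>{0<..<T} in lborel. \<forall>\<psi>\<in>H10 \<Omega>.
        \<rho> * C * (\<theta>t t \<bullet> \<psi>) + \<kappa> * (grad \<Omega> (\<theta> t) \<bullet> grad \<Omega> \<psi>)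
          + convolution k (\<lambda>s. grad \<Omega> (\<theta> s)) t \<bullet> grad \<Omega> \<psi> - T\<^sub>0 * \<gamma> * (ut t \<bullet> grad \<Omega> \<psi>) = 0"
    unfolding forward_solution_def by blast
  from u(3) obtain G where G: "L2_time T G"
      "AE t\<in>{0<..<T} in lborel. ut t \<in> H10_vec \<Omega> \<and> grad_vec \<Omega> (ut t) = G t"
    unfolding L2_H10_vec_def by blast
  have u0: "u 0 \<in> H10_vec \<Omega>" using u(1) T by (simp add: C_H10_vec_def)
  note M = has_time_deriv_grad_vec[OF \<Omega> u(2) u0 G]
  have tr_add: "div_l2 (x + y) = div_l2 x + div_l2 y" and tr_scale: "div_l2 (c *\<^sub>R x) = c *\<^sub>R div_l2 x"
    for x y :: "(real^'n, real^'n^'n) l2" and c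
    by (rule l2_map_add[OF linear_trace])
      (rule linear_scale[OF bounded_linear.linear[OF bounded_linear_l2_map[OF linear_trace]]])
  show ?thesis
    unfolding energy_solution_def
  proof (intro exI conjI)
    show "has_time_deriv T u ut" "has_time_deriv T ut utt" "has_time_deriv T (\<lambda>t. grad_vec \<Omega> (u t)) G"
      "has_time_deriv T \<theta> \<theta>t" by fact+
    show "continuous_on {0..T} (\<lambda>t. grad \<Omega> (\<theta> t))" using \<theta> by (simp add: C_H10_def)
    show "u 0 = 0" "ut 0 = 0" "\<theta> 0 = 0" by fact+
    show "grad_vec \<Omega> (u 0) = 0" using init grad_vec_zero[OF \<Omega>] by simp
    show "AE t\<in>{0..T} in lborel. (ut t, G t) \<in> grad_vec_graph \<Omega> \<and> (\<theta> t, grad \<Omega> (\<theta> t)) \<in> grad_graph \<Omega> \<and>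
        (\<forall>\<phi> P. (\<phi>, P) \<in> grad_vec_graph \<Omega> \<longrightarrow> \<rho> * (utt t \<bullet> \<phi>) + \<mu> * (grad_vec \<Omega> (u t) \<bullet> P)
            + (lam + \<mu>) * (div_l2 (grad_vec \<Omega> (u t)) \<bullet> div_l2 P) + \<gamma> * (grad \<Omega> (\<theta> t) \<bullet> \<phi>) = g t * (f \<bullet> \<phi>)) \<and>
        (\<forall>\<psi> Q. (\<psi>, Q) \<in> grad_graph \<Omega> \<longrightarrow> \<rho> * C * (\<theta>t t \<bullet> \<psi>) + \<kappa> * (grad \<Omega> (\<theta> t) \<bullet> Q)
            + convolution k (\<lambda>s. grad \<Omega> (\<theta> s)) t \<bullet> Q - T\<^sub>0 * \<gamma> * (ut t \<bullet> Q) = 0)"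
      using AE_Ioo_imp_Icc[OF e1] AE_Ioo_imp_Icc[OF e2] AE_Ioo_imp_Icc[OF G(2)]
    proof eventually_elim
      case (elim t)
      show ?case
      proof (intro impI conjI allI)
        assume t: "t \<in> {0..T}"
        show "(ut t, G t) \<in> grad_vec_graph \<Omega>"
          unfolding grad_vec_graph_def using elim(3) t by (intro span_base) auto
        show "(\<theta> t, grad \<Omega> (\<theta> t)) \<in> grad_graph \<Omega>"
          unfolding grad_graph_def using \<theta>(1) t by (intro span_base) (auto simp: C_H10_def)
        \<comment> \<open>The residual of the momentum equation, as a linear functional of the test
          pair: it vanishes on the graph, hence on its span. \<open>l2\<close> below does the same
          for the heat equation.\<close>
        define l1 where "l1 p = \<rho> * (utt t \<bullet> fst p) + \<mu> * (grad_vec \<Omega> (u t) \<bullet> snd p)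
            + (lam + \<mu>) * (div_l2 (grad_vec \<Omega> (u t)) \<bullet> div_l2 (snd p)) + \<gamma> * (grad \<Omega> (\<theta> t) \<bullet> fst p) - g t * (f \<bullet> fst p)" for p
        have "linear l1"
          by (rule linearI) (simp_all add: l1_def tr_add tr_scale inner_add_right algebra_simps)
        moreover have "l1 p = 0" if "p \<in> (\<lambda>\<phi>. (\<phi>, grad_vec \<Omega> \<phi>)) ` H10_vec \<Omega>" for p
          using elim(1) t that by (auto simp: l1_def div_vec_eq_trace)
        ultimately have "l1 p = 0" if "p \<in> grad_vec_graph \<Omega>" for p
          using that unfolding grad_vec_graph_def by (rule linear_eq_0_on_span)
        then show "\<rho> * (utt t \<bullet> \<phi>) + \<mu> * (grad_vec \<Omega> (u t) \<bullet> P)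
            + (lam + \<mu>) * (div_l2 (grad_vec \<Omega> (u t)) \<bullet> div_l2 P) + \<gamma> * (grad \<Omega> (\<theta> t) \<bullet> \<phi>) = g t * (f \<bullet> \<phi>)"
          if "(\<phi>, P) \<in> grad_vec_graph \<Omega>" for \<phi> P
          using that by (force simp: l1_def)
        define l2 where "l2 p = \<rho> * C * (\<theta>t t \<bullet> fst p) + \<kappa> * (grad \<Omega> (\<theta> t) \<bullet> snd p)
            + convolution k (\<lambda>s. grad \<Omega> (\<theta> s)) t \<bullet> snd p - T\<^sub>0 * \<gamma> * (ut t \<bullet> snd p)" for p
        have "linear l2"
          by (rule linearI) (simp_all add: l2_def inner_add_right algebra_simps)
        moreover have "l2 p = 0" if "p \<in> (\<lambda>\<psi>. (\<psi>, grad \<Omega> \<psi>)) ` H10 \<Omega>" for p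
          using elim(2) t that by (auto simp: l2_def)
        ultimately have "l2 p = 0" if "p \<in> grad_graph \<Omega>" for p
          using that unfolding grad_graph_def by (rule linear_eq_0_on_span)
        then show "\<rho> * C * (\<theta>t t \<bullet> \<psi>) + \<kappa> * (grad \<Omega> (\<theta> t) \<bullet> Q)
            + convolution k (\<lambda>s. grad \<Omega> (\<theta> s)) t \<bullet> Q - T\<^sub>0 * \<gamma> * (ut t \<bullet> Q) = 0"
          if "(\<psi>, Q) \<in> grad_graph \<Omega>" for \<psi> Q
          using that by (force simp: l2_def)
      qed
    qed
  qed
qed

lemma forward_solution_linear:
  fixes \<Omega> :: "(real^'n) set"
  assumes \<Omega>: "open \<Omega>" and k: "continuous_on {0..T} k"
    and pos: "T > 0" "\<rho> > 0" "C > 0" "\<kappa> > 0" "T\<^sub>0 > 0" "lam > 0" "\<mu> > 0"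
    and 1: "forward_solution \<Omega> T \<rho> C \<kappa> T\<^sub>0 lam \<mu> \<gamma> k g f1 u1 \<theta>1"
    and 2: "forward_solution \<Omega> T \<rho> C \<kappa> T\<^sub>0 lam \<mu> \<gamma> k g f2 u2 \<theta>2"
    and 3: "forward_solution \<Omega> T \<rho> C \<kappa> T\<^sub>0 lam \<mu> \<gamma> k g (f1 + c *\<^sub>R f2) u3 \<theta>3"
    and t: "t \<in> {0..T}"
  shows "u3 t = u1 t + c *\<^sub>R u2 t"
proof -
  note e = forward_solution_energy[OF \<Omega> pos(1)]
  have V: "subspace (grad_vec_graph \<Omega>)" "subspace (grad_graph \<Omega>)"
    by (simp_all add: grad_vec_graph_def grad_graph_def)
  note tr = bounded_linear_l2_map[OF linear_trace[where 'n = 'n]]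
  note comb = energy_solution_combine[OF V bounded_linear.linear[OF tr] k]
  \<comment> \<open>The combination u1 + c u2 - u3 is an energy solution with source 0, which forces
    it to vanish.\<close>
  from energy_solution_zero[OF tr k pos _ t, OF comb[OF comb[OF e[OF 1] e[OF 2], of c] e[OF 3], of "- 1", simplified]]
  show ?thesis by simp
qed

lemma C_k_on_continuous: "C_k_on m T f \<Longrightarrow> continuous_on {0..T} f"
  by (auto simp: C_k_on_def dest: spec[of _ "0::nat"])

lemma set_integrable_inner_const:
  fixes w :: "real \<Rightarrow> 'h::{real_inner, banach, second_countable_topology}"
  assumes "set_integrable lborel {0..T} w"
  shows "set_integrable lborel {0..T} (\<lambda>s. w s \<bullet> a)" "(LINT s:{0..T}|lborel. w s \<bullet> a) = (LINT s:{0..T}|lborel. w s) \<bullet> a"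
  using set_integral_bounded_linear[OF bounded_linear_inner_left assms, of a] by simp_all

section \<open>Duality\<close>

text \<open>The acceleration of the adjoint displacement takes values in \<open>H\<^sup>-\<^sup>1\<close>, so the product rule is not available
  for it. Eliminating it by the equation leaves Hilbert space valued time integrals only.\<close>

lemma adjoint_velocity:
  fixes \<Omega> :: "(real^'n) set" and G :: "real \<Rightarrow> (real^'n, real^'n) l2"
  assumes M: "continuous_on {0..T} M" and G: "set_integrable lborel {0..T} G"
    and v: "has_time_deriv T (\<lambda>t. vt t \<bullet> \<phi>) W"
    and eq: "AE t\<in>{0..T} in lborel. \<rho> * W t + \<mu> * (M t \<bullet> A) + c * (div_l2 (M t) \<bullet> div_l2 A) + d * (G t \<bullet> \<phi>) = 0"
    and t: "t \<in> {0..T}"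
  shows "\<rho> * (vt t \<bullet> \<phi>) = \<rho> * (vt 0 \<bullet> \<phi>) - \<mu> * ((LINT s:{0..t}|lborel. M s) \<bullet> A)
    - c * (div_l2 (LINT s:{0..t}|lborel. M s) \<bullet> div_l2 A) - d * ((LINT s:{0..t}|lborel. G s) \<bullet> \<phi>)"
proof -
  have T': "t \<le> T" using t by auto
  have Mi: "set_integrable lborel {0..t} M"
    using borel_integrable_atLeastAtMost'[OF M] T' by (rule set_integrable_Icc_subset)
  have Gi: "set_integrable lborel {0..t} G" using G T' by (rule set_integrable_Icc_subset)
  have Wi: "set_integrable lborel {0..t} W"
    using has_time_derivD(1)[OF v] T' by (rule set_integrable_Icc_subset)
  note D = set_integral_bounded_linear[OF bounded_linear_l2_map[OF linear_trace] Mi]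
  have "(LINT s:{0..t}|lborel. \<rho> * W s + \<mu> * (M s \<bullet> A) + c * (div_l2 (M s) \<bullet> div_l2 A) + d * (G s \<bullet> \<phi>)) = 0"
    using eq T' by (intro set_integral_eq_zero_AE) (auto elim!: eventually_mono)
  then have "\<rho> * (LINT s:{0..t}|lborel. W s) + \<mu> * ((LINT s:{0..t}|lborel. M s) \<bullet> A)
      + c * (div_l2 (LINT s:{0..t}|lborel. M s) \<bullet> div_l2 A) + d * ((LINT s:{0..t}|lborel. G s) \<bullet> \<phi>) = 0"
    unfolding D(2)
    using Wi set_integrable_inner_const[OF Mi] set_integrable_inner_const[OF D(1)] set_integrable_inner_const[OF Gi]
    by (simp add: set_integral_add)
  then show ?thesis
    unfolding has_time_derivD(2)[OF v t] by (simp add: algebra_simps)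
qed

text \<open>Four identities are combined: the adjoint momentum balance, integrated in time, is
  tested with \<open>ut t\<close>, the direct one with \<open>v t\<close>, and each heat equation
  with the temperature of the other problem. Testing with the derivative \<open>ut\<close> instead
  of \<open>u\<close> makes up for the missing product rule for the adjoint acceleration.\<close>

lemma duality:
  fixes \<Omega> :: "(real^'n) set"
  assumes \<Omega>: "open \<Omega>" and T: "T > 0" and k: "continuous_on {0..T} k" and g: "continuous_on {0..T} g"
    and sol: "forward_solution \<Omega> T \<rho> C \<kappa> T\<^sub>0 lam \<mu> \<gamma> k g f u \<theta>"
    and adj: "adjoint_solution \<Omega> T \<rho> C \<kappa> T\<^sub>0 lam \<mu> \<gamma> k w v \<eta>"
  shows "\<rho> * (w \<bullet> u T) = - (LINT t:{0..T}|lborel. (g t *\<^sub>R f) \<bullet> v t)"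
proof -
  from sol obtain ut utt \<theta>t where
     u: "C_H10_vec \<Omega> T u" "has_time_deriv T u ut" "L2_H10_vec \<Omega> T ut" "has_time_deriv T ut utt"
     and \<theta>: "C_H10 \<Omega> T \<theta>" "has_time_deriv T \<theta> \<theta>t" and init: "u 0 = 0" "ut 0 = 0" "\<theta> 0 = 0"
     and e1: "AE t\<in>{0<..<T} in lborel. \<forall>\<phi>\<in>H10_vec \<Omega>.
        \<rho> * (utt t \<bullet> \<phi>) + \<mu> * (grad_vec \<Omega> (u t) \<bullet> grad_vec \<Omega> \<phi>)
          + (lam + \<mu>) * (div_vec \<Omega> (u t) \<bullet> div_vec \<Omega> \<phi>) + \<gamma> * (grad \<Omega> (\<theta> t) \<bullet> \<phi>) = (g t *\<^sub>R f) \<bullet> \<phi>"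
     and e2: "AE t\<in>{0<..<T} in lborel. \<forall>\<psi>\<in>H10 \<Omega>.
        \<rho> * C * (\<theta>t t \<bullet> \<psi>) + \<kappa> * (grad \<Omega> (\<theta> t) \<bullet> grad \<Omega> \<psi>)
          + convolution k (\<lambda>s. grad \<Omega> (\<theta> s)) t \<bullet> grad \<Omega> \<psi> - T\<^sub>0 * \<gamma> * (ut t \<bullet> grad \<Omega> \<psi>) = 0"
    unfolding forward_solution_def by blast
  from adj obtain vt W \<eta>t where
     v: "C_H10_vec \<Omega> T v" "has_time_deriv T v vt"
     and W: "\<And>\<phi>. \<phi> \<in> H10_vec \<Omega> \<Longrightarrow> has_time_deriv T (\<lambda>t. vt t \<bullet> \<phi>) (\<lambda>t. W t \<phi>)"
     and \<eta>: "C_H10 \<Omega> T \<eta>" "has_time_deriv T \<eta> \<eta>t" "L2_H10 \<Omega> T \<eta>t"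
     and fin: "v T = 0" "vt T = w" "\<eta> T = 0"
     and e3: "AE t\<in>{0<..<T} in lborel. \<forall>\<phi>\<in>H10_vec \<Omega>.
        \<rho> * W t \<phi> + \<mu> * (grad_vec \<Omega> (v t) \<bullet> grad_vec \<Omega> \<phi>)
          + (lam + \<mu>) * (div_vec \<Omega> (v t) \<bullet> div_vec \<Omega> \<phi>) + \<gamma> * T\<^sub>0 * (grad \<Omega> (\<eta>t t) \<bullet> \<phi>) = 0"
     and e4: "AE t\<in>{0<..<T} in lborel. \<forall>\<psi>\<in>H10 \<Omega>.
        - \<rho> * C * (\<eta>t t \<bullet> \<psi>) + \<kappa> * (grad \<Omega> (\<eta> t) \<bullet> grad \<Omega> \<psi>)
          + adjoint_convolution T k (\<lambda>s. grad \<Omega> (\<eta> s)) t \<bullet> grad \<Omega> \<psi> + \<gamma> * (v t \<bullet> grad \<Omega> \<psi>) = 0"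
    unfolding adjoint_solution_def by blast
  from u(3) obtain Gu where Gu: "L2_time T Gu"
      "AE t\<in>{0<..<T} in lborel. ut t \<in> H10_vec \<Omega> \<and> grad_vec \<Omega> (ut t) = Gu t"
    unfolding L2_H10_vec_def by blast
  from \<eta>(3) obtain G\<eta> where G\<eta>: "L2_time T G\<eta>"
      "AE t\<in>{0<..<T} in lborel. \<eta>t t \<in> H10 \<Omega> \<and> grad \<Omega> (\<eta>t t) = G\<eta> t"
    unfolding L2_H10_def by blast
  have mem: "u t \<in> H10_vec \<Omega>" "v t \<in> H10_vec \<Omega>" "\<theta> t \<in> H10 \<Omega>" "\<eta> t \<in> H10 \<Omega>" if "t \<in> {0..T}" for t
    using that u(1) v(1) \<theta>(1) \<eta>(1) by (auto simp: C_H10_vec_def C_H10_def)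
  have T': "0 \<in> {0..T}" "T \<in> {0..T}" "0 \<le> T" "T \<le> T" using T by auto
  define Mu where "Mu t = grad_vec \<Omega> (u t)" for t
  define Mv where "Mv t = grad_vec \<Omega> (v t)" for t
  define N\<theta> where "N\<theta> t = grad \<Omega> (\<theta> t)" for t
  define N\<eta> where "N\<eta> t = grad \<Omega> (\<eta> t)" for t
  \<comment> \<open>Primitives, starting at 0, of the adjoint Jacobian and of the gradient of the
    adjoint temperature rate; they appear when the adjoint momentum equation is integrated from 0 to
    \<open>t\<close>.\<close>
  define P where "P t = (LINT s:{0..t}|lborel. Mv s)" for t
  define Q where "Q t = (LINT s:{0..t}|lborel. G\<eta> s)" for t
  have Mv: "continuous_on {0..T} Mv" and N\<theta>: "continuous_on {0..T} N\<theta>" and N\<eta>: "continuous_on {0..T} N\<eta>"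
    and cv: "continuous_on {0..T} v"
    using v(1) \<theta>(1) \<eta>(1) by (auto simp: C_H10_vec_def C_H10_def Mv_def[abs_def] N\<theta>_def[abs_def] N\<eta>_def[abs_def])
  have Gi: "set_integrable lborel {0..T} G\<eta>" by (rule L2_time_integrable[OF G\<eta>(1)])
  have dMu: "has_time_deriv T Mu Gu"
    unfolding Mu_def[abs_def] by (rule has_time_deriv_grad_vec[OF \<Omega> u(2) mem(1)[OF T'(1)] Gu])
  have dN\<eta>: "has_time_deriv T N\<eta> G\<eta>"
    unfolding N\<eta>_def[abs_def] by (rule has_time_deriv_grad[OF \<Omega> \<eta>(2) mem(4)[OF T'(1)] G\<eta>])
  have dP: "has_time_deriv T P Mv"
    unfolding P_def[abs_def] by (rule has_time_deriv_integral[OF borel_integrable_atLeastAtMost'[OF Mv]])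
  have dQ: "has_time_deriv T Q G\<eta>"
    unfolding Q_def[abs_def] by (rule has_time_deriv_integral[OF Gi])
  note div_bl = bounded_linear_l2_map[OF linear_trace[where 'n = 'n]]
  note dtP = has_time_deriv_bounded_linear[OF div_bl dP] and dtMu = has_time_deriv_bounded_linear[OF div_bl dMu]
  have bdry: "P 0 = 0" "Q 0 = 0" "Mu 0 = 0" "N\<eta> T = 0"
    unfolding P_def Q_def Mu_def N\<eta>_def set_integral_singleton
    using init fin grad_zero[OF \<Omega>] grad_vec_zero[OF \<Omega>] by simp_all
  \<comment> \<open>Here \<open>W\<close> is gone and the identity holds at every time for every
    \<phi>, so moving test functions are allowed: \<open>ut t\<close> at almost every
    \<open>t\<close> in \<open>E1\<close>, and \<open>u T\<close> at the final time.\<close>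
  have velocity: "\<rho> * (vt t \<bullet> \<phi>) = \<rho> * (vt 0 \<bullet> \<phi>) - \<mu> * (P t \<bullet> grad_vec \<Omega> \<phi>)
      - (lam + \<mu>) * (div_l2 (P t) \<bullet> div_l2 (grad_vec \<Omega> \<phi>)) - \<gamma> * T\<^sub>0 * (Q t \<bullet> \<phi>)"
    if \<phi>: "\<phi> \<in> H10_vec \<Omega>" and t: "t \<in> {0..T}" for \<phi> t
    unfolding P_def Q_def
  proof (rule adjoint_velocity[OF Mv Gi W[OF \<phi>] _ t])
    show "AE t\<in>{0..T} in lborel. \<rho> * W t \<phi> + \<mu> * (Mv t \<bullet> grad_vec \<Omega> \<phi>)
        + (lam + \<mu>) * (div_l2 (Mv t) \<bullet> div_l2 (grad_vec \<Omega> \<phi>)) + \<gamma> * T\<^sub>0 * (G\<eta> t \<bullet> \<phi>) = 0"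
      using AE_Ioo_imp_Icc[OF e3] AE_Ioo_imp_Icc[OF G\<eta>(2)]
      by eventually_elim (use \<phi> in \<open>auto simp: Mv_def div_vec_eq_trace\<close>)
  qed
  let ?I = "\<lambda>h. LINT t:{0..T}|lborel. h t :: real"
  note i1 = has_time_deriv_inner[OF u(4) v(2) T'(3,4)]
  note i2 = has_time_deriv_inner[OF dP dMu T'(3,4)]
  note i3 = has_time_deriv_inner[OF dtP dtMu T'(3,4)]
  note i4 = has_time_deriv_inner[OF dQ u(2) T'(3,4)]
  note i5 = has_time_deriv_inner[OF \<theta>(2) \<eta>(2) T'(3,4)]
  note i6 = has_time_deriv_inner[OF u(2) dN\<eta> T'(3,4)]
  note i7 = set_integrable_inner_continuous[OF borel_integrable_atLeastAtMost'[OF N\<theta>] cv]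
  note i8 = set_integrable_inner_continuous[OF borel_integrable_atLeastAtMost'[OF N\<theta>] N\<eta>]
  note i9 = convolution_adjoint[OF k N\<theta> N\<eta>]
  note i10 = set_integrable_inner_const[OF has_time_derivD(1)[OF u(2)], of "vt 0"]
  have i11: "set_integrable lborel {0..T} (\<lambda>t. (g t *\<^sub>R f) \<bullet> v t)"
    by (intro borel_integrable_atLeastAtMost' continuous_intros g cv)
  have E1: "\<rho> * ?I (\<lambda>t. ut t \<bullet> vt t) - \<rho> * ?I (\<lambda>t. ut t \<bullet> vt 0) + \<mu> * ?I (\<lambda>t. P t \<bullet> Gu t)
      + (lam + \<mu>) * ?I (\<lambda>t. div_l2 (P t) \<bullet> div_l2 (Gu t)) + \<gamma> * T\<^sub>0 * ?I (\<lambda>t. Q t \<bullet> ut t) = 0"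
  proof -
    have "?I (\<lambda>t. \<rho> * (ut t \<bullet> vt t) - \<rho> * (ut t \<bullet> vt 0) + \<mu> * (P t \<bullet> Gu t)
      + (lam + \<mu>) * (div_l2 (P t) \<bullet> div_l2 (Gu t)) + \<gamma> * T\<^sub>0 * (Q t \<bullet> ut t)) = 0"
    proof (rule set_integral_eq_zero_AE)
      show "AE t\<in>{0..T} in lborel. \<rho> * (ut t \<bullet> vt t) - \<rho> * (ut t \<bullet> vt 0) + \<mu> * (P t \<bullet> Gu t)
        + (lam + \<mu>) * (div_l2 (P t) \<bullet> div_l2 (Gu t)) + \<gamma> * T\<^sub>0 * (Q t \<bullet> ut t) = 0"
        using AE_Ioo_imp_Icc[OF Gu(2)]
      proof (eventually_elim, intro impI)
        fix t assume *: "t \<in> {0..T} \<longrightarrow> ut t \<in> H10_vec \<Omega> \<and> grad_vec \<Omega> (ut t) = Gu t" and t: "t \<in> {0..T}"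
        show "\<rho> * (ut t \<bullet> vt t) - \<rho> * (ut t \<bullet> vt 0) + \<mu> * (P t \<bullet> Gu t)
          + (lam + \<mu>) * (div_l2 (P t) \<bullet> div_l2 (Gu t)) + \<gamma> * T\<^sub>0 * (Q t \<bullet> ut t) = 0"
          using velocity[of "ut t" t] * t by (simp add: inner_commute[of "ut t"])
      qed
    qed
    then show ?thesis
      using i1(2) i2(2) i3(2) i4(2) i10 by (simp add: set_integral_add set_integral_diff)
  qed
  have E2: "\<rho> * ?I (\<lambda>t. utt t \<bullet> v t) + \<mu> * ?I (\<lambda>t. Mv t \<bullet> Mu t) + (lam + \<mu>) * ?I (\<lambda>t. div_l2 (Mv t) \<bullet> div_l2 (Mu t))
      + \<gamma> * ?I (\<lambda>t. N\<theta> t \<bullet> v t) - ?I (\<lambda>t. (g t *\<^sub>R f) \<bullet> v t) = 0"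
  proof -
    have "?I (\<lambda>t. \<rho> * (utt t \<bullet> v t) + \<mu> * (Mv t \<bullet> Mu t) + (lam + \<mu>) * (div_l2 (Mv t) \<bullet> div_l2 (Mu t))
      + \<gamma> * (N\<theta> t \<bullet> v t) - (g t *\<^sub>R f) \<bullet> v t) = 0"
    proof (rule set_integral_eq_zero_AE)
      show "AE t\<in>{0..T} in lborel. \<rho> * (utt t \<bullet> v t) + \<mu> * (Mv t \<bullet> Mu t) + (lam + \<mu>) * (div_l2 (Mv t) \<bullet> div_l2 (Mu t))
        + \<gamma> * (N\<theta> t \<bullet> v t) - (g t *\<^sub>R f) \<bullet> v t = 0"
        using AE_Ioo_imp_Icc[OF e1]
        by eventually_elim (use mem(2) in \<open>simp add: Mu_def Mv_def N\<theta>_def div_vec_eq_trace inner_commute[of "grad_vec \<Omega> (v _)"]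
            inner_commute[of "div_l2 (grad_vec \<Omega> (v _))"]\<close>)
    qed
    then show ?thesis
      using i1(1) i2(1) i3(1) i7(1) i11 by (simp add: set_integral_add set_integral_diff)
  qed
  have E3: "\<rho> * C * ?I (\<lambda>t. \<theta>t t \<bullet> \<eta> t) + \<kappa> * ?I (\<lambda>t. N\<theta> t \<bullet> N\<eta> t) + ?I (\<lambda>t. convolution k N\<theta> t \<bullet> N\<eta> t)
      - T\<^sub>0 * \<gamma> * ?I (\<lambda>t. ut t \<bullet> N\<eta> t) = 0"
  proof -
    have "?I (\<lambda>t. \<rho> * C * (\<theta>t t \<bullet> \<eta> t) + \<kappa> * (N\<theta> t \<bullet> N\<eta> t) + convolution k N\<theta> t \<bullet> N\<eta> t
      - T\<^sub>0 * \<gamma> * (ut t \<bullet> N\<eta> t)) = 0"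
    proof (rule set_integral_eq_zero_AE)
      show "AE t\<in>{0..T} in lborel. \<rho> * C * (\<theta>t t \<bullet> \<eta> t) + \<kappa> * (N\<theta> t \<bullet> N\<eta> t) + convolution k N\<theta> t \<bullet> N\<eta> t
        - T\<^sub>0 * \<gamma> * (ut t \<bullet> N\<eta> t) = 0"
        using AE_Ioo_imp_Icc[OF e2]
        by eventually_elim (use mem(4) in \<open>simp add: N\<theta>_def[abs_def] N\<eta>_def\<close>)
    qed
    then show ?thesis
      using i5(1) i8(1) i9(1) i6(1) by (simp add: set_integral_add set_integral_diff)
  qed
  have E4: "- \<rho> * C * ?I (\<lambda>t. \<theta> t \<bullet> \<eta>t t) + \<kappa> * ?I (\<lambda>t. N\<theta> t \<bullet> N\<eta> t) + ?I (\<lambda>t. N\<theta> t \<bullet> adjoint_convolution T k N\<eta> t)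
      + \<gamma> * ?I (\<lambda>t. N\<theta> t \<bullet> v t) = 0"
  proof -
    have "?I (\<lambda>t. - \<rho> * C * (\<theta> t \<bullet> \<eta>t t) + \<kappa> * (N\<theta> t \<bullet> N\<eta> t) + N\<theta> t \<bullet> adjoint_convolution T k N\<eta> t
      + \<gamma> * (N\<theta> t \<bullet> v t)) = 0"
    proof (rule set_integral_eq_zero_AE)
      show "AE t\<in>{0..T} in lborel. - \<rho> * C * (\<theta> t \<bullet> \<eta>t t) + \<kappa> * (N\<theta> t \<bullet> N\<eta> t) + N\<theta> t \<bullet> adjoint_convolution T k N\<eta> t
        + \<gamma> * (N\<theta> t \<bullet> v t) = 0"
        using AE_Ioo_imp_Icc[OF e4]
        by eventually_elim (use mem(3) in \<open>simp add: N\<theta>_def N\<eta>_def[abs_def] inner_commute[of "\<theta> _"] inner_commute[of "grad \<Omega> (\<theta> _)"]\<close>)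
    qed
    then show ?thesis
      using i5(2) i8(1) i9(2) i7(1) by (simp add: set_integral_add set_integral_diff)
  qed
  have uT: "(LINT s:{0..T}|lborel. ut s) = u T"
    using has_time_derivD(2)[OF u(2) T'(2)] init by simp
  \<comment> \<open>The terminal velocity enters here, through \<open>velocity\<close> at time
    \<open>T\<close>. The end values of \<open>P\<close> and \<open>Q\<close> that come with it are
    those left by the product rules below, and the four tested identities absorb them.\<close>
  have "\<rho> * (w \<bullet> u T) = \<rho> * (vt 0 \<bullet> u T) - \<mu> * (P T \<bullet> Mu T) - (lam + \<mu>) * (div_l2 (P T) \<bullet> div_l2 (Mu T)) - \<gamma> * T\<^sub>0 * (Q T \<bullet> u T)"
    using velocity[OF mem(1)[OF T'(2)] T'(2)] fin by (simp add: Mu_def)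
  moreover have "?I (\<lambda>t. utt t \<bullet> v t) + ?I (\<lambda>t. ut t \<bullet> vt t) = 0"
    using i1(3) init fin by simp
  moreover have "?I (\<lambda>t. Mv t \<bullet> Mu t) + ?I (\<lambda>t. P t \<bullet> Gu t) = P T \<bullet> Mu T"
    using i2(3) bdry by simp
  moreover have "?I (\<lambda>t. div_l2 (Mv t) \<bullet> div_l2 (Mu t)) + ?I (\<lambda>t. div_l2 (P t) \<bullet> div_l2 (Gu t)) = div_l2 (P T) \<bullet> div_l2 (Mu T)"
    using i3(3) bdry by (simp add: l2_map_zero[OF linear_trace])
  moreover have "?I (\<lambda>t. G\<eta> t \<bullet> u t) + ?I (\<lambda>t. Q t \<bullet> ut t) = Q T \<bullet> u T"
    using i4(3) bdry by simp
  moreover have "?I (\<lambda>t. \<theta>t t \<bullet> \<eta> t) + ?I (\<lambda>t. \<theta> t \<bullet> \<eta>t t) = 0"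
    using i5(3) init fin by simp
  moreover have "?I (\<lambda>t. ut t \<bullet> N\<eta> t) + ?I (\<lambda>t. G\<eta> t \<bullet> u t) = 0"
    using i6(3) init bdry by (simp add: inner_commute)
  moreover have "?I (\<lambda>t. ut t \<bullet> vt 0) = vt 0 \<bullet> u T"
    using i10(2) uT by (simp add: inner_commute)
  ultimately show ?thesis
    using E1 E2 E3 E4 i9(3) by algebra
qed

section \<open>Derivative of the cost and uniqueness of the Riesz gradient\<close>

lemma has_gateaux_deriv_cost:
  fixes f \<delta> \<Xi> :: "'h::real_inner"
  assumes "\<And>\<epsilon>. U (f + \<epsilon> *\<^sub>R \<delta>) T = U f T + \<epsilon> *\<^sub>R U \<delta> T"
  shows "has_gateaux_deriv (cost U T \<Xi> \<beta>) f \<delta> ((U f T - \<Xi>) \<bullet> U \<delta> T + \<beta> * (f \<bullet> \<delta>))"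
  unfolding has_gateaux_deriv_def
proof (rule Lim_transform_eventually)
  let ?D = "(U f T - \<Xi>) \<bullet> U \<delta> T + \<beta> * (f \<bullet> \<delta>)"
  \<comment> \<open>The coefficient of \<epsilon>^2 in the expansion of the cost along the line, so
    that the difference quotient is exactly \<open>?D + \<epsilon> * ?c\<close> for nonzero
    \<epsilon>.\<close>
  let ?c = "(norm (U \<delta> T))\<^sup>2 / 2 + \<beta> / 2 * (norm \<delta>)\<^sup>2"
  have "((\<lambda>\<epsilon>. ?D + \<epsilon> * ?c) \<longlongrightarrow> ?D + 0 * ?c) (at 0)"
    by (intro tendsto_intros)
  then show "((\<lambda>\<epsilon>. ?D + \<epsilon> * ?c) \<longlongrightarrow> ?D) (at 0)" by simp
  have "cost U T \<Xi> \<beta> (f + \<epsilon> *\<^sub>R \<delta>) - cost U T \<Xi> \<beta> f = \<epsilon> * (?D + \<epsilon> * ?c)" for \<epsilon>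
  proof -
    have *: "(norm (a + \<epsilon> *\<^sub>R b))\<^sup>2 = (norm a)\<^sup>2 + 2 * \<epsilon> * (a \<bullet> b) + \<epsilon>\<^sup>2 * (norm b)\<^sup>2" for a b :: 'h
      unfolding power2_norm_eq_inner
      by (simp add: inner_add_left inner_add_right inner_commute power2_eq_square algebra_simps)
    have e: "U (f + \<epsilon> *\<^sub>R \<delta>) T - \<Xi> = (U f T - \<Xi>) + \<epsilon> *\<^sub>R U \<delta> T" by (simp add: assms)
    show ?thesis
      unfolding cost_def e * by (simp add: power2_eq_square field_simps)
  qed
  then show "\<forall>\<^sub>F \<epsilon> in at 0. ?D + \<epsilon> * ?c = (cost U T \<Xi> \<beta> (f + \<epsilon> *\<^sub>R \<delta>) - cost U T \<Xi> \<beta> f) / \<epsilon>"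
    by (auto simp: eventually_at_filter)
qed

text \<open>The difference \<open>G - G'\<close> is itself an admissible direction; both gradients
  represent the derivative along it, and limits are unique.\<close>

lemma is_riesz_gradient_unique:
  assumes "subspace H" "is_riesz_gradient H J f G" "is_riesz_gradient H J f G'"
  shows "G = G'"
proof -
  have H: "G \<in> H" "G' \<in> H" using assms by (auto simp: is_riesz_gradient_def)
  then have "G - G' \<in> H" by (rule subspace_diff[OF assms(1)])
  then have "has_gateaux_deriv J f (G - G') (G \<bullet> (G - G'))" "has_gateaux_deriv J f (G - G') (G' \<bullet> (G - G'))"
    using assms by (auto simp: is_riesz_gradient_def)
  then have "G \<bullet> (G - G') = G' \<bullet> (G - G')"
    unfolding has_gateaux_deriv_def by (rule tendsto_unique[OF trivial_limit_at])
  then have "(G - G') \<bullet> (G - G') = 0" by (simp add: inner_diff_left)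
  then show ?thesis by simp
qed

theorem theorem4p6:
  fixes \<Omega> :: "(real^'n) set"
    and T \<rho> C\<^sub>s \<kappa> T\<^sub>0 lam \<mu> \<alpha>\<^sub>T \<gamma> \<beta> :: real
    and k g :: "real \<Rightarrow> real"
    and U :: "(real^'n, real^'n) l2 \<Rightarrow> real \<Rightarrow> (real^'n, real^'n) l2"
    and \<Theta> :: "(real^'n, real^'n) l2 \<Rightarrow> real \<Rightarrow> (real^'n, real) l2"
    and \<Xi> f :: "(real^'n, real^'n) l2"
    and u' :: "real \<Rightarrow> (real^'n, real^'n) l2"
    and \<theta>' :: "real \<Rightarrow> (real^'n, real) l2"
  assumes domain: "open \<Omega>" "bounded \<Omega>" "lipschitz_boundary \<Omega>"
    and pos: "T > 0" "\<rho> > 0" "C\<^sub>s > 0" "\<kappa> > 0" "T\<^sub>0 > 0" "lam > 0" "\<mu> > 0" "\<alpha>\<^sub>T > 0"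
    and gamma: "\<gamma> = \<alpha>\<^sub>T * (3 * lam + 2 * \<mu>)"
    and kernel: "C_k_on 2 T k" "strongly_positive_definite_kernel T k" "(k \<longlongrightarrow> 0) at_top"
      "\<forall>j\<le>2. \<forall>t\<in>{0..T}. (- 1) ^ j * (dt_on T ^^ j) k t \<ge> 0"
      "\<exists>t\<in>{0..T}. dt_on T k t \<noteq> 0"
    and g: "C_k_on 1 T g" "\<forall>t\<in>{0..T}. dt_on T (\<lambda>t. (g t)\<^sup>2) t > 0"
    and direct: "\<And>f. f \<in> L2 \<Omega> \<Longrightarrow> forward_solution \<Omega> T \<rho> C\<^sub>s \<kappa> T\<^sub>0 lam \<mu> \<gamma> k g f (U f) (\<Theta> f)"
    and data: "\<Xi> \<in> L2 \<Omega>" "\<beta> \<ge> 0" "f \<in> L2 \<Omega>"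
    and adjoint: "adjoint_solution \<Omega> T \<rho> C\<^sub>s \<kappa> T\<^sub>0 lam \<mu> \<gamma> k (U f T - \<Xi>) u' \<theta>'"
  shows "is_riesz_gradient (L2 \<Omega>) (cost U T \<Xi> \<beta>) f G \<longleftrightarrow>
    G = - (1 / \<rho>) *\<^sub>R (LINT t:{0..T}|lborel. g t *\<^sub>R u' t) + \<beta> *\<^sub>R f"
proof -
  note kc = C_k_on_continuous[OF kernel(1)] and gc = C_k_on_continuous[OF g(1)]
  have u': "C_H10_vec \<Omega> T u'" "C_L2 \<Omega> T u'"
  proof -
    show "C_H10_vec \<Omega> T u'" using adjoint by (auto simp: adjoint_solution_def)
    then show "C_L2 \<Omega> T u'"
      using H10_vec_subset_L2[OF domain(1)] by (auto simp: C_H10_vec_def C_L2_def)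
  qed
  have gu: "set_integrable lborel {0..T} (\<lambda>t. g t *\<^sub>R u' t)"
    using u'(2) by (intro borel_integrable_atLeastAtMost' continuous_intros gc) (auto simp: C_L2_def)
  let ?G = "- (1 / \<rho>) *\<^sub>R (LINT t:{0..T}|lborel. g t *\<^sub>R u' t) + \<beta> *\<^sub>R f"
  have "is_riesz_gradient (L2 \<Omega>) (cost U T \<Xi> \<beta>) f ?G"
    unfolding is_riesz_gradient_def
  proof (intro conjI ballI)
    have "(LINT t:{0..T}|lborel. g t *\<^sub>R u' t) \<in> L2 \<Omega>"
      using domain(1) u'(2) by (intro L2_integral gu) (auto simp: C_L2_def intro!: subspace_scale[OF subspace_L2])
    then show "?G \<in> L2 \<Omega>"
      by (intro subspace_add[OF subspace_L2] subspace_scale[OF subspace_L2] data)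
    fix \<delta> :: "(real^'n, real^'n) l2" assume \<delta>: "\<delta> \<in> L2 \<Omega>"
    \<comment> \<open>\<open>U\<close> is an arbitrary choice of solutions, one for each source; its
      linearity comes from uniqueness for the direct problem.\<close>
    have lin: "U (f + \<epsilon> *\<^sub>R \<delta>) T = U f T + \<epsilon> *\<^sub>R U \<delta> T" for \<epsilon>
    proof (rule forward_solution_linear[OF domain(1) kc pos(1-7) direct[OF data(3)] direct[OF \<delta>] direct])
      show "f + \<epsilon> *\<^sub>R \<delta> \<in> L2 \<Omega>"
        by (intro subspace_add[OF subspace_L2] subspace_scale[OF subspace_L2] data \<delta>)
    qed (use pos in auto)
    \<comment> \<open>Duality is applied to the direct solution with source \<delta>, while the
      adjoint terminal data come from the solution with source \<open>f\<close>.\<close>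
    have "\<rho> * ((U f T - \<Xi>) \<bullet> U \<delta> T) = - (LINT t:{0..T}|lborel. (g t *\<^sub>R \<delta>) \<bullet> u' t)"
      by (rule duality[OF domain(1) pos(1) kc gc direct[OF \<delta>] adjoint])
    also have "\<dots> = - ((LINT t:{0..T}|lborel. g t *\<^sub>R u' t) \<bullet> \<delta>)"
      unfolding set_integrable_inner_const(2)[OF gu, symmetric] by (simp add: inner_commute)
    finally have "(U f T - \<Xi>) \<bullet> U \<delta> T + \<beta> * (f \<bullet> \<delta>) = ?G \<bullet> \<delta>"
      using pos(2) unfolding inner_add_left inner_scaleR_left by (simp add: field_simps)
    with has_gateaux_deriv_cost[where U = U and T = T and \<Xi> = \<Xi> and \<beta> = \<beta>, OF lin]
    show "has_gateaux_deriv (cost U T \<Xi> \<beta>) f \<delta> (?G \<bullet> \<delta>)" by simp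
  qed
  then show ?thesis using is_riesz_gradient_unique[OF subspace_L2] by blast
qed

end
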